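(* Let $m$ and $n$ be non-negative integers. The cohomology of the complex $C_{m,n}$ of $U_q(\mathfrak{sl}_3)$-modules is concentrated in degree $0$, where it is isomorphic to the irreducible $U_q(\mathfrak{sl}_3)$-module $V_{m,n}$.
   Context: **The algebra.** The ground field is $\mathbb{K}=\mathbb{C}(q^{1/6})$ and $[2]=q+q^{-1}$. $U_q(\mathfrak{sl}_3)$ is the unital associative $\mathbb{K}$-algebra generated by $K_i^{\pm1},E_i,F_i$ ($i\in\{1,2\}$) with relations, for $i\ne j$: $K_iK_i^{-1}=K_i^{-1}K_i=1$, $K_iK_j=K_jK_i$, $K_iE_i=q^2E_iK_i$, $K_iF_i=q^{-2}F_iK_i$, $K_iE_j=q^{-1}E_jK_i$, $K_iF_j=qF_jK_i$, $(q-q^{-1})(E_iF_i-F_iE_i)=K_i-K_i^{-1}$, $E_iF_j=F_jE_i$, $E_i^2E_j-[2]E_iE_jE_i+E_jE_i^2=0$, $F_i^2F_j-[2]F_iF_jF_i+F_jF_i^2=0$. It acts on tensor products through $\Delta(K_i^{\pm1})=K_i^{\pm1}\otimes K_i^{\pm1}$, $\Delta(E_i)=E_i\otimes K_i+1\otimes E_i$, $\Delta(F_i)=F_i\otimes1+K_i^{-1}\otimes F_i$, and on the trivial module through $\varepsilon(K_i^{\pm1})=1$, $\varepsilon(E_i)=\varepsilon(F_i)=0$. **Modules.** For $m,n\ge0$, $V_{m,n}$ is the (unique up to isomorphism) finite-dimensional simple module containing a non-zero vector $v$ with $E_1v=E_2v=0$, $K_1v=q^mv$, $K_2v=q^nv$.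 $V_{0,0}$ is the trivial module $\mathbb{K}$. The module $V_+=V_{1,0}$ has basis $v^+_{-1},v^+_0,v^+_1$, on which $K_1$ acts diagonally by $1,q^{-1},q$ and $K_2$ by $q^{-1},q,1$ (in this order), with $E_1v^+_0=v^+_1$, $E_2v^+_{-1}=v^+_0$, $F_1v^+_1=v^+_0$, $F_2v^+_0=v^+_{-1}$ and all other actions of $E_i,F_i$ on basis vectors zero. The module $V_-=V_{0,1}$ has basis $v^-_{-1},v^-_0,v^-_1$, on which $K_1$ acts by $q^{-1},q,1$ and $K_2$ by $1,q^{-1},q$, with $E_1v^-_{-1}=v^-_0$, $E_2v^-_0=v^-_1$, $F_1v^-_0=v^-_{-1}$, $F_2v^-_1=v^-_0$ and all other actions of $E_i,F_i$ zero. **Morphisms.** The following are module morphisms (elementary tensors of basis vectors not listed are sent to $0$). $d_{-+}:V_-\otimes V_+\to V_{0,0}$ and $d_{+-}:V_+\otimes V_-\to V_{0,0}$: for $(\sigma,\tau)=(-,+)$ or $(+,-)$, $d_{\sigma\tau}(v^\sigma_{-1}\otimes v^\tau_1)=-q^{-1}$, $d_{\sigma\tau}(v^\sigma_0\otimes v^\tau_0)=1$, $d_{\sigma\tau}(v^\sigma_1\otimes v^\tau_{-1})=-q$. $h_{++}^-:V_+\otimes V_+\to V_-$ and $h_{--}^+:V_-\otimes V_-\to V_+$: for $(\sigma,\tau)=(+,-)$ or $(-,+)$, $h^{\tau}_{\sigma\sigma}$ sends $v^\sigma_{-1}\otimes v^\sigma_0\mapsto q^{-1/2}v^\tau_{-1}$,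 $v^\sigma_0\otimes v^\sigma_{-1}\mapsto-q^{1/2}v^\tau_{-1}$, $v^\sigma_{-1}\otimes v^\sigma_1\mapsto q^{-1/2}v^\tau_0$, $v^\sigma_1\otimes v^\sigma_{-1}\mapsto-q^{1/2}v^\tau_0$, $v^\sigma_0\otimes v^\sigma_1\mapsto q^{-1/2}v^\tau_1$, $v^\sigma_1\otimes v^\sigma_0\mapsto-q^{1/2}v^\tau_1$. **The graph $\Gamma_{m,n}$.** Let $\epsilon(m,n)$ be the sequence of $m+n$ dots, the first $m$ colored $+$ and the last $n$ colored $-$. A compatible (or admissible) partition of $\epsilon(m,n)$ is a partition into non-empty sets of consecutive dots, each of cardinality at most $3$, such that every set with three elements has all its elements of the same color. The vertices of $\Gamma_{m,n}$ are the compatible partitions; there is an edge $P_1\to P_2$ iff $P_2$ is obtained from $P_1$ by merging two sets of $P_1$. A partition with $k$ sets has degree $m+n-k$. **The complex $C_{m,n}$.** To a compatible partition $P$ associate $\widetilde C_{m,n}(P)$, the tensor product, from left to right over the sets of $P$, of: $V_+$ for $\{+\}$ or $\{--\}$; $V_-$ for $\{-\}$ or $\{++\}$; $V_{0,0}$ for $\{+-\}$, $\{+++\}$ or $\{---\}$. To an edge $e:P_1\to P_2$ associate the morphism $d_e:\widetilde C_{m,n}(P_1)\to\widetilde C_{m,n}(P_2)$ which is the identity on the factors of the sets not involved, and on the two merged sets is: $d_{+-}$ for $\{+\},\{-\}$; $h_{++}^-$ for $\{+\},\{+\}$; $h_{--}^+$ for $\{-\},\{-\}$; $d_{-+}$ for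 $\{++\},\{+\}$; $d_{+-}$ for $\{+\},\{++\}$; $d_{+-}$ for $\{--\},\{-\}$; $d_{-+}$ for $\{-\},\{--\}$. All squares commute. The complex $C_{m,n}$ has $C_{m,n}^i=\bigoplus_{\deg P=i}\widetilde C_{m,n}(P)$ and differential the sum of the maps $\pm d_e$, the signs being chosen so that all squares anti-commute. For example, encode $P$ by the set $J$ of those $j\in\{1,\dots,m+n-1\}$ for which dots $j,j+1$ lie in the same set, and multiply the edge map $J\to J\cup\{i\}$ by $(-1)^{\#\{j\in J: j<i\}}$. All such choices of signs give isomorphic complexes. *)

theory Defs
  imports
    "HOL-Computational_Algebra.Computational_Algebra"
    "HOL-Library.Poly_Mapping"
    "HOL-Algebra.Module"
    "HOL-Algebra.AbelCoset"
    "HOL-Algebra.Algebraic_Closure_Type"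
begin

section \<open>The ground field\<close>

text \<open>The indeterminate of the rational function field is \<open>q\<^sup>1\<^sup>/\<^sup>6\<close>.\<close>

type_synonym kk = "complex poly fract"

definition q_sixth :: kk where "q_sixth = Fract [:0, 1:] 1"

definition q :: kk where "q = q_sixth ^ 6"

definition q_half :: kk where "q_half = q_sixth ^ 3"

abbreviation kk_ring :: "kk ring" where
  "kk_ring \<equiv> ring_of_type_algebra"


section \<open>Modules over quantum \<open>sl\<^sub>3\<close>\<close>

datatype node = N1 | N2

datatype generator = K node | Kinv node | E node | F node

text \<open>
  A module over the algebra presented by these generators is a vector space with one linear
  operator per generator, subject to the defining relations.  The fields \<open>mult\<close> and \<open>one\<close>
  inherited from the record type \<open>module\<close> are never used.
\<close>

record 'v uq_module = "(kk, 'v) module" +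
  act :: "generator \<Rightarrow> 'v \<Rightarrow> 'v"

locale uq_sl3_module = module kk_ring M for M :: "'v uq_module" (structure) +
  assumes act_closed: "v \<in> carrier M \<Longrightarrow> act M g v \<in> carrier M"
    and act_add: "\<lbrakk>v \<in> carrier M; w \<in> carrier M\<rbrakk> \<Longrightarrow> act M g (v \<oplus> w) = act M g v \<oplus> act M g w"
    and act_smult: "v \<in> carrier M \<Longrightarrow> act M g (c \<odot>\<^bsub>M\<^esub> v) = c \<odot>\<^bsub>M\<^esub> act M g v"
    and K_Kinv: "v \<in> carrier M \<Longrightarrow> act M (K i) (act M (Kinv i) v) = v"
    and Kinv_K: "v \<in> carrier M \<Longrightarrow> act M (Kinv i) (act M (K i) v) = v"
    and K_K: "v \<in> carrier M \<Longrightarrow> act M (K i) (act M (K j) v) = act M (K j) (act M (K i) v)"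
    and K_E_same: "v \<in> carrier M \<Longrightarrow>
      act M (K i) (act M (E i) v) = q\<^sup>2 \<odot>\<^bsub>M\<^esub> act M (E i) (act M (K i) v)"
    and K_F_same: "v \<in> carrier M \<Longrightarrow>
      act M (K i) (act M (F i) v) = inverse (q\<^sup>2) \<odot>\<^bsub>M\<^esub> act M (F i) (act M (K i) v)"
    and K_E_diff: "\<lbrakk>v \<in> carrier M; i \<noteq> j\<rbrakk> \<Longrightarrow>
      act M (K i) (act M (E j) v) = inverse q \<odot>\<^bsub>M\<^esub> act M (E j) (act M (K i) v)"
    and K_F_diff: "\<lbrakk>v \<in> carrier M; i \<noteq> j\<rbrakk> \<Longrightarrow>
      act M (K i) (act M (F j) v) = q \<odot>\<^bsub>M\<^esub> act M (F j) (act M (K i) v)"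
    and E_F_same: "v \<in> carrier M \<Longrightarrow>
      (q - inverse q) \<odot>\<^bsub>M\<^esub> (act M (E i) (act M (F i) v) \<ominus> act M (F i) (act M (E i) v)) =
      act M (K i) v \<ominus> act M (Kinv i) v"
    and E_F_diff: "\<lbrakk>v \<in> carrier M; i \<noteq> j\<rbrakk> \<Longrightarrow>
      act M (E i) (act M (F j) v) = act M (F j) (act M (E i) v)"
    and E_Serre: "\<lbrakk>v \<in> carrier M; i \<noteq> j\<rbrakk> \<Longrightarrow>
      act M (E i) (act M (E i) (act M (E j) v))
      \<ominus> (q + inverse q) \<odot>\<^bsub>M\<^esub> act M (E i) (act M (E j) (act M (E i) v))
      \<oplus> act M (E j) (act M (E i) (act M (E i) v)) = \<zero>"
    and F_Serre: "\<lbrakk>v \<in> carrier M; i \<noteq> j\<rbrakk> \<Longrightarrow>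
      act M (F i) (act M (F i) (act M (F j) v))
      \<ominus> (q + inverse q) \<odot>\<^bsub>M\<^esub> act M (F i) (act M (F j) (act M (F i) v))
      \<oplus> act M (F j) (act M (F i) (act M (F i) v)) = \<zero>"

definition uq_submodule :: "'v set \<Rightarrow> 'v uq_module \<Rightarrow> bool" where
  "uq_submodule H M \<longleftrightarrow> submodule H kk_ring M \<and> (\<forall>g. \<forall>v\<in>H. act M g v \<in> H)"

definition simple_uq_module :: "'v uq_module \<Rightarrow> bool" where
  "simple_uq_module M \<longleftrightarrow> uq_sl3_module M \<and> carrier M \<noteq> {\<zero>\<^bsub>M\<^esub>} \<and>
     (\<forall>H. uq_submodule H M \<longrightarrow> H = {\<zero>\<^bsub>M\<^esub>} \<or> H = carrier M)"

definition finite_dimensional :: "'v uq_module \<Rightarrow> bool" where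
  "finite_dimensional M \<longleftrightarrow> (\<exists>A. finite A \<and> A \<subseteq> carrier M \<and>
     (\<forall>v\<in>carrier M. \<exists>c. v = (\<Oplus>\<^bsub>M\<^esub>a\<in>A. c a \<odot>\<^bsub>M\<^esub> a)))"

definition is_V :: "nat \<Rightarrow> nat \<Rightarrow> 'v uq_module \<Rightarrow> bool" where
  "is_V m n M \<longleftrightarrow> simple_uq_module M \<and> finite_dimensional M \<and>
     (\<exists>v\<in>carrier M. v \<noteq> \<zero>\<^bsub>M\<^esub> \<and>
        act M (E N1) v = \<zero>\<^bsub>M\<^esub> \<and> act M (E N2) v = \<zero>\<^bsub>M\<^esub> \<and>
        act M (K N1) v = q ^ m \<odot>\<^bsub>M\<^esub> v \<and> act M (K N2) v = q ^ n \<odot>\<^bsub>M\<^esub> v)"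

definition uq_hom :: "'v uq_module \<Rightarrow> 'w uq_module \<Rightarrow> ('v \<Rightarrow> 'w) set" where
  "uq_hom M N = {f \<in> carrier M \<rightarrow> carrier N.
     (\<forall>v\<in>carrier M. \<forall>w\<in>carrier M. f (v \<oplus>\<^bsub>M\<^esub> w) = f v \<oplus>\<^bsub>N\<^esub> f w) \<and>
     (\<forall>c. \<forall>v\<in>carrier M. f (c \<odot>\<^bsub>M\<^esub> v) = c \<odot>\<^bsub>N\<^esub> f v) \<and>
     (\<forall>g. \<forall>v\<in>carrier M. f (act M g v) = act N g (f v))}"

definition uq_isomorphic :: "'v uq_module \<Rightarrow> 'w uq_module \<Rightarrow> bool" where
  "uq_isomorphic M N \<longleftrightarrow> (\<exists>f \<in> uq_hom M N. bij_betw f (carrier M) (carrier N))"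

definition quotient_module :: "'v uq_module \<Rightarrow> 'v set \<Rightarrow> 'v set uq_module" where
  "quotient_module M B = \<lparr>carrier = a_rcosets\<^bsub>M\<^esub> B, monoid.mult = undefined, monoid.one = undefined,
     zero = B, add = set_add M, module.smult = (\<lambda>c Y. \<Union>v\<in>Y. B +>\<^bsub>M\<^esub> (c \<odot>\<^bsub>M\<^esub> v)),
     act = (\<lambda>g Y. \<Union>v\<in>Y. B +>\<^bsub>M\<^esub> act M g v)\<rparr>"


section \<open>Tensor products of the basic modules\<close>

text \<open>The type \<open>'b \<Rightarrow>\<^sub>0 kk\<close> is the vector space with basis \<open>'b\<close>.\<close>

abbreviation basis_vec :: "'b \<Rightarrow> 'b \<Rightarrow>\<^sub>0 kk" where
  "basis_vec b \<equiv> Poly_Mapping.single b 1"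

definition scale :: "kk \<Rightarrow> ('b \<Rightarrow>\<^sub>0 kk) \<Rightarrow> ('b \<Rightarrow>\<^sub>0 kk)" where
  "scale c v = Poly_Mapping.map ((*) c) v"

definition lin_ext :: "('a \<Rightarrow> ('b \<Rightarrow>\<^sub>0 kk)) \<Rightarrow> ('a \<Rightarrow>\<^sub>0 kk) \<Rightarrow> ('b \<Rightarrow>\<^sub>0 kk)" where
  "lin_ext f v = (\<Sum>b\<in>Poly_Mapping.keys v. scale (Poly_Mapping.lookup v b) (f b))"

text \<open>\<open>V_Plus\<close>, \<open>V_Minus\<close> and \<open>V_Triv\<close> name \<open>V\<^sub>+\<close>, \<open>V\<^sub>-\<close> and \<open>V\<^sub>0\<^sub>,\<^sub>0\<close>.\<close>

datatype factor = V_Plus | V_Minus | V_Triv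

text \<open>
  The basis vector \<open>v\<^sub>a\<close> of \<open>V\<^sub>+\<close> or \<open>V\<^sub>-\<close> is labelled by the integer \<open>a\<close>; the basis vector \<open>1\<close>
  of the trivial module is labelled by \<open>0\<close>.
\<close>

fun labels :: "factor \<Rightarrow> int set" where
  "labels V_Plus = {-1, 0, 1}"
| "labels V_Minus = {-1, 0, 1}"
| "labels V_Triv = {0}"

text \<open>\<open>K i\<close> acts on the basis vector labelled \<open>a\<close> by \<open>q powi weight V i a\<close>.\<close>

fun weight :: "factor \<Rightarrow> node \<Rightarrow> int \<Rightarrow> int" where
  "weight V_Plus N1 a = (if a = -1 then 0 else if a = 0 then -1 else 1)"
| "weight V_Plus N2 a = (if a = -1 then -1 else if a = 0 then 1 else 0)"
| "weight V_Minus N1 a = (if a = -1 then -1 else if a = 0 then 1 else 0)"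
| "weight V_Minus N2 a = (if a = -1 then 0 else if a = 0 then -1 else 1)"
| "weight V_Triv i a = 0"

text \<open>\<open>E i\<close> raises \<open>source V i\<close> by one and \<open>F i\<close> undoes this; all other basis vectors are killed.\<close>

fun source :: "factor \<Rightarrow> node \<Rightarrow> int option" where
  "source V_Plus N1 = Some 0"
| "source V_Plus N2 = Some (-1)"
| "source V_Minus N1 = Some (-1)"
| "source V_Minus N2 = Some 0"
| "source V_Triv i = None"

fun factor_act :: "factor \<Rightarrow> generator \<Rightarrow> int \<Rightarrow> (int \<Rightarrow>\<^sub>0 kk)" where
  "factor_act V (K i) a = scale (q powi weight V i a) (basis_vec a)"
| "factor_act V (Kinv i) a = scale (q powi (- weight V i a)) (basis_vec a)"
| "factor_act V (E i) a = (if source V i = Some a then basis_vec (a + 1) else 0)"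
| "factor_act V (F i) a = (if source V i = Some (a - 1) then basis_vec (a - 1) else 0)"

text \<open>
  The basis vector \<open>v\<^sub>a\<^sub>1 \<otimes> \<dots> \<otimes> v\<^sub>a\<^sub>k\<close> of a tensor product is labelled by the word \<open>[a1, \<dots>, ak]\<close>;
  \<open>tensor\<close> is the tensor product of a vector in the first factor with one in the remaining factors.
\<close>

definition tensor :: "(int \<Rightarrow>\<^sub>0 kk) \<Rightarrow> (int list \<Rightarrow>\<^sub>0 kk) \<Rightarrow> (int list \<Rightarrow>\<^sub>0 kk)" where
  "tensor v x = lin_ext (\<lambda>a. lin_ext (\<lambda>w. basis_vec (a # w)) x) v"

fun counit :: "generator \<Rightarrow> kk" where
  "counit (K i) = 1"
| "counit (Kinv i) = 1"
| "counit (E i) = 0"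
| "counit (F i) = 0"

text \<open>
  The action of the generators on basis vectors of a tensor product, by the (coassociative)
  coproduct; on the empty product, which is the trivial module, it is given by the counit.
\<close>

fun word_act :: "factor list \<Rightarrow> generator \<Rightarrow> int list \<Rightarrow> (int list \<Rightarrow>\<^sub>0 kk)" where
  "word_act [] g [] = scale (counit g) (basis_vec [])"
| "word_act (V # Vs) (K i) (a # w) = tensor (factor_act V (K i) a) (word_act Vs (K i) w)"
| "word_act (V # Vs) (Kinv i) (a # w) = tensor (factor_act V (Kinv i) a) (word_act Vs (Kinv i) w)"
| "word_act (V # Vs) (E i) (a # w) =
     tensor (factor_act V (E i) a) (word_act Vs (K i) w) +
     tensor (basis_vec a) (word_act Vs (E i) w)"
| "word_act (V # Vs) (F i) (a # w) =
     tensor (factor_act V (F i) a) (basis_vec w) +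
     tensor (factor_act V (Kinv i) a) (word_act Vs (F i) w)"
| "word_act _ _ _ = 0"

definition tensor_module :: "factor list \<Rightarrow> (int list \<Rightarrow>\<^sub>0 kk) uq_module" where
  "tensor_module Vs = \<lparr>carrier = {x. Poly_Mapping.keys x \<subseteq> listset (map labels Vs)},
     monoid.mult = undefined, monoid.one = undefined, zero = 0, add = (+), module.smult = scale,
     act = (\<lambda>g. lin_ext (word_act Vs g))\<rparr>"


section \<open>The elementary morphisms\<close>

text \<open>The common formula for \<open>d\<^sub>+\<^sub>-\<close> and \<open>d\<^sub>-\<^sub>+\<close>, with values in the trivial module.\<close>

definition d_map :: "int \<Rightarrow> int \<Rightarrow> (int \<Rightarrow>\<^sub>0 kk)" where
  "d_map a b =
    (if (a, b) = (-1, 1) then scale (- inverse q) (basis_vec 0)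
     else if (a, b) = (0, 0) then basis_vec 0
     else if (a, b) = (1, -1) then scale (- q) (basis_vec 0)
     else 0)"

text \<open>The common formula for \<open>V\<^sub>+ \<otimes> V\<^sub>+ \<rightarrow> V\<^sub>-\<close> and \<open>V\<^sub>- \<otimes> V\<^sub>- \<rightarrow> V\<^sub>+\<close>.\<close>

definition h_map :: "int \<Rightarrow> int \<Rightarrow> (int \<Rightarrow>\<^sub>0 kk)" where
  "h_map a b =
    (if (a, b) = (-1, 0) then scale (inverse q_half) (basis_vec (-1))
     else if (a, b) = (0, -1) then scale (- q_half) (basis_vec (-1))
     else if (a, b) = (-1, 1) then scale (inverse q_half) (basis_vec 0)
     else if (a, b) = (1, -1) then scale (- q_half) (basis_vec 0)
     else if (a, b) = (0, 1) then scale (inverse q_half) (basis_vec 1)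
     else if (a, b) = (1, 0) then scale (- q_half) (basis_vec 1)
     else 0)"


section \<open>Compatible partitions\<close>

datatype sign = Pos | Neg

definition dots :: "nat \<Rightarrow> nat \<Rightarrow> sign list" where
  "dots m n = replicate m Pos @ replicate n Neg"

text \<open>
  A partition of a sequence of dots into sets of consecutive dots is the list, from left to
  right, of the colour sequences of these sets; their concatenation is the given sequence.
\<close>

type_synonym cpart = "sign list list"

definition admissible_block :: "sign list \<Rightarrow> bool" where
  "admissible_block B \<longleftrightarrow> B \<noteq> [] \<and> length B \<le> 3 \<and>
     (length B = 3 \<longrightarrow> (\<forall>s\<in>set B. \<forall>t\<in>set B. s = t))"

definition compatible :: "nat \<Rightarrow> nat \<Rightarrow> cpart \<Rightarrow> bool" where
  "compatible m n P \<longleftrightarrow> concat P = dots m n \<and> (\<forall>B\<in>set P. admissible_block B)"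

definition deg :: "cpart \<Rightarrow> int" where
  "deg P = int (length (concat P)) - int (length P)"

definition block_factor :: "sign list \<Rightarrow> factor" where
  "block_factor B =
    (if B = [Pos] \<or> B = [Neg, Neg] then V_Plus
     else if B = [Neg] \<or> B = [Pos, Pos] then V_Minus
     else V_Triv)"

definition C_tilde :: "cpart \<Rightarrow> (int list \<Rightarrow>\<^sub>0 kk) uq_module" where
  "C_tilde P = tensor_module (map block_factor P)"

text \<open>The edges of the graph leaving \<open>P\<close>: merging the blocks number \<open>k\<close> and \<open>k + 1\<close> (from \<open>0\<close>).\<close>

definition merge :: "cpart \<Rightarrow> nat \<Rightarrow> cpart" where
  "merge P k = take k P @ [P ! k @ P ! Suc k] @ drop (Suc (Suc k)) P"

definition edges_from :: "cpart \<Rightarrow> nat set" where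
  "edges_from P = {k. Suc k < length P \<and> admissible_block (P ! k @ P ! Suc k)}"

definition merge_map :: "sign list \<Rightarrow> sign list \<Rightarrow> int \<Rightarrow> int \<Rightarrow> (int \<Rightarrow>\<^sub>0 kk)" where
  "merge_map A B =
    (if (A, B) \<in> {([Pos], [Pos]), ([Neg], [Neg])} then h_map
     else if (A, B) \<in> {([Pos], [Neg]), ([Pos, Pos], [Pos]), ([Pos], [Pos, Pos]),
                       ([Neg, Neg], [Neg]), ([Neg], [Neg, Neg])} then d_map
     else (\<lambda>_ _. 0))"

definition edge_map :: "cpart \<Rightarrow> nat \<Rightarrow> (int list \<Rightarrow>\<^sub>0 kk) \<Rightarrow> (int list \<Rightarrow>\<^sub>0 kk)" where
  "edge_map P k = lin_ext (\<lambda>w.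
     lin_ext (\<lambda>c. basis_vec (take k w @ [c] @ drop (Suc (Suc k)) w))
       (merge_map (P ! k) (P ! Suc k) (w ! k) (w ! Suc k)))"

text \<open>The set \<open>J\<close> of those \<open>j\<close> for which dots \<open>j\<close> and \<open>j + 1\<close> (counted from \<open>1\<close>) lie in the same set.\<close>

definition joined :: "cpart \<Rightarrow> nat set" where
  "joined P = {1..<length (concat P)} - {length (concat (take k P)) | k. k \<le> length P}"

text \<open>
  Merging blocks \<open>k\<close> and \<open>k + 1\<close> adjoins to \<open>J\<close> the number \<open>i\<close> of dots in blocks \<open>0, \<dots>, k\<close>.
\<close>

definition edge_sign :: "cpart \<Rightarrow> nat \<Rightarrow> kk" where
  "edge_sign P k = (-1) ^ card {j \<in> joined P. j < length (concat (take (Suc k) P))}"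


section \<open>The complex and its cohomology\<close>

text \<open>
  Elements of the direct sum of the modules \<open>C_tilde P\<close> are finitely supported families of vectors
  indexed by the partitions.
\<close>

type_synonym cochain = "cpart \<Rightarrow>\<^sub>0 (int list \<Rightarrow>\<^sub>0 kk)"

definition C :: "nat \<Rightarrow> nat \<Rightarrow> int \<Rightarrow> cochain uq_module" where
  "C m n i = \<lparr>carrier = {x. \<forall>P \<in> Poly_Mapping.keys x.
       compatible m n P \<and> deg P = i \<and> Poly_Mapping.lookup x P \<in> carrier (C_tilde P)},
     monoid.mult = undefined, monoid.one = undefined, zero = 0, add = (+),
     module.smult = (\<lambda>c x. \<Sum>P\<in>Poly_Mapping.keys x.
       Poly_Mapping.single P (c \<odot>\<^bsub>C_tilde P\<^esub> Poly_Mapping.lookup x P)),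
     act = (\<lambda>g x. \<Sum>P\<in>Poly_Mapping.keys x.
       Poly_Mapping.single P (act (C_tilde P) g (Poly_Mapping.lookup x P)))\<rparr>"

definition differential :: "cochain \<Rightarrow> cochain" where
  "differential x = (\<Sum>P\<in>Poly_Mapping.keys x. \<Sum>k\<in>edges_from P.
     Poly_Mapping.single (merge P k)
       (scale (edge_sign P k) (edge_map P k (Poly_Mapping.lookup x P))))"

definition cocycles :: "nat \<Rightarrow> nat \<Rightarrow> int \<Rightarrow> cochain uq_module" where
  "cocycles m n i = (C m n i)\<lparr>carrier := {x \<in> carrier (C m n i). differential x = 0}\<rparr>"

text \<open>In degree \<open>0\<close> this is the zero submodule, since no partition has degree \<open>-1\<close>.\<close>

definition coboundaries :: "nat \<Rightarrow> nat \<Rightarrow> int \<Rightarrow> cochain set" where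
  "coboundaries m n i = differential ` carrier (C m n (i - 1))"

definition cohomology :: "nat \<Rightarrow> nat \<Rightarrow> int \<Rightarrow> cochain set uq_module" where
  "cohomology m n i = quotient_module (cocycles m n i) (coboundaries m n i)"

end

theory Submission
  imports Defs "HOL-Library.List_Lexorder"
begin

text \<open>
  Both assertions rest on a basis of the complex.  A basis vector of the summand of a partition
  \<open>P\<close> is a labelling of the blocks of \<open>P\<close>; replacing each block by the leading term of its
  label, a product of basis vectors of \<open>V\<^sub>+\<close> and \<open>V\<^sub>-\<close>, turns it into a word of \<open>m + n\<close> letters
  \<open>-1\<close>, \<open>0\<close>, \<open>1\<close>.  The letters of neighbouring dots of one block form a good pair: they ascend if the
  dots have equal colours, and they are \<open>(-1, 1)\<close> at the change of colour.  In other words, the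
  complex is a part of the bar complex of a quadratic algebra which has a basis of
  Poincare-Birkhoff-Witt type.  An edge of the graph maps a basis vector to a multiple of a basis
  vector: with the same word and a non-zero coefficient if it joins a good pair, and with a
  lexicographically smaller word, or to zero, otherwise.

  Hence, up to smaller words, the part of the complex that belongs to a word with at least one good
  pair is the complex of a simplex, and joining or splitting the first good pair is a contracting
  matching (\<open>matched_up\<close>, \<open>matched_down\<close>).  Every word that occurs in positive degree has a good
  pair, so the cohomology vanishes there (\<open>exact_if_matching\<close>, \<open>cocycle_is_coboundary\<close>).

  In degree \<open>0\<close> the cohomology is the intersection of the kernels of the maps \<open>h\<close> and \<open>d\<close> in
  \<open>V\<^sub>+\<^sup>\<otimes>\<^sup>m \<otimes> V\<^sub>-\<^sup>\<otimes>\<^sup>n\<close>.  The largest word of a non-zero vector of this intersection has no good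
  pair (\<open>H0_leading\<close>), and each word without good pairs is the largest word of a vector
  \<open>F\<^sub>1\<^sup>a F\<^sub>2\<^sup>b F\<^sub>1\<^sup>c v\<close>, where \<open>v\<close> is the highest weight vector (\<open>lowered_top_leading\<close>).  So \<open>v\<close>
  generates the intersection (\<open>H0_span\<close>).  A contravariant Hermitian form without isotropic vectors
  then shows that every non-zero submodule has a vector with non-zero component along \<open>v\<close>, hence
  contains \<open>v\<close> (\<open>top_in_submodule\<close>); this is simplicity.  Finally, two simple modules with highest
  weight vectors of the same weight are isomorphic, because the submodule of their direct sum that
  is generated by the pair of these vectors is the graph of an isomorphism
  (\<open>uq_isomorphic_is_V\<close>).
\<close>

section \<open>The ground field\<close>

lemma q_sixth_nonzero [simp]: "q_sixth \<noteq> 0"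
  by (simp add: q_sixth_def Zero_fract_def eq_fract)

lemma q_nonzero [simp]: "q \<noteq> 0"
  by (simp add: q_def)

lemma q_half_nonzero [simp]: "q_half \<noteq> 0"
  by (simp add: q_half_def)

lemma q_half_square: "q_half * q_half = q"
  by (simp add: q_def q_half_def flip: power_add)

lemma q_power_eq: "q ^ n = Fract (monom 1 (6 * n)) 1"
proof -
  have "q_sixth ^ k = Fract (monom 1 k) 1" for k
    by (induction k)
      (simp_all add: One_fract_def q_sixth_def monom_Suc del: power_Suc add: power_Suc)
  then show ?thesis
    unfolding q_def power_mult[symmetric] by simp
qed

lemma q_power_eq_1_iff: "q ^ n = 1 \<longleftrightarrow> n = 0"
proof
  assume "q ^ n = 1"
  then have "monom (1 :: complex) (6 * n) = 1"
    by (simp add: q_power_eq One_fract_def eq_fract)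
  then have "degree (monom (1 :: complex) (6 * n)) = 0"
    by (simp only: degree_1)
  then show "n = 0"
    by (simp add: degree_monom_eq)
qed simp

lemma q_powi_eq_1_iff: "q powi s = 1 \<longleftrightarrow> s = 0"
  by (cases s rule: int_cases3) (auto simp: power_int_minus q_power_eq_1_iff)

lemma q_powi_inj: "q powi s = q powi t \<longleftrightarrow> s = t"
proof
  assume "q powi s = q powi t"
  then have "q powi (s - t) = 1"
    by (simp add: power_int_diff)
  then show "s = t"
    by (simp add: q_powi_eq_1_iff)
qed simp

lemma q_minus_inverse_nonzero [simp]: "q - inverse q \<noteq> 0"
proof
  assume "q - inverse q = 0"
  then have "q ^ 2 = 1"
    by (simp add: power2_eq_square field_simps)
  then show False
    by (simp add: q_power_eq_1_iff)
qed

text \<open>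
  The cone of positive elements: quotients of polynomials whose leading coefficients are positive
  real numbers.  It is closed under sums and products and does not contain \<open>0\<close>; this excludes
  cancellation in the vectors \<open>F\<^sub>1\<^sup>a F\<^sub>2\<^sup>b F\<^sub>1\<^sup>c v\<close> and isotropic vectors of the Hermitian form.
\<close>

definition lead_pos :: "complex poly \<Rightarrow> bool" where
  "lead_pos p \<longleftrightarrow> (\<exists>r>0. lead_coeff p = of_real r)"

definition positive :: "kk \<Rightarrow> bool" where
  "positive c \<longleftrightarrow> (\<exists>a b. c = Fract a b \<and> lead_pos a \<and> lead_pos b)"

lemma lead_pos_nonzero: "lead_pos p \<Longrightarrow> p \<noteq> 0"
  by (auto simp: lead_pos_def)

lemma lead_pos_mult: "lead_pos a \<Longrightarrow> lead_pos b \<Longrightarrow> lead_pos (a * b)"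
  unfolding lead_pos_def
  by (metis lead_coeff_mult mult_pos_pos of_real_mult)

lemma lead_pos_add:
  assumes "lead_pos a" "lead_pos b"
  shows "lead_pos (a + b)"
proof -
  obtain r s where rs: "r > 0" "lead_coeff a = of_real r" "s > 0" "lead_coeff b = of_real s"
    using assms by (auto simp: lead_pos_def)
  consider "degree a < degree b" | "degree b < degree a" | "degree a = degree b"
    by linarith
  then show ?thesis
  proof cases
    case 1
    then show ?thesis
      using rs lead_coeff_add_le[OF 1] by (metis lead_pos_def)
  next
    case 2
    then show ?thesis
      using rs lead_coeff_add_le[OF 2] by (metis lead_pos_def add.commute)
  next
    case 3
    have c: "coeff (a + b) (degree a) = of_real (r + s)"
      using rs 3 by simp
    have "r + s > 0"
      using rs by simp
    then have "degree (a + b) = degree a"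
      using c 3 by (metis degree_add_le le_antisym le_degree of_real_eq_0_iff order_less_irrefl order.refl)
    then show ?thesis
      using c \<open>r + s > 0\<close> by (metis lead_pos_def)
  qed
qed

lemma positive_mult: "positive a \<Longrightarrow> positive b \<Longrightarrow> positive (a * b)"
  unfolding positive_def by (metis lead_pos_mult mult_fract)

lemma positive_add: "positive a \<Longrightarrow> positive b \<Longrightarrow> positive (a + b)"
  unfolding positive_def
  by (metis lead_pos_mult lead_pos_add lead_pos_nonzero add_fract)

lemma positive_inverse: "positive a \<Longrightarrow> positive (inverse a)"
  unfolding positive_def by (metis inverse_fract)

lemma positive_nonzero: "positive a \<Longrightarrow> a \<noteq> 0"
  unfolding positive_def Zero_fract_def by (metis eq_fract(1) lead_pos_nonzero mult_1_right mult_zero_left zero_neq_one)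

lemma positive_1: "positive 1"
  unfolding positive_def One_fract_def by (intro exI[of _ 1]) (auto simp: lead_pos_def intro!: exI[of _ 1])

lemma positive_q: "positive q"
proof -
  have "q = Fract (monom 1 6) 1"
    using q_power_eq[of 1] by simp
  moreover have "lead_pos (monom 1 6)" "lead_pos 1"
    by (auto simp: lead_pos_def degree_monom_eq intro!: exI[of _ 1])
  ultimately show ?thesis
    unfolding positive_def by blast
qed

lemma positive_power: "positive a \<Longrightarrow> positive (a ^ n)"
  by (induction n) (simp_all add: positive_1 positive_mult)

lemma positive_q_powi: "positive (q powi s)"
  by (cases s rule: int_cases3)
    (simp_all add: positive_1 positive_power positive_q power_int_minus positive_inverse)

definition nonneg :: "kk \<Rightarrow> bool" where
  "nonneg c \<longleftrightarrow> c = 0 \<or> positive c"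

lemma nonneg_add: "nonneg a \<Longrightarrow> nonneg b \<Longrightarrow> nonneg (a + b)"
  by (auto simp: nonneg_def positive_add)

lemma nonneg_mult: "nonneg a \<Longrightarrow> nonneg b \<Longrightarrow> nonneg (a * b)"
  by (auto simp: nonneg_def positive_mult)

lemma nonneg_add_eq_0: "nonneg a \<Longrightarrow> nonneg b \<Longrightarrow> a + b = 0 \<longleftrightarrow> a = 0 \<and> b = 0"
  by (auto simp: nonneg_def dest: positive_add positive_nonzero)

lemma nonneg_sum: "(\<And>i. i \<in> A \<Longrightarrow> nonneg (f i)) \<Longrightarrow> nonneg (sum f A)"
  by (induction A rule: infinite_finite_induct) (simp_all add: nonneg_add, simp_all add: nonneg_def)

lemma nonneg_sum_eq_0:
  "finite A \<Longrightarrow> (\<And>i. i \<in> A \<Longrightarrow> nonneg (f i)) \<Longrightarrow> sum f A = 0 \<longleftrightarrow> (\<forall>i\<in>A. f i = 0)"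
  by (induction A rule: finite_induct) (simp_all add: nonneg_add_eq_0 nonneg_sum)

text \<open>Complex conjugation of the coefficients; it fixes the indeterminate.\<close>

lemma map_poly_cnj_add: "map_poly cnj (a + b) = map_poly cnj a + map_poly cnj b"
  by (rule poly_eqI) (simp add: coeff_map_poly)

lemma map_poly_cnj_mult: "map_poly cnj (a * b) = map_poly cnj a * map_poly cnj b"
  by (rule poly_eqI) (simp add: coeff_map_poly coeff_mult)

lemma map_poly_cnj_eq_0_iff: "map_poly cnj a = 0 \<longleftrightarrow> a = 0"
  by (simp add: map_poly_eq_0_iff)

definition conjugate :: "kk \<Rightarrow> kk" where
  "conjugate c = (let (a, b) = quot_of_fract c in Fract (map_poly cnj a) (map_poly cnj b))"

lemma conjugate_Fract:
  assumes "b \<noteq> 0"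
  shows "conjugate (Fract a b) = Fract (map_poly cnj a) (map_poly cnj b)"
proof -
  obtain a' b' where ab: "quot_of_fract (Fract a b) = (a', b')"
    by fastforce
  have "b' \<noteq> 0"
    using snd_quot_of_fract_nonzero[of "Fract a b"] ab by simp
  have "Fract a' b' = Fract a b"
    using Fract_quot_of_fract[of "Fract a b"] ab by simp
  then have "a' * b = a * b'"
    using assms \<open>b' \<noteq> 0\<close> by (simp add: eq_fract)
  then have "map_poly cnj a' * map_poly cnj b = map_poly cnj a * map_poly cnj b'"
    by (simp flip: map_poly_cnj_mult)
  then show ?thesis
    using assms \<open>b' \<noteq> 0\<close> by (simp add: conjugate_def ab eq_fract map_poly_cnj_eq_0_iff)
qed

lemma conjugate_add: "conjugate (a + b) = conjugate a + conjugate b"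
  by (cases a; cases b)
    (simp add: conjugate_Fract map_poly_cnj_eq_0_iff map_poly_cnj_add map_poly_cnj_mult)

lemma conjugate_mult: "conjugate (a * b) = conjugate a * conjugate b"
  by (cases a; cases b)
    (simp add: conjugate_Fract map_poly_cnj_eq_0_iff map_poly_cnj_mult)

lemma conjugate_0 [simp]: "conjugate 0 = 0"
  by (simp add: Zero_fract_def conjugate_Fract)

lemma conjugate_1 [simp]: "conjugate 1 = 1"
  by (simp add: One_fract_def conjugate_Fract)

lemma conjugate_eq_0_iff [simp]: "conjugate c = 0 \<longleftrightarrow> c = 0"
  by (cases c) (simp add: conjugate_Fract Zero_fract_def eq_fract map_poly_cnj_eq_0_iff)

lemma conjugate_power: "conjugate (a ^ n) = conjugate a ^ n"
  by (induction n) (simp_all add: conjugate_mult)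

lemma conjugate_q [simp]: "conjugate q = q"
proof -
  have "conjugate q_sixth = q_sixth"
    by (simp add: q_sixth_def conjugate_Fract map_poly_pCons)
  then show ?thesis
    by (simp add: q_def conjugate_power)
qed

lemma conjugate_inverse: "conjugate (inverse a) = inverse (conjugate a)"
  by (metis conjugate_0 conjugate_1 conjugate_mult conjugate_eq_0_iff inverse_unique inverse_zero right_inverse)

lemma conjugate_q_powi [simp]: "conjugate (q powi s) = q powi s"
  by (cases s rule: int_cases3) (simp_all add: conjugate_power power_int_minus conjugate_inverse)

lemma lead_pos_cnj: "p \<noteq> 0 \<Longrightarrow> lead_pos (map_poly cnj p * p)"
proof -
  assume p: "p \<noteq> 0"
  have "lead_coeff (map_poly cnj p * p) = cnj (lead_coeff p) * lead_coeff p"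
    by (simp add: lead_coeff_mult coeff_map_poly degree_map_poly)
  also have "\<dots> = of_real ((cmod (lead_coeff p))\<^sup>2)"
    by (metis complex_norm_square mult.commute)
  finally show ?thesis
    unfolding lead_pos_def using p by (intro exI[of _ "(cmod (lead_coeff p))\<^sup>2"]) simp
qed

lemma positive_norm: "c \<noteq> 0 \<Longrightarrow> positive (conjugate c * c)"
proof (cases c)
  case (Fract a b)
  moreover assume "c \<noteq> 0"
  ultimately have "a \<noteq> 0"
    by (auto simp: Zero_fract_def eq_fract)
  then show ?thesis
    using Fract lead_pos_cnj by (auto simp: conjugate_Fract positive_def)
qed

lemma nonneg_norm: "nonneg (conjugate c * c)"
  using positive_norm[of c] by (cases "c = 0") (simp_all add: nonneg_def)


section \<open>Free vector spaces and tensor words\<close>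

lemma lookup_scale [simp]: "Poly_Mapping.lookup (scale c x) k = c * Poly_Mapping.lookup x k"
  by (simp add: scale_def Poly_Mapping.map.rep_eq when_def)

lemma scale_add_right: "scale c (x + y) = scale c x + scale c y"
  by (rule poly_mapping_eqI) (simp add: lookup_add algebra_simps)

lemma scale_add_left: "scale (c + d) x = scale c x + scale d x"
  by (rule poly_mapping_eqI) (simp add: lookup_add algebra_simps)

lemma scale_scale [simp]: "scale c (scale d x) = scale (c * d) x"
  by (rule poly_mapping_eqI) (simp add: algebra_simps)

lemma scale_1 [simp]: "scale 1 x = x"
  by (rule poly_mapping_eqI) simp

lemma scale_0 [simp]: "scale 0 x = 0" "scale c 0 = 0"
  by (rule poly_mapping_eqI, simp)+

lemma scale_eq_0_iff [simp]: "scale c x = 0 \<longleftrightarrow> c = 0 \<or> x = 0"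
  by (auto simp: poly_mapping_eq_iff fun_eq_iff)

lemma scale_single [simp]: "scale c (Poly_Mapping.single b d) = Poly_Mapping.single b (c * d)"
  by (rule poly_mapping_eqI) (simp add: lookup_single when_def)

lemma keys_scale: "Poly_Mapping.keys (scale c x) \<subseteq> Poly_Mapping.keys x"
  by (auto simp: in_keys_iff)

lemma scale_sum: "scale c (\<Sum>i\<in>A. f i) = (\<Sum>i\<in>A. scale c (f i))"
  by (induction A rule: infinite_finite_induct) (simp_all add: scale_add_right)

interpretation free: vector_space "scale :: kk \<Rightarrow> ('b \<Rightarrow>\<^sub>0 kk) \<Rightarrow> ('b \<Rightarrow>\<^sub>0 kk)"
  by unfold_locales (simp_all add: scale_add_left scale_add_right)

text \<open>Linearity of maps between spaces with given bases.\<close>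

definition linear_map :: "(('a \<Rightarrow>\<^sub>0 kk) \<Rightarrow> ('b \<Rightarrow>\<^sub>0 kk)) \<Rightarrow> bool" where
  "linear_map f \<longleftrightarrow> (\<forall>x y. f (x + y) = f x + f y) \<and> (\<forall>c x. f (scale c x) = scale c (f x))"

lemma linear_mapI:
  "(\<And>x y. f (x + y) = f x + f y) \<Longrightarrow> (\<And>c x. f (scale c x) = scale c (f x)) \<Longrightarrow> linear_map f"
  by (simp add: linear_map_def)

lemma linear_map_add: "linear_map f \<Longrightarrow> f (x + y) = f x + f y"
  and linear_map_scale: "linear_map f \<Longrightarrow> f (scale c x) = scale c (f x)"
  by (simp_all add: linear_map_def)

lemma linear_map_0: "linear_map f \<Longrightarrow> f 0 = 0"
  by (metis linear_map_scale scale_0)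

lemma linear_map_sum: "linear_map f \<Longrightarrow> f (\<Sum>i\<in>A. g i) = (\<Sum>i\<in>A. f (g i))"
  by (induction A rule: infinite_finite_induct) (simp_all add: linear_map_0 linear_map_add)

lemma basis_expansion:
  assumes "finite A" "Poly_Mapping.keys x \<subseteq> A"
  shows "x = (\<Sum>b\<in>A. scale (Poly_Mapping.lookup x b) (basis_vec b))"
proof (rule poly_mapping_eqI)
  fix k
  have "Poly_Mapping.lookup (\<Sum>b\<in>A. scale (Poly_Mapping.lookup x b) (basis_vec b)) k =
    (\<Sum>b\<in>A. if k = b then Poly_Mapping.lookup x b else 0)"
    unfolding lookup_sum by (rule sum.cong) (auto simp: lookup_single when_def)
  also have "\<dots> = Poly_Mapping.lookup x k"
    using assms by (auto simp: in_keys_iff)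
  finally show "Poly_Mapping.lookup x k =
    Poly_Mapping.lookup (\<Sum>b\<in>A. scale (Poly_Mapping.lookup x b) (basis_vec b)) k" ..
qed

lemma linear_map_eqI:
  assumes "linear_map f" "linear_map g" "\<And>b. b \<in> Poly_Mapping.keys x \<Longrightarrow> f (basis_vec b) = g (basis_vec b)"
  shows "f x = g x"
proof -
  have "f x = (\<Sum>b\<in>Poly_Mapping.keys x. scale (Poly_Mapping.lookup x b) (f (basis_vec b)))"
    by (subst basis_expansion[of "Poly_Mapping.keys x" x])
      (simp_all add: linear_map_sum[OF assms(1)] linear_map_scale[OF assms(1)] del: scale_single)
  also have "\<dots> = (\<Sum>b\<in>Poly_Mapping.keys x. scale (Poly_Mapping.lookup x b) (g (basis_vec b)))"
    by (rule sum.cong) (simp_all add: assms(3))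
  also have "\<dots> = g x"
    by (subst (3) basis_expansion[of "Poly_Mapping.keys x" x])
      (simp_all add: linear_map_sum[OF assms(2)] linear_map_scale[OF assms(2)] del: scale_single)
  finally show ?thesis .
qed

lemma lin_ext_superset:
  assumes "finite A" "Poly_Mapping.keys x \<subseteq> A"
  shows "lin_ext f x = (\<Sum>b\<in>A. scale (Poly_Mapping.lookup x b) (f b))"
  unfolding lin_ext_def using assms by (intro sum.mono_neutral_left) (auto simp: in_keys_iff)

lemma linear_map_lin_ext: "linear_map (lin_ext f)"
proof (rule linear_mapI)
  fix x y :: "'a \<Rightarrow>\<^sub>0 kk"
  let ?A = "Poly_Mapping.keys x \<union> Poly_Mapping.keys y"
  have "Poly_Mapping.keys (x + y) \<subseteq> ?A"
    by (rule keys_add)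
  then show "lin_ext f (x + y) = lin_ext f x + lin_ext f y"
    by (simp add: lin_ext_superset[of ?A] lookup_add scale_add_left sum.distrib)
next
  fix c and x :: "'a \<Rightarrow>\<^sub>0 kk"
  show "lin_ext f (scale c x) = scale c (lin_ext f x)"
    by (subst lin_ext_superset[OF _ keys_scale[of c x]]) (simp_all add: lin_ext_def scale_sum)
qed

lemma lin_ext_basis [simp]: "lin_ext f (basis_vec b) = f b"
  by (simp add: lin_ext_def)

lemma lin_ext_single [simp]: "lin_ext f (Poly_Mapping.single b c) = scale c (f b)"
  by (simp add: lin_ext_def)

lemma lin_ext_0 [simp]: "lin_ext f 0 = 0"
  by (simp add: lin_ext_def)

text \<open>
  A vector in the span of the words is a family of vectors indexed by the first letter;
  \<open>slice a x\<close> is the member with index \<open>a\<close>.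
\<close>

definition slice :: "'a \<Rightarrow> ('a list \<Rightarrow>\<^sub>0 kk) \<Rightarrow> ('a list \<Rightarrow>\<^sub>0 kk)" where
  "slice a x = Poly_Mapping.map_key ((#) a) x"

lemma lookup_slice [simp]: "Poly_Mapping.lookup (slice a x) w = Poly_Mapping.lookup x (a # w)"
  by (simp add: slice_def Poly_Mapping.map_key.rep_eq)

lemma slice_add [simp]: "slice a (x + y) = slice a x + slice a y"
  and slice_scale [simp]: "slice a (scale c x) = scale c (slice a x)"
  and slice_0 [simp]: "slice a 0 = 0"
  and slice_minus [simp]: "slice a (x - y) = slice a x - slice a y"
  by (rule poly_mapping_eqI, simp add: lookup_add lookup_minus)+

lemma slice_basis [simp]:
  "slice a (Poly_Mapping.single (b # w) c) = (if a = b then Poly_Mapping.single w c else 0)"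
  "slice a (Poly_Mapping.single [] c) = 0"
  by (rule poly_mapping_eqI, simp add: lookup_single when_def)+

lemma slice_eqI:
  assumes "\<And>b. slice b x = slice b y" "Poly_Mapping.lookup x [] = Poly_Mapping.lookup y []"
  shows "x = y"
proof (rule poly_mapping_eqI)
  fix w show "Poly_Mapping.lookup x w = Poly_Mapping.lookup y w"
    using assms by (cases w) (simp_all, metis lookup_slice)
qed

lemma lookup_tensor:
  "Poly_Mapping.lookup (tensor v x) (b # w) = Poly_Mapping.lookup v b * Poly_Mapping.lookup x w"
  "Poly_Mapping.lookup (tensor v x) [] = 0"
proof -
  have *: "lin_ext (\<lambda>w. basis_vec (a # w)) x =
    (\<Sum>w\<in>Poly_Mapping.keys x. Poly_Mapping.single (a # w) (Poly_Mapping.lookup x w))" for a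
    by (simp add: lin_ext_def)
  have "Poly_Mapping.lookup (lin_ext (\<lambda>w. basis_vec (a # w)) x) (b # w) =
    (if a = b then Poly_Mapping.lookup x w else 0)" for a
  proof -
    have "Poly_Mapping.lookup (lin_ext (\<lambda>w. basis_vec (a # w)) x) (b # w) =
      (\<Sum>w'\<in>Poly_Mapping.keys x. if w' = w then if a = b then Poly_Mapping.lookup x w else 0 else 0)"
      unfolding * lookup_sum by (rule sum.cong) (auto simp: lookup_single when_def)
    also have "\<dots> = (if a = b then Poly_Mapping.lookup x w else 0)"
      by (auto simp: in_keys_iff)
    finally show ?thesis .
  qed
  then have "Poly_Mapping.lookup (tensor v x) (b # w) =
    (\<Sum>a\<in>Poly_Mapping.keys v. if a = b then Poly_Mapping.lookup v b * Poly_Mapping.lookup x w else 0)"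
    unfolding tensor_def lin_ext_def[of _ v] lookup_sum lookup_scale
    by (intro sum.cong) simp_all
  also have "\<dots> = Poly_Mapping.lookup v b * Poly_Mapping.lookup x w"
    by (auto simp: in_keys_iff)
  finally show "Poly_Mapping.lookup (tensor v x) (b # w) =
    Poly_Mapping.lookup v b * Poly_Mapping.lookup x w" .
  show "Poly_Mapping.lookup (tensor v x) [] = 0"
    unfolding tensor_def lin_ext_def[of _ v] lookup_sum lookup_scale * by (simp add: lookup_single)
qed

lemma slice_tensor [simp]: "slice b (tensor v x) = scale (Poly_Mapping.lookup v b) x"
  by (rule poly_mapping_eqI) (simp add: lookup_tensor)

text \<open>The action of a generator on a tensor product, and its form on slices.\<close>

definition tact :: "factor list \<Rightarrow> generator \<Rightarrow> (int list \<Rightarrow>\<^sub>0 kk) \<Rightarrow> (int list \<Rightarrow>\<^sub>0 kk)" where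
  "tact Vs g = lin_ext (word_act Vs g)"

lemma linear_map_tact: "linear_map (tact Vs g)"
  unfolding tact_def by (rule linear_map_lin_ext)

lemmas tact_add [simp] = linear_map_add[OF linear_map_tact]
lemmas tact_scale [simp] = linear_map_scale[OF linear_map_tact]
lemmas tact_0 [simp] = linear_map_0[OF linear_map_tact]

lemma tact_minus [simp]: "tact Vs g (x - y) = tact Vs g x - tact Vs g y"
  by (metis add_diff_cancel diff_add_cancel tact_add)

lemma slice_tact:
  "slice b (tact (V # Vs) (K i) x) = scale (q powi weight V i b) (tact Vs (K i) (slice b x))"
  "slice b (tact (V # Vs) (Kinv i) x) = scale (q powi (- weight V i b)) (tact Vs (Kinv i) (slice b x))"
  "slice b (tact (V # Vs) (E i) x) =
    (if source V i = Some (b - 1) then tact Vs (K i) (slice (b - 1) x) else 0) + tact Vs (E i) (slice b x)"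
  "slice b (tact (V # Vs) (F i) x) =
    (if source V i = Some b then slice (b + 1) x else 0) +
    scale (q powi (- weight V i b)) (tact Vs (F i) (slice b x))"
proof -
  let ?f = "\<lambda>x. slice b (tact (V # Vs) (K i) x)"
  let ?g = "\<lambda>x. scale (q powi weight V i b) (tact Vs (K i) (slice b x))"
  have "linear_map ?f" "linear_map ?g"
    by (simp_all add: linear_map_def scale_add_right algebra_simps)
  moreover have "?f (basis_vec w) = ?g (basis_vec w)" for w
    by (cases w) (auto simp: tact_def lookup_single when_def)
  ultimately show "?f x = ?g x"
    by (rule linear_map_eqI)
  let ?f = "\<lambda>x. slice b (tact (V # Vs) (Kinv i) x)"
  let ?g = "\<lambda>x. scale (q powi (- weight V i b)) (tact Vs (Kinv i) (slice b x))"
  have "linear_map ?f" "linear_map ?g"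
    by (simp_all add: linear_map_def scale_add_right algebra_simps)
  moreover have "?f (basis_vec w) = ?g (basis_vec w)" for w
    by (cases w) (auto simp: tact_def lookup_single when_def)
  ultimately show "?f x = ?g x"
    by (rule linear_map_eqI)
  let ?f = "\<lambda>x. slice b (tact (V # Vs) (E i) x)"
  let ?g = "\<lambda>x. (if source V i = Some (b - 1) then tact Vs (K i) (slice (b - 1) x) else 0) + tact Vs (E i) (slice b x)"
  have "linear_map ?f" "linear_map ?g"
    by (simp_all add: linear_map_def scale_add_right algebra_simps)
  moreover have "?f (basis_vec w) = ?g (basis_vec w)" for w
    by (cases w) (auto simp: tact_def lookup_single when_def)
  ultimately show "?f x = ?g x"
    by (rule linear_map_eqI)
  let ?f = "\<lambda>x. slice b (tact (V # Vs) (F i) x)"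
  let ?g = "\<lambda>x. (if source V i = Some b then slice (b + 1) x else 0) +
      scale (q powi (- weight V i b)) (tact Vs (F i) (slice b x))"
  have "linear_map ?f" "linear_map ?g"
    by (simp_all add: linear_map_def scale_add_right algebra_simps)
  moreover have "?f (basis_vec w) = ?g (basis_vec w)" for w
    by (cases w) (auto simp: tact_def lookup_single when_def)
  ultimately show "?f x = ?g x"
    by (rule linear_map_eqI)
qed

lemma lookup_tact_Nil [simp]: "Poly_Mapping.lookup (tact (V # Vs) g x) [] = 0"
proof -
  have *: "Poly_Mapping.lookup (word_act (V # Vs) g w) [] = 0" for w
    by (cases w; cases g) (simp_all add: lookup_tensor lookup_add)
  show ?thesis
    unfolding tact_def lin_ext_def lookup_sum by (simp add: *)
qed

text \<open>Membership of a vector in the tensor product of the modules \<open>Vs\<close>.\<close>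

definition valid :: "factor list \<Rightarrow> (int list \<Rightarrow>\<^sub>0 kk) \<Rightarrow> bool" where
  "valid Vs x \<longleftrightarrow> Poly_Mapping.keys x \<subseteq> listset (map labels Vs)"

lemma valid_Nil: "valid [] x \<longleftrightarrow> (\<exists>c. x = Poly_Mapping.single [] c)"
proof
  assume "valid [] x"
  then have "x = Poly_Mapping.single [] (Poly_Mapping.lookup x [])"
    by (intro poly_mapping_eqI) (auto simp: valid_def lookup_single when_def in_keys_iff subset_iff)
  then show "\<exists>c. x = Poly_Mapping.single [] c" ..
qed (auto simp: valid_def split: if_splits)

lemma valid_Cons:
  "valid (V # Vs) x \<longleftrightarrow> Poly_Mapping.lookup x [] = 0 \<and> (\<forall>b. valid Vs (slice b x)) \<and>
     (\<forall>b. b \<notin> labels V \<longrightarrow> slice b x = 0)"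
proof (intro iffI conjI allI impI)
  assume *: "valid (V # Vs) x"
  show "Poly_Mapping.lookup x [] = 0"
    using * by (auto simp: valid_def set_Cons_def in_keys_iff)
  show "valid Vs (slice b x)" for b
    using * by (auto simp: valid_def set_Cons_def in_keys_iff)
  show "slice b x = 0" if "b \<notin> labels V" for b
    by (rule poly_mapping_eqI) (use * that in \<open>auto simp: valid_def set_Cons_def in_keys_iff subset_iff\<close>)
next
  assume *: "Poly_Mapping.lookup x [] = 0 \<and> (\<forall>b. valid Vs (slice b x)) \<and>
     (\<forall>b. b \<notin> labels V \<longrightarrow> slice b x = 0)"
  show "valid (V # Vs) x"
    unfolding valid_def
  proof
    fix w assume w: "w \<in> Poly_Mapping.keys x"
    then obtain a v where av: "w = a # v"
      using * by (cases w) (auto simp: in_keys_iff)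
    have "v \<in> Poly_Mapping.keys (slice a x)"
      using w by (simp add: av in_keys_iff)
    moreover have "a \<in> labels V"
      using calculation * by force
    ultimately show "w \<in> listset (map labels (V # Vs))"
      using * by (auto simp: av valid_def set_Cons_def)
  qed
qed

lemma valid_0: "valid Vs 0"
  and valid_add: "valid Vs x \<Longrightarrow> valid Vs y \<Longrightarrow> valid Vs (x + y)"
  and valid_scale: "valid Vs x \<Longrightarrow> valid Vs (scale c x)"
  unfolding valid_def
  using keys_add[of x y] keys_scale[of c x] by auto

lemma valid_tact: "valid Vs x \<Longrightarrow> valid Vs (tact Vs g x)"
proof (induction Vs arbitrary: x g)
  case Nil
  then obtain c where "x = Poly_Mapping.single [] c"
    unfolding valid_Nil ..
  then show ?case
    by (simp add: tact_def valid_def)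
next
  case (Cons V Vs)
  have x: "valid Vs (slice b x)" "b \<notin> labels V \<Longrightarrow> slice b x = 0" for b
    using Cons.prems by (simp_all add: valid_Cons)
  have src: "b \<in> labels V" "b + 1 \<in> labels V" if "source V i = Some b" for i b
    using that by (cases V; cases i; auto)+
  have "valid Vs (slice b (tact (V # Vs) g x))" for b
    by (cases g) (auto simp: slice_tact intro!: valid_add valid_scale x Cons.IH)
  moreover have "slice b (tact (V # Vs) g x) = 0" if "b \<notin> labels V" for b
  proof -
    have "source V i \<noteq> Some b" "source V i \<noteq> Some (b - 1)" for i
      using src(1)[of i b] src(2)[of i "b - 1"] that by auto
    then show ?thesis
      using that by (cases g) (simp_all add: slice_tact x(2))
  qed
  ultimately show ?case
    by (simp add: valid_Cons)
qed


section \<open>The defining relations on tensor products\<close>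

text \<open>
  The Cartan matrix of \<open>sl\<^sub>3\<close>.  The relations are proved by induction on the number of tensor
  factors, by comparison of slices: on a slice the generators act through their actions on the first
  factor and on the tensor product of the remaining ones.
\<close>

definition cartan :: "node \<Rightarrow> node \<Rightarrow> int" where
  "cartan i j = (if i = j then 2 else -1)"

text \<open>The weights of the first factor satisfy the relations between \<open>K\<close> and \<open>E\<close>, \<open>F\<close>.\<close>

lemma weight_source: "source V j = Some a \<Longrightarrow> weight V i (a + 1) = weight V i a + cartan i j"
  by (cases V; cases i; cases j) (auto simp: cartan_def)

lemma weight_source_self: "source V i = Some a \<Longrightarrow> weight V i a = -1"
  by (cases V; cases i) auto

lemma weight_target_self: "source V i = Some a \<Longrightarrow> weight V i (a + 1) = 1"
  by (cases V; cases i) auto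

lemma weight_eq_0:
  "b \<in> labels V \<Longrightarrow> source V i \<noteq> Some b \<Longrightarrow> source V i \<noteq> Some (b - 1) \<Longrightarrow> weight V i b = 0"
  by (cases V; cases i) auto

lemma source_inj: "source V i = Some a \<Longrightarrow> source V j = Some a \<Longrightarrow> i = j"
  by (cases V; cases i; cases j) auto

lemma tact_Nil: "valid [] x \<Longrightarrow> tact [] g x = scale (counit g) x"
proof -
  assume "valid [] x"
  then obtain c where "x = Poly_Mapping.single [] c"
    unfolding valid_Nil ..
  then show ?thesis
    by (simp add: tact_def mult.commute)
qed

lemma valid_slice: "valid (V # Vs) x \<Longrightarrow> valid Vs (slice b x)"
  and slice_outside: "valid (V # Vs) x \<Longrightarrow> b \<notin> labels V \<Longrightarrow> slice b x = 0"
  and valid_lookup_Nil: "valid (V # Vs) x \<Longrightarrow> Poly_Mapping.lookup x [] = 0"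
  by (simp_all add: valid_Cons)

lemma tact_K_Kinv: "valid Vs x \<Longrightarrow> tact Vs (K i) (tact Vs (Kinv i) x) = x"
proof (induction Vs arbitrary: x)
  case (Cons V Vs)
  show ?case
    by (rule slice_eqI)
      (simp_all add: slice_tact Cons.IH[OF valid_slice[OF Cons.prems]] valid_lookup_Nil[OF Cons.prems] flip: power_int_add)
qed (simp add: tact_Nil valid_tact)

lemma tact_Kinv_K: "valid Vs x \<Longrightarrow> tact Vs (Kinv i) (tact Vs (K i) x) = x"
proof (induction Vs arbitrary: x)
  case (Cons V Vs)
  show ?case
    by (rule slice_eqI)
      (simp_all add: slice_tact Cons.IH[OF valid_slice[OF Cons.prems]] valid_lookup_Nil[OF Cons.prems] flip: power_int_add)
qed (simp add: tact_Nil valid_tact)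

lemma tact_K_K: "valid Vs x \<Longrightarrow> tact Vs (K i) (tact Vs (K j) x) = tact Vs (K j) (tact Vs (K i) x)"
proof (induction Vs arbitrary: x)
  case (Cons V Vs)
  show ?case
    by (rule slice_eqI)
      (simp_all add: slice_tact Cons.IH[OF valid_slice[OF Cons.prems], symmetric] mult.commute)
qed (simp add: tact_Nil valid_tact)

lemma tact_K_E:
  "valid Vs x \<Longrightarrow> tact Vs (K i) (tact Vs (E j) x) = scale (q powi cartan i j) (tact Vs (E j) (tact Vs (K i) x))"
proof (induction Vs arbitrary: x)
  case (Cons V Vs)
  note x = valid_slice[OF Cons.prems]
  show ?case
  proof (rule slice_eqI)
    fix b
    show "slice b (tact (V # Vs) (K i) (tact (V # Vs) (E j) x)) =
      slice b (scale (q powi cartan i j) (tact (V # Vs) (E j) (tact (V # Vs) (K i) x)))"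
      using weight_source[of V j "b - 1" i]
      by (auto simp: slice_tact Cons.IH[OF x] tact_K_K[OF x, of i j] scale_add_right power_int_add mult_ac)
  qed simp
qed (simp add: tact_Nil valid_tact)

lemma tact_K_F:
  "valid Vs x \<Longrightarrow> tact Vs (K i) (tact Vs (F j) x) = scale (q powi (- cartan i j)) (tact Vs (F j) (tact Vs (K i) x))"
proof (induction Vs arbitrary: x)
  case (Cons V Vs)
  note x = valid_slice[OF Cons.prems]
  show ?case
  proof (rule slice_eqI)
    fix b
    show "slice b (tact (V # Vs) (K i) (tact (V # Vs) (F j) x)) =
      slice b (scale (q powi (- cartan i j)) (tact (V # Vs) (F j) (tact (V # Vs) (K i) x)))"
      using weight_source[of V j b i]
      by (auto simp: slice_tact Cons.IH[OF x] scale_add_right power_int_add power_int_minus mult_ac)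
  qed simp
qed (simp add: tact_Nil valid_tact)

lemma tact_E_F_diff:
  assumes "i \<noteq> j"
  shows "valid Vs x \<Longrightarrow> tact Vs (E i) (tact Vs (F j) x) = tact Vs (F j) (tact Vs (E i) x)"
proof (induction Vs arbitrary: x)
  case (Cons V Vs)
  note x = valid_slice[OF Cons.prems]
  show ?case
  proof (rule slice_eqI)
    fix b
    have "source V i = Some a \<Longrightarrow> source V j = Some a \<Longrightarrow> False" for a
      using source_inj[of V i a j] assms by blast
    then show "slice b (tact (V # Vs) (E i) (tact (V # Vs) (F j) x)) =
      slice b (tact (V # Vs) (F j) (tact (V # Vs) (E i) x))"
      using weight_source[of V i "b - 1" j] assms
      by (auto simp: slice_tact Cons.IH[OF x] tact_K_F[OF x] scale_add_right power_int_add power_int_minus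
          power_int_diff cartan_def divide_inverse mult_ac)
  qed simp
qed (simp add: tact_Nil valid_tact)

lemma tact_E_F_same:
  "valid Vs x \<Longrightarrow> scale (q - inverse q) (tact Vs (E i) (tact Vs (F i) x) - tact Vs (F i) (tact Vs (E i) x)) =
    tact Vs (K i) x - tact Vs (Kinv i) x"
proof (induction Vs arbitrary: x)
  case (Cons V Vs)
  note x = valid_slice[OF Cons.prems]
  show ?case
  proof (rule slice_eqI)
    fix b
    let ?w = "q powi (- weight V i b)"
    let ?L = "tact (V # Vs) (E i) (tact (V # Vs) (F i) x) - tact (V # Vs) (F i) (tact (V # Vs) (E i) x)"
    have *: "slice b ?L =
      scale ((if source V i = Some (b - 1) then 1 else 0) - (if source V i = Some b then 1 else 0))
        (tact Vs (K i) (slice b x)) +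
      scale ?w (tact Vs (E i) (tact Vs (F i) (slice b x)) - tact Vs (F i) (tact Vs (E i) (slice b x)))"
      using weight_source[of V i "b - 1" i]
      by (auto simp: slice_tact tact_K_F[OF x] scale_add_right power_int_add power_int_minus
          cartan_def mult_ac free.scale_right_diff_distrib)
    have "slice b (scale (q - inverse q) ?L) = scale ((q - inverse q) *
        ((if source V i = Some (b - 1) then 1 else 0) - (if source V i = Some b then 1 else 0)))
        (tact Vs (K i) (slice b x)) +
      scale ?w (tact Vs (K i) (slice b x) - tact Vs (Kinv i) (slice b x))"
      unfolding slice_scale * Cons.IH[OF x, symmetric] by (simp add: scale_add_right mult.commute)
    also have "\<dots> = slice b (tact (V # Vs) (K i) x - tact (V # Vs) (Kinv i) x)"
    proof (cases "b \<in> labels V")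
      case True
      then show ?thesis
        using weight_target_self[of V i "b - 1"] weight_source_self[of V i b] weight_eq_0[of b V i]
        by (auto simp: slice_tact free.scale_right_diff_distrib scale_add_left[symmetric]
            free.scale_left_diff_distrib power_int_minus)
    qed (simp add: slice_tact slice_outside[OF Cons.prems])
    finally show "slice b (scale (q - inverse q) ?L) =
      slice b (tact (V # Vs) (K i) x - tact (V # Vs) (Kinv i) x)" .
  qed (simp add: lookup_minus)
qed (simp add: tact_Nil valid_tact)

lemma q_powi_simps: "q powi 2 = q * q" "q powi - 2 = inverse (q * q)" "q powi - 1 = inverse q" "q powi 1 = q"
  by (simp_all add: power_int_minus power2_eq_square)

lemma q_inverse_cancel: "q * inverse q = 1" "inverse q * q = 1" "q * (inverse q * c) = c" "inverse q * (q * c) = c"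
  by simp_all

lemma tact_F_Serre:
  assumes "i \<noteq> j"
  shows "valid Vs x \<Longrightarrow> set Vs \<subseteq> {V_Plus, V_Minus} \<Longrightarrow>
    tact Vs (F i) (tact Vs (F i) (tact Vs (F j) x)) =
    scale (q + inverse q) (tact Vs (F i) (tact Vs (F j) (tact Vs (F i) x))) -
    tact Vs (F j) (tact Vs (F i) (tact Vs (F i) x))"
proof (induction Vs arbitrary: x)
  case (Cons V Vs)
  note x = valid_slice[OF Cons.prems(1)]
  have "set Vs \<subseteq> {V_Plus, V_Minus}"
    using Cons.prems(2) by simp
  note IH = Cons.IH[OF x this]
  from assms consider "i = N1" "j = N2" | "i = N2" "j = N1"
    by (cases i; cases j) auto
  then show ?case
  proof cases
    case 1
    note IH = IH[unfolded 1]
    show ?thesis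
      unfolding 1
    proof (rule slice_eqI)
      fix b
      show "slice b (tact (V # Vs) (F N1) (tact (V # Vs) (F N1) (tact (V # Vs) (F N2) x))) =
      slice b (scale (q + inverse q) (tact (V # Vs) (F N1) (tact (V # Vs) (F N2) (tact (V # Vs) (F N1) x))) -
      tact (V # Vs) (F N2) (tact (V # Vs) (F N1) (tact (V # Vs) (F N1) x)))"
      proof (cases "b \<in> labels V")
        case True
        then have "b \<in> {-1, 0, 1}"
          by (cases V) auto
        then show ?thesis
          by (intro poly_mapping_eqI; use Cons.prems(2) in \<open>cases V\<close>; elim insertE)
            (simp_all add: slice_tact IH lookup_add lookup_minus q_powi_simps algebra_simps
            q_inverse_cancel)
      qed (simp add: slice_outside[OF Cons.prems(1)] slice_outside[OF valid_tact] Cons.prems(1) valid_tact)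
    qed (simp add: lookup_minus)
  next
    case 2
    note IH = IH[unfolded 2]
    show ?thesis
      unfolding 2
    proof (rule slice_eqI)
      fix b
      show "slice b (tact (V # Vs) (F N2) (tact (V # Vs) (F N2) (tact (V # Vs) (F N1) x))) =
      slice b (scale (q + inverse q) (tact (V # Vs) (F N2) (tact (V # Vs) (F N1) (tact (V # Vs) (F N2) x))) -
      tact (V # Vs) (F N1) (tact (V # Vs) (F N2) (tact (V # Vs) (F N2) x)))"
      proof (cases "b \<in> labels V")
        case True
        then have "b \<in> {-1, 0, 1}"
          by (cases V) auto
        then show ?thesis
          by (intro poly_mapping_eqI; use Cons.prems(2) in \<open>cases V\<close>; elim insertE)
            (simp_all add: slice_tact IH lookup_add lookup_minus q_powi_simps algebra_simps
            q_inverse_cancel)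
      qed (simp add: slice_outside[OF Cons.prems(1)] slice_outside[OF valid_tact] Cons.prems(1) valid_tact)
    qed (simp add: lookup_minus)
  qed
qed (simp add: tact_Nil valid_tact)

lemma tact_E_Serre:
  assumes "i \<noteq> j"
  shows "valid Vs x \<Longrightarrow> set Vs \<subseteq> {V_Plus, V_Minus} \<Longrightarrow>
    tact Vs (E i) (tact Vs (E i) (tact Vs (E j) x)) =
    scale (q + inverse q) (tact Vs (E i) (tact Vs (E j) (tact Vs (E i) x))) -
    tact Vs (E j) (tact Vs (E i) (tact Vs (E i) x))"
proof (induction Vs arbitrary: x)
  case (Cons V Vs)
  note x = valid_slice[OF Cons.prems(1)]
  have "set Vs \<subseteq> {V_Plus, V_Minus}"
    using Cons.prems(2) by simp
  note IH = Cons.IH[OF x this]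
  from assms consider "i = N1" "j = N2" | "i = N2" "j = N1"
    by (cases i; cases j) auto
  then show ?case
  proof cases
    case 1
    note IH = IH[unfolded 1]
    show ?thesis
      unfolding 1
    proof (rule slice_eqI)
      fix b
      show "slice b (tact (V # Vs) (E N1) (tact (V # Vs) (E N1) (tact (V # Vs) (E N2) x))) =
      slice b (scale (q + inverse q) (tact (V # Vs) (E N1) (tact (V # Vs) (E N2) (tact (V # Vs) (E N1) x))) -
      tact (V # Vs) (E N2) (tact (V # Vs) (E N1) (tact (V # Vs) (E N1) x)))"
      proof (cases "b \<in> labels V")
        case True
        then have "b \<in> {-1, 0, 1}"
          by (cases V) auto
        then show ?thesis
          by (intro poly_mapping_eqI; use Cons.prems(2) in \<open>cases V\<close>; elim insertE)
            (simp_all add: slice_tact IH lookup_add lookup_minus q_powi_simps algebra_simps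
            q_inverse_cancel power2_eq_square tact_K_E x valid_tact cartan_def tact_K_K[OF x, of N2 N1])
      qed (simp add: slice_outside[OF Cons.prems(1)] slice_outside[OF valid_tact] Cons.prems(1) valid_tact)
    qed (simp add: lookup_minus)
  next
    case 2
    note IH = IH[unfolded 2]
    show ?thesis
      unfolding 2
    proof (rule slice_eqI)
      fix b
      show "slice b (tact (V # Vs) (E N2) (tact (V # Vs) (E N2) (tact (V # Vs) (E N1) x))) =
      slice b (scale (q + inverse q) (tact (V # Vs) (E N2) (tact (V # Vs) (E N1) (tact (V # Vs) (E N2) x))) -
      tact (V # Vs) (E N1) (tact (V # Vs) (E N2) (tact (V # Vs) (E N2) x)))"
      proof (cases "b \<in> labels V")
        case True
        then have "b \<in> {-1, 0, 1}"
          by (cases V) auto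
        then show ?thesis
          by (intro poly_mapping_eqI; use Cons.prems(2) in \<open>cases V\<close>; elim insertE)
            (simp_all add: slice_tact IH lookup_add lookup_minus q_powi_simps algebra_simps
            q_inverse_cancel power2_eq_square tact_K_E x valid_tact cartan_def tact_K_K[OF x, of N2 N1])
      qed (simp add: slice_outside[OF Cons.prems(1)] slice_outside[OF valid_tact] Cons.prems(1) valid_tact)
    qed (simp add: lookup_minus)
  qed
qed (simp add: tact_Nil valid_tact)


section \<open>The kernel of the elementary morphisms\<close>

text \<open>
  The kernel of \<open>h\<close> (if \<open>V = W\<close>) or of \<open>d\<close> on the first two tensor factors, and the intersection of
  these kernels over all pairs of neighbouring factors.
\<close>

definition pair_kernel :: "factor \<Rightarrow> factor \<Rightarrow> (int list \<Rightarrow>\<^sub>0 kk) \<Rightarrow> bool" where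
  "pair_kernel V W x \<longleftrightarrow>
    (if V = W then
       slice 0 (slice (-1) x) = scale q (slice (-1) (slice 0 x)) \<and>
       slice 1 (slice (-1) x) = scale q (slice (-1) (slice 1 x)) \<and>
       slice 1 (slice 0 x) = scale q (slice 0 (slice 1 x))
     else slice 0 (slice 0 x) =
       scale (inverse q) (slice 1 (slice (-1) x)) + scale q (slice (-1) (slice 1 x)))"

fun harmonic :: "factor list \<Rightarrow> (int list \<Rightarrow>\<^sub>0 kk) \<Rightarrow> bool" where
  "harmonic (V # W # Vs) x \<longleftrightarrow> pair_kernel V W x \<and> (\<forall>b. harmonic (W # Vs) (slice b x))"
| "harmonic _ x \<longleftrightarrow> True"

lemma pair_kernel_0: "pair_kernel V W 0"
  and pair_kernel_add: "pair_kernel V W x \<Longrightarrow> pair_kernel V W y \<Longrightarrow> pair_kernel V W (x + y)"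
  and pair_kernel_scale: "pair_kernel V W x \<Longrightarrow> pair_kernel V W (scale c x)"
  by (auto simp: pair_kernel_def scale_add_right mult.commute split: if_splits)

lemma harmonic_0: "harmonic Vs 0"
  by (induction Vs "0 :: int list \<Rightarrow>\<^sub>0 kk" rule: harmonic.induct) (simp_all add: pair_kernel_0)

lemma harmonic_add: "harmonic Vs x \<Longrightarrow> harmonic Vs y \<Longrightarrow> harmonic Vs (x + y)"
  by (induction Vs x arbitrary: y rule: harmonic.induct) (simp_all add: pair_kernel_add)

lemma harmonic_scale: "harmonic Vs x \<Longrightarrow> harmonic Vs (scale c x)"
  by (induction Vs x rule: harmonic.induct) (simp_all add: pair_kernel_scale)

lemma pair_kernel_tact:
  assumes "V \<noteq> V_Triv" "W \<noteq> V_Triv" "pair_kernel V W x"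
  shows "pair_kernel V W (tact (V # W # Vs) g x)"
proof (cases g)
  case (K i)
  then show ?thesis
    using assms by (cases V; cases W; cases i)
      (simp_all add: pair_kernel_def slice_tact q_powi_simps scale_add_right mult_ac q_inverse_cancel)
next
  case (Kinv i)
  then show ?thesis
    using assms by (cases V; cases W; cases i)
      (simp_all add: pair_kernel_def slice_tact q_powi_simps scale_add_right mult_ac q_inverse_cancel)
next
  case (E i)
  then show ?thesis
    using assms by (cases V; cases W; cases i)
      (simp_all add: pair_kernel_def slice_tact q_powi_simps scale_add_right mult_ac q_inverse_cancel)
next
  case (F i)
  then show ?thesis
    using assms by (cases V; cases W; cases i)
      (simp_all add: pair_kernel_def slice_tact q_powi_simps scale_add_right mult_ac q_inverse_cancel)
qed

lemma harmonic_tact: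
  "V_Triv \<notin> set Vs \<Longrightarrow> harmonic Vs x \<Longrightarrow> harmonic Vs (tact Vs g x)"
proof (induction Vs x arbitrary: g rule: harmonic.induct)
  case (1 V W Vs x)
  have "harmonic (W # Vs) (tact (W # Vs) g' (slice b x))" for g' b
    using 1 by simp
  moreover have "harmonic (W # Vs) (slice b x)" for b
    using 1 by simp
  ultimately have "harmonic (W # Vs) (slice b (tact (V # W # Vs) g x))" for b
    by (cases g) (auto simp: slice_tact intro!: harmonic_add harmonic_scale harmonic_0)
  moreover have "pair_kernel V W (tact (V # W # Vs) g x)"
    by (rule pair_kernel_tact) (use 1 in auto)
  ultimately show ?case
    by simp
qed simp_all

text \<open>
  The member with index \<open>p\<close> if a vector is seen as a family indexed by the words of a fixed
  length.
\<close>

definition slices :: "'a list \<Rightarrow> ('a list \<Rightarrow>\<^sub>0 kk) \<Rightarrow> ('a list \<Rightarrow>\<^sub>0 kk)" where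
  "slices = fold slice"

lemma slices_simps [simp]: "slices [] x = x" "slices (a # p) x = slices p (slice a x)"
  by (simp_all add: slices_def)

lemma lookup_slices [simp]: "Poly_Mapping.lookup (slices p x) w = Poly_Mapping.lookup x (p @ w)"
  by (induction p arbitrary: x) simp_all

lemma harmonic_iff:
  "harmonic Vs x \<longleftrightarrow>
    (\<forall>p. Suc (length p) < length Vs \<longrightarrow> pair_kernel (Vs ! length p) (Vs ! Suc (length p)) (slices p x))"
proof (induction Vs x rule: harmonic.induct)
  case (1 V W Vs x)
  have "harmonic (V # W # Vs) x \<longleftrightarrow> pair_kernel V W x \<and>
    (\<forall>b p. Suc (length p) < length (W # Vs) \<longrightarrow>
      pair_kernel ((W # Vs) ! length p) ((W # Vs) ! Suc (length p)) (slices p (slice b x)))"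
    using 1 by simp
  also have "\<dots> \<longleftrightarrow> (\<forall>p. Suc (length p) < length (V # W # Vs) \<longrightarrow>
    pair_kernel ((V # W # Vs) ! length p) ((V # W # Vs) ! Suc (length p)) (slices p x))"
    (is "?l \<longleftrightarrow> (\<forall>p. ?r p)")
  proof
    assume l: ?l
    show "\<forall>p. ?r p"
    proof
      fix p show "?r p"
        using l by (cases p) auto
    qed
  next
    assume r: "\<forall>p. ?r p"
    show ?l
    proof (intro conjI allI impI)
      show "pair_kernel V W x"
        using spec[OF r, of "[]"] by simp
    next
      fix b and p :: "int list" assume "Suc (length p) < length (W # Vs)"
      then show "pair_kernel ((W # Vs) ! length p) ((W # Vs) ! Suc (length p)) (slices p (slice b x))"
        using spec[OF r, of "b # p"] by simp
    qed
  qed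
  finally show ?case .
qed simp_all

lemma harmonic_swap:
  assumes "harmonic Vs x" "Suc (length p) < length Vs" "Vs ! length p = Vs ! Suc (length p)"
    and "a < b" "a \<in> {-1, 0, 1}" "b \<in> {-1, 0, 1}"
  shows "Poly_Mapping.lookup x (p @ a # b # r) = q * Poly_Mapping.lookup x (p @ b # a # r)"
proof -
  have "pair_kernel (Vs ! length p) (Vs ! Suc (length p)) (slices p x)"
    using assms harmonic_iff by blast
  then have "slice b (slice a (slices p x)) = scale q (slice a (slice b (slices p x)))"
    using assms(3-) by (auto simp: pair_kernel_def)
  then show ?thesis
    by (auto dest!: arg_cong[where f = "\<lambda>y. Poly_Mapping.lookup y r"])
qed

lemma harmonic_contract:
  assumes "harmonic Vs x" "Suc (length p) < length Vs" "Vs ! length p \<noteq> Vs ! Suc (length p)"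
  shows "Poly_Mapping.lookup x (p @ 0 # 0 # r) =
    inverse q * Poly_Mapping.lookup x (p @ -1 # 1 # r) + q * Poly_Mapping.lookup x (p @ 1 # -1 # r)"
proof -
  have "pair_kernel (Vs ! length p) (Vs ! Suc (length p)) (slices p x)"
    using assms harmonic_iff by blast
  then have "slice 0 (slice 0 (slices p x)) =
     scale (inverse q) (slice 1 (slice (-1) (slices p x))) + scale q (slice (-1) (slice 1 (slices p x)))"
    using assms(3) by (auto simp: pair_kernel_def)
  then show ?thesis
    by (auto simp: lookup_add dest!: arg_cong[where f = "\<lambda>y. Poly_Mapping.lookup y r"])
qed

text \<open>The vector \<open>v\<^sub>1 \<otimes> \<dots> \<otimes> v\<^sub>1\<close>, which has the highest weight.\<close>

definition top_vector :: "nat \<Rightarrow> (int list \<Rightarrow>\<^sub>0 kk)" where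
  "top_vector N = basis_vec (replicate N 1)"

lemma slice_top [simp]: "slice a (top_vector (Suc N)) = (if a = 1 then top_vector N else 0)"
  by (simp add: top_vector_def)

lemma lookup_top_Nil: "Poly_Mapping.lookup (top_vector (Suc N)) [] = 0"
  by (simp add: top_vector_def lookup_single)

lemma harmonic_top: "length Vs = N \<Longrightarrow> harmonic Vs (top_vector N)"
proof (induction Vs arbitrary: N)
  case (Cons V Vs)
  then show ?case
    by (cases Vs) (auto simp: pair_kernel_def harmonic_0)
qed simp

lemma valid_top: "V_Triv \<notin> set Vs \<Longrightarrow> valid Vs (top_vector (length Vs))"
proof (induction Vs)
  case (Cons V Vs)
  then show ?case
    by (cases V) (auto simp: valid_Cons valid_0 lookup_top_Nil)
qed (simp add: valid_def top_vector_def)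

lemma tact_E_top: "V_Triv \<notin> set Vs \<Longrightarrow> tact Vs (E i) (top_vector (length Vs)) = 0"
proof (induction Vs)
  case (Cons V Vs)
  have "source V i \<noteq> Some 1"
    using Cons.prems by (cases V; cases i) auto
  then show ?case
    using Cons by - (rule slice_eqI, auto simp: slice_tact)
qed (simp add: tact_def top_vector_def)

lemma tact_K_top:
  "tact Vs (K i) (top_vector (length Vs)) = scale (q powi (\<Sum>V\<leftarrow>Vs. weight V i 1)) (top_vector (length Vs))"
proof (induction Vs)
  case (Cons V Vs)
  then show ?case
    by - (rule slice_eqI, simp_all add: slice_tact power_int_add lookup_top_Nil)
qed (simp add: tact_def top_vector_def)

lemma minus_in_subspace:
  assumes "\<And>c x. x \<in> S \<Longrightarrow> scale c x \<in> S" "x \<in> S"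
  shows "- x \<in> S"
  using assms(1)[OF assms(2), of "-1"] by simp

lemma tensor_module_simps [simp]:
  "carrier (tensor_module Vs) = Collect (valid Vs)" "x \<oplus>\<^bsub>tensor_module Vs\<^esub> y = x + y"
  "\<zero>\<^bsub>tensor_module Vs\<^esub> = 0" "c \<odot>\<^bsub>tensor_module Vs\<^esub> x = scale c x"
  "act (tensor_module Vs) g x = tact Vs g x"
  by (auto simp: tensor_module_def tact_def valid_def)

text \<open>Invariant subspaces of tensor products of \<open>V\<^sub>+\<close> and \<open>V\<^sub>-\<close> are modules.\<close>

lemma uq_sl3_module_subspace:
  assumes "V_Triv \<notin> set Vs" and S: "\<And>x. x \<in> S \<Longrightarrow> valid Vs x" "0 \<in> S"
    "\<And>x y. x \<in> S \<Longrightarrow> y \<in> S \<Longrightarrow> x + y \<in> S" "\<And>c x. x \<in> S \<Longrightarrow> scale c x \<in> S"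
    "\<And>g x. x \<in> S \<Longrightarrow> tact Vs g x \<in> S"
  shows "uq_sl3_module (tensor_module Vs\<lparr>carrier := S\<rparr>)" (is "uq_sl3_module ?M")
proof -
  have sel: "carrier ?M = S" "x \<oplus>\<^bsub>?M\<^esub> y = x + y" "\<zero>\<^bsub>?M\<^esub> = 0" "c \<odot>\<^bsub>?M\<^esub> x = scale c x"
    "act ?M g x = tact Vs g x" for x y c g
    by simp_all
  have Vs: "set Vs \<subseteq> {V_Plus, V_Minus}"
    using assms(1) factor.exhaust by blast
  have neg: "- x \<in> S" if "x \<in> S" for x
    using minus_in_subspace[of S] S(4) that by blast
  have ab: "abelian_group ?M"
  proof (rule abelian_groupI)
    fix x assume "x \<in> carrier ?M"
    then show "\<exists>y\<in>carrier ?M. y \<oplus>\<^bsub>?M\<^esub> x = \<zero>\<^bsub>?M\<^esub>"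
      unfolding sel using neg by (intro bexI[of _ "- x"]) simp_all
  qed (simp_all add: S add_ac)
  then interpret ab: abelian_group ?M .
  have minus: "x \<ominus>\<^bsub>?M\<^esub> y = x - y" if "x \<in> S" "y \<in> S" for x y
  proof -
    have "\<ominus>\<^bsub>?M\<^esub> y = - y"
      by (rule ab.minus_equality) (use that neg in simp_all)
    then show ?thesis
      by (simp add: a_minus_def)
  qed
  have kk: "cring kk_ring"
    by (rule cring_from_type_algebra)
  have module: "module kk_ring ?M"
    by (rule moduleI[OF kk ab])
      (simp_all add: S ring_of_type_algebra_def scale_add_right scale_add_left)
  have serre: "tact Vs (E i) (tact Vs (E i) (tact Vs (E j) x)) -
      scale (q + inverse q) (tact Vs (E i) (tact Vs (E j) (tact Vs (E i) x))) +
      tact Vs (E j) (tact Vs (E i) (tact Vs (E i) x)) = 0"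
    "tact Vs (F i) (tact Vs (F i) (tact Vs (F j) x)) -
      scale (q + inverse q) (tact Vs (F i) (tact Vs (F j) (tact Vs (F i) x))) +
      tact Vs (F j) (tact Vs (F i) (tact Vs (F i) x)) = 0" if "x \<in> S" "i \<noteq> j" for i j x
    using tact_E_Serre[OF that(2) S(1)[OF that(1)] Vs] tact_F_Serre[OF that(2) S(1)[OF that(1)] Vs]
    by simp_all
  have "uq_sl3_module_axioms ?M"
    by unfold_locales
      (simp_all add: S minus, simp_all add: tact_K_Kinv tact_Kinv_K S,
        simp_all add: tact_K_E tact_K_F cartan_def power_int_minus S tact_E_F_same,
        (rule tact_K_K, erule S(1)), (rule tact_E_F_diff, assumption, erule S(1)),
        (rule serre(1), assumption+), (rule serre(2), assumption+))
  with module show ?thesis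
    by (simp add: uq_sl3_module_def)
qed


section \<open>Lowering words\<close>

text \<open>\<open>lowers i Vs w w'\<close>: the word \<open>w'\<close> occurs in \<open>F i\<close> applied to the word \<open>w\<close>.\<close>

inductive lowers :: "node \<Rightarrow> factor list \<Rightarrow> int list \<Rightarrow> int list \<Rightarrow> bool" where
  lowers_here: "source V i = Some b \<Longrightarrow> lowers i (V # Vs) ((b + 1) # w) (b # w)"
| lowers_later: "lowers i Vs w w' \<Longrightarrow> lowers i (V # Vs) (a # w) (a # w')"

lemma tact_F_Nil: "tact [] (F i) x = 0"
proof -
  have "word_act [] (F i) w = 0" for w
    by (cases w) simp_all
  then show ?thesis
    by (simp add: tact_def lin_ext_def)
qed

lemma lookup_tact_F:
  "Poly_Mapping.lookup (tact (V # Vs) (F i) x) (b # w) =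
    (if source V i = Some b then Poly_Mapping.lookup x ((b + 1) # w) else 0) +
    q powi (- weight V i b) * Poly_Mapping.lookup (tact Vs (F i) (slice b x)) w"
proof -
  have "Poly_Mapping.lookup (tact (V # Vs) (F i) x) (b # w) =
    Poly_Mapping.lookup (slice b (tact (V # Vs) (F i) x)) w"
    by simp
  then show ?thesis
    unfolding slice_tact by (simp add: lookup_add)
qed

lemma tact_F_support:
  "Poly_Mapping.lookup (tact Vs (F i) x) y \<noteq> 0 \<Longrightarrow> \<exists>w. Poly_Mapping.lookup x w \<noteq> 0 \<and> lowers i Vs w y"
proof (induction Vs arbitrary: x y)
  case Nil
  then show ?case
    by (simp add: tact_F_Nil)
next
  case (Cons V Vs)
  then obtain b w where y: "y = b # w"
    by (cases y) auto
  show ?case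
  proof (cases "source V i = Some b \<and> Poly_Mapping.lookup x ((b + 1) # w) \<noteq> 0")
    case True
    then show ?thesis
      unfolding y using lowers_here by blast
  next
    case False
    then have "Poly_Mapping.lookup (tact Vs (F i) (slice b x)) w \<noteq> 0"
      using Cons.prems unfolding y lookup_tact_F by (auto split: if_splits)
    then obtain w' where "Poly_Mapping.lookup (slice b x) w' \<noteq> 0" "lowers i Vs w' w"
      using Cons.IH by blast
    then show ?thesis
      unfolding y using lowers_later by auto
  qed
qed

text \<open>
  On vectors with coefficients in the cone the operators \<open>F i\<close> act without cancellation, so that
  all words that can be reached by lowering letters do occur.
\<close>

definition nonneg_vec :: "(int list \<Rightarrow>\<^sub>0 kk) \<Rightarrow> bool" where
  "nonneg_vec x \<longleftrightarrow> (\<forall>w. nonneg (Poly_Mapping.lookup x w))"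

lemma nonneg_0: "nonneg 0"
  and nonneg_q_powi: "nonneg (q powi s)"
  by (simp_all add: nonneg_def positive_q_powi)

lemma nonneg_vec_slice: "nonneg_vec x \<Longrightarrow> nonneg_vec (slice b x)"
  by (simp add: nonneg_vec_def)

lemma nonneg_vec_tact_F: "nonneg_vec x \<Longrightarrow> nonneg_vec (tact Vs (F i) x)"
proof (induction Vs arbitrary: x)
  case Nil
  then show ?case
    by (simp add: tact_F_Nil nonneg_vec_def nonneg_0)
next
  case (Cons V Vs)
  show ?case
    unfolding nonneg_vec_def
  proof
    fix y
    show "nonneg (Poly_Mapping.lookup (tact (V # Vs) (F i) x) y)"
    proof (cases y)
      case (Cons b w)
      have "nonneg (Poly_Mapping.lookup (tact Vs (F i) (slice b x)) w)"
        using Cons.IH[OF nonneg_vec_slice[OF Cons.prems]] by (simp add: nonneg_vec_def)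
      then show ?thesis
        using Cons.prems unfolding Cons lookup_tact_F
        by (auto intro!: nonneg_add nonneg_mult nonneg_q_powi nonneg_0 simp: nonneg_vec_def)
    qed (simp add: nonneg_0)
  qed
qed

lemma tact_F_support_nonneg:
  "lowers i Vs w y \<Longrightarrow> nonneg_vec x \<Longrightarrow> Poly_Mapping.lookup x w \<noteq> 0 \<Longrightarrow>
    Poly_Mapping.lookup (tact Vs (F i) x) y \<noteq> 0"
proof (induction arbitrary: x rule: lowers.induct)
  case (lowers_here V i b Vs w)
  have "nonneg (q powi (- weight V i b) * Poly_Mapping.lookup (tact Vs (F i) (slice b x)) w)"
    "nonneg (Poly_Mapping.lookup x ((b + 1) # w))"
    using nonneg_vec_tact_F[OF nonneg_vec_slice[OF lowers_here(2)]] lowers_here(2)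
    by (auto simp: nonneg_vec_def intro: nonneg_mult nonneg_q_powi)
  then show ?case
    unfolding lookup_tact_F using lowers_here by (simp add: nonneg_add_eq_0)
next
  case (lowers_later i Vs w w' V a)
  have "Poly_Mapping.lookup (tact Vs (F i) (slice a x)) w' \<noteq> 0"
    using lowers_later by (intro lowers_later.IH nonneg_vec_slice) auto
  moreover have "nonneg (q powi (- weight V i a) * Poly_Mapping.lookup (tact Vs (F i) (slice a x)) w')"
    "nonneg (if source V i = Some a then Poly_Mapping.lookup x ((a + 1) # w') else 0)"
    using nonneg_vec_tact_F[OF nonneg_vec_slice[OF lowers_later(3)]] lowers_later(3)
    by (auto simp: nonneg_vec_def intro: nonneg_mult nonneg_q_powi nonneg_0)
  ultimately show ?case
    unfolding lookup_tact_F by (simp only: nonneg_add_eq_0) auto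
qed

lemma nonneg_vec_tact_F_power: "nonneg_vec x \<Longrightarrow> nonneg_vec ((tact Vs (F i) ^^ t) x)"
  by (induction t) (simp_all add: nonneg_vec_tact_F)

lemma tact_F_power_support_nonneg:
  "(lowers i Vs ^^ t) w y \<Longrightarrow> nonneg_vec x \<Longrightarrow> Poly_Mapping.lookup x w \<noteq> 0 \<Longrightarrow>
    Poly_Mapping.lookup ((tact Vs (F i) ^^ t) x) y \<noteq> 0"
proof (induction t arbitrary: y)
  case (Suc t)
  then obtain v where "(lowers i Vs ^^ t) w v" "lowers i Vs v y"
    by auto
  moreover have "Poly_Mapping.lookup ((tact Vs (F i) ^^ t) x) v \<noteq> 0"
    using Suc.IH[OF calculation(1)] Suc.prems by simp
  ultimately show ?case
    using tact_F_support_nonneg[OF _ nonneg_vec_tact_F_power[OF Suc.prems(2)]] by simp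
qed simp

lemma lowers_at:
  "length p < length Vs \<Longrightarrow> source (Vs ! length p) i = Some b \<Longrightarrow>
    lowers i Vs (p @ (b + 1) # r) (p @ b # r)"
proof (induction p arbitrary: Vs)
  case Nil
  then show ?case
    by (cases Vs) (auto intro: lowers_here)
next
  case (Cons a p)
  then show ?case
    by (cases Vs) (auto intro: lowers_later)
qed

text \<open>
  The last \<open>t\<close> letters of a constant stretch are lowered one after the other, from right to
  left.
\<close>

lemma lowers_replicate:
  assumes "\<And>j. length p \<le> j \<Longrightarrow> j < length p + (u + t) \<Longrightarrow> j < length Vs \<and> source (Vs ! j) i = Some b"
  shows "(lowers i Vs ^^ t) (p @ replicate (u + t) (b + 1) @ r)
    (p @ replicate u (b + 1) @ replicate t b @ r)"
  using assms
proof (induction t arbitrary: u)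
  case (Suc t)
  have "(lowers i Vs ^^ t) (p @ replicate (Suc u + t) (b + 1) @ r)
    (p @ replicate (Suc u) (b + 1) @ replicate t b @ r)"
    by (rule Suc.IH) (use Suc.prems in simp)
  moreover have "lowers i Vs ((p @ replicate u (b + 1)) @ (b + 1) # replicate t b @ r)
    ((p @ replicate u (b + 1)) @ b # replicate t b @ r)"
    by (rule lowers_at) (use Suc.prems in simp_all)
  moreover have "p @ replicate (Suc u) (b + 1) @ replicate t b @ r =
    (p @ replicate u (b + 1)) @ (b + 1) # replicate t b @ r"
    by (simp add: replicate_app_Cons_same)
  ultimately have "(lowers i Vs ^^ Suc t) (p @ replicate (Suc u + t) (b + 1) @ r)
    ((p @ replicate u (b + 1)) @ b # replicate t b @ r)"
    unfolding relpowp.simps by (metis relcomppI)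
  then show ?case
    by simp
qed simp


section \<open>Sorted words\<close>

text \<open>
  The numbers of letters different from \<open>1\<close> and equal to \<open>-1\<close>, and the decreasing word with given
  such numbers.
\<close>

definition non_top :: "int list \<Rightarrow> nat" where
  "non_top w = length (filter (\<lambda>a. a \<noteq> 1) w)"

definition bottoms :: "int list \<Rightarrow> nat" where
  "bottoms w = length (filter (\<lambda>a. a = -1) w)"

definition decreasing :: "nat \<Rightarrow> nat \<Rightarrow> nat \<Rightarrow> int list" where
  "decreasing N A B = replicate (N - A) 1 @ replicate (A - B) 0 @ replicate B (-1)"

lemma non_top_simps [simp]:
  "non_top [] = 0" "non_top (a # w) = (if a = 1 then 0 else 1) + non_top w"
  "non_top (v @ w) = non_top v + non_top w"
  "non_top (replicate k a) = (if a = 1 then 0 else k)"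
  by (auto simp: non_top_def)

lemma bottoms_simps [simp]:
  "bottoms [] = 0" "bottoms (a # w) = (if a = -1 then 1 else 0) + bottoms w"
  "bottoms (v @ w) = bottoms v + bottoms w"
  "bottoms (replicate k a) = (if a = -1 then k else 0)"
  by (auto simp: bottoms_def)

lemma bottoms_le_non_top: "bottoms w \<le> non_top w"
  and non_top_le_length: "non_top w \<le> length w"
  by (induction w) auto

lemma decreasing_stats:
  assumes "B \<le> A" "A \<le> N"
  shows "length (decreasing N A B) = N" "non_top (decreasing N A B) = A" "bottoms (decreasing N A B) = B"
  using assms by (auto simp: decreasing_def)

lemma decreasing_Cons:
  "A < N \<Longrightarrow> decreasing N A B = 1 # decreasing (N - 1) A B"
  "B < N \<Longrightarrow> decreasing N N B = 0 # decreasing (N - 1) (N - 1) B"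
  "0 < N \<Longrightarrow> decreasing N N N = -1 # decreasing (N - 1) (N - 1) (N - 1)"
proof -
  show "A < N \<Longrightarrow> decreasing N A B = 1 # decreasing (N - 1) A B"
    by (simp add: decreasing_def Suc_diff_Suc flip: replicate_Suc)
  show "B < N \<Longrightarrow> decreasing N N B = 0 # decreasing (N - 1) (N - 1) B"
    by (simp add: decreasing_def Suc_diff_Suc flip: replicate_Suc)
  show "0 < N \<Longrightarrow> decreasing N N N = -1 # decreasing (N - 1) (N - 1) (N - 1)"
    by (cases N) (simp_all add: decreasing_def)
qed

text \<open>
  Words are compared lexicographically.  Among the words with at least \<open>A\<close> letters different from
  \<open>1\<close> and at least \<open>B\<close> letters \<open>-1\<close>, the decreasing word is the largest one.
\<close>

lemma le_decreasing:
  "set w \<subseteq> {-1, 0, 1} \<Longrightarrow> A \<le> non_top w \<Longrightarrow> B \<le> bottoms w \<Longrightarrow> B \<le> A \<Longrightarrow> w \<le> decreasing (length w) A B"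
proof (induction w arbitrary: A B)
  case (Cons a w)
  let ?N = "Suc (length w)"
  have le: "non_top w \<le> length w" "bottoms w \<le> length w"
    using non_top_le_length[of w] bottoms_le_non_top[of w] by simp_all
  have "A \<le> ?N" "B \<le> A"
    using order.trans[OF Cons.prems(2) non_top_le_length] Cons.prems(4) by simp_all
  then consider "A < ?N" | "A = ?N" "B < ?N" | "A = ?N" "B = ?N"
    by linarith
  then show ?case
  proof cases
    case 1
    then show ?thesis
      using decreasing_Cons(1)[OF 1, of B] Cons.IH[of A B] Cons.prems by (auto split: if_splits)
  next
    case 2
    then have "a \<noteq> 1"
      using Cons.prems(2) le by (auto split: if_splits)
    then show ?thesis
      using decreasing_Cons(2)[OF 2(2)] 2 Cons.IH[of "length w" B] Cons.prems by (auto split: if_splits)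
  next
    case 3
    then have "a = -1"
      using Cons.prems(3) le by (auto split: if_splits)
    then show ?thesis
      using decreasing_Cons(3)[of ?N] 3 Cons.IH[of "length w" "length w"] Cons.prems by simp
  qed
qed (simp add: decreasing_def)

lemma decreasing_if_sorted:
  "set w \<subseteq> {-1, 0, 1} \<Longrightarrow> sorted_wrt (\<ge>) w \<Longrightarrow> w = decreasing (length w) (non_top w) (bottoms w)"
proof (induction w)
  case (Cons a w)
  have le: "non_top w \<le> length w" "bottoms w \<le> non_top w"
    using non_top_le_length[of w] bottoms_le_non_top[of w] by simp_all
  have IH: "w = decreasing (length w) (non_top w) (bottoms w)"
    using Cons by simp
  have "\<forall>b\<in>set w. b \<le> a"
    using Cons.prems by simp
  consider "a = 1" | "a = 0" | "a = -1"
    using Cons.prems by auto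
  then show ?case
  proof cases
    case 1
    then show ?thesis
      using IH le decreasing_Cons(1)[of "non_top w" "Suc (length w)"] by simp
  next
    case 2
    then have "\<forall>b\<in>set w. b \<noteq> 1"
      using \<open>\<forall>b\<in>set w. b \<le> a\<close> by auto
    then have "non_top w = length w"
      by (simp add: non_top_def)
    then show ?thesis
      using IH le 2 decreasing_Cons(2)[of "bottoms w" "Suc (length w)"] by simp
  next
    case 3
    then have "\<forall>b\<in>set w. b = -1"
      using \<open>\<forall>b\<in>set w. b \<le> a\<close> Cons.prems by fastforce
    then have "\<forall>b\<in>set w. b \<noteq> 1"
      by auto
    with \<open>\<forall>b\<in>set w. b = -1\<close> have "non_top w = length w" "bottoms w = length w"
      by (simp_all add: non_top_def bottoms_def)
    then show ?thesis
      using IH le 3 decreasing_Cons(3)[of "Suc (length w)"] by simp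
  qed
qed (simp add: decreasing_def)

lemma sorted_if_no_ascent:
  "(\<And>p a b r. w = p @ a # b # r \<Longrightarrow> b \<le> a) \<Longrightarrow> sorted_wrt (\<ge>) (w :: int list)"
proof (induction w)
  case (Cons a w)
  have w: "sorted_wrt (\<ge>) w"
  proof (rule Cons.IH)
    fix p b c r assume "w = p @ b # c # r"
    then show "c \<le> b"
      using Cons.prems[of "a # p" b c r] by simp
  qed
  show ?case
  proof (cases w)
    case (Cons b v)
    then show ?thesis
      using w Cons.prems[of "[]" a b v] by auto
  qed simp
qed simp

lemma append_less_append:
  "length p = length p' \<Longrightarrow> p @ r \<le> p' @ r' \<longleftrightarrow> p < p' \<or> p = p' \<and> r \<le> (r' :: int list)"
  by (induction p p' rule: list_induct2) auto


section \<open>Spanning by lowered top vectors\<close>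

text \<open>The tensor factors of the partition into single dots.\<close>

definition factor_seq :: "nat \<Rightarrow> nat \<Rightarrow> factor list" where
  "factor_seq m n = replicate m V_Plus @ replicate n V_Minus"

lemma length_factor_seq [simp]: "length (factor_seq m n) = m + n"
  and V_Triv_factor_seq [simp]: "V_Triv \<notin> set (factor_seq m n)"
  by (auto simp: factor_seq_def)

lemma nth_factor_seq: "k < m + n \<Longrightarrow> factor_seq m n ! k = (if k < m then V_Plus else V_Minus)"
  by (simp add: factor_seq_def nth_append)

lemma listset_factor_seq:
  "listset (map labels (factor_seq m n)) = {w. length w = m + n \<and> set w \<subseteq> {-1, 0, 1}}"
proof -
  have *: "listset As = {w. length w = length As \<and> set w \<subseteq> {-1, 0, 1}}"
    if "set As \<subseteq> {{-1, 0, 1}}" for As :: "int set list"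
    using that
  proof (induction As)
    case (Cons A As)
    then have "A = {-1, 0, 1}" "listset As = {w. length w = length As \<and> set w \<subseteq> {-1, 0, 1}}"
      by auto
    then show ?case
      by (auto simp: set_Cons_def length_Suc_conv)
  qed auto
  show ?thesis
    by (subst *) (auto simp: factor_seq_def)
qed

lemma valid_factor_seq_word:
  "valid (factor_seq m n) x \<Longrightarrow> Poly_Mapping.lookup x w \<noteq> 0 \<Longrightarrow> length w = m + n \<and> set w \<subseteq> {-1, 0, 1}"
  unfolding valid_def listset_factor_seq by (auto simp: in_keys_iff)

text \<open>The subspace that will be identified with the cohomology in degree \<open>0\<close>.\<close>

definition H0 :: "nat \<Rightarrow> nat \<Rightarrow> (int list \<Rightarrow>\<^sub>0 kk) set" where
  "H0 m n = {x. valid (factor_seq m n) x \<and> harmonic (factor_seq m n) x}"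

lemma H0_zero: "0 \<in> H0 m n"
  and H0_add: "x \<in> H0 m n \<Longrightarrow> y \<in> H0 m n \<Longrightarrow> x + y \<in> H0 m n"
  and H0_scale: "x \<in> H0 m n \<Longrightarrow> scale c x \<in> H0 m n"
  and H0_tact: "x \<in> H0 m n \<Longrightarrow> tact (factor_seq m n) g x \<in> H0 m n"
  by (simp_all add: H0_def valid_0 valid_add valid_scale valid_tact harmonic_0 harmonic_add
      harmonic_scale harmonic_tact)

lemma H0_top: "top_vector (m + n) \<in> H0 m n"
  using valid_top[of "factor_seq m n"] harmonic_top[of "factor_seq m n"] by (simp add: H0_def)

lemma H0_minus: "x \<in> H0 m n \<Longrightarrow> y \<in> H0 m n \<Longrightarrow> x - y \<in> H0 m n"
  using H0_add[of x m n "scale (-1) y"] H0_scale[of y m n "-1"] by simp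

text \<open>
  Bookkeeping for words that are reached from the top word: with \<open>p\<close> and \<open>r\<close> the words in the
  letters of the factors \<open>V\<^sub>+\<close> and \<open>V\<^sub>-\<close>, the numbers \<open>\<alpha>\<close> and \<open>\<beta>\<close> count the applications of
  \<open>F\<^sub>1\<close> and \<open>F\<^sub>2\<close>, and \<open>\<gamma>\<close> bounds the number of lowered letters of \<open>p\<close> from below.
\<close>

definition stat :: "nat \<Rightarrow> nat \<Rightarrow> nat \<Rightarrow> nat \<Rightarrow> nat \<Rightarrow> int list \<Rightarrow> bool" where
  "stat m n \<alpha> \<beta> \<gamma> w \<longleftrightarrow> (\<exists>p r. w = p @ r \<and> length p = m \<and> length r = n \<and>
     non_top p + bottoms r = \<alpha> \<and> bottoms p + non_top r = \<beta> \<and> \<gamma> \<le> non_top p)"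

lemma lowers_append:
  "lowers i (Us @ Ws) (p @ r) y \<Longrightarrow> length p = length Us \<Longrightarrow>
    (\<exists>p'. y = p' @ r \<and> lowers i Us p p') \<or> (\<exists>r'. y = p @ r' \<and> lowers i Ws r r')"
proof (induction Us arbitrary: p y)
  case (Cons U Us)
  then obtain a p' where p: "p = a # p'" "length p' = length Us"
    by (cases p) auto
  have "lowers i (U # (Us @ Ws)) (a # (p' @ r)) y"
    using Cons.prems(1) by (simp add: p)
  then show ?case
  proof cases
    case (lowers_here b)
    then show ?thesis
      by (auto simp: p intro: lowers.lowers_here)
  next
    case (lowers_later w')
    then show ?thesis
      using Cons.IH[OF lowers_later(2) p(2)] by (auto simp: p intro: lowers.lowers_later)
  qed
qed simp

lemma lowers_uniform:
  "lowers i Vs p p' \<Longrightarrow> set Vs \<subseteq> {V} \<Longrightarrow> source V i = Some b \<Longrightarrow> b \<in> {-1, 0} \<Longrightarrow>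
    length p' = length p \<and>
    non_top p' = non_top p + (if b = 0 then 1 else 0) \<and> bottoms p' = bottoms p + (if b = 0 then 0 else 1)"
  by (induction rule: lowers.induct) auto

lemma stat_lowers:
  assumes "stat m n \<alpha> \<beta> \<gamma> w" "lowers i (factor_seq m n) w y"
  shows "stat m n (\<alpha> + (if i = N1 then 1 else 0)) (\<beta> + (if i = N1 then 0 else 1)) \<gamma> y"
proof -
  obtain p r where w: "w = p @ r" "length p = m" "length r = n" "non_top p + bottoms r = \<alpha>"
    "bottoms p + non_top r = \<beta>" "\<gamma> \<le> non_top p"
    using assms(1) by (auto simp: stat_def)
  have "lowers i (replicate m V_Plus @ replicate n V_Minus) (p @ r) y"
    using assms(2) w(1) by (simp add: factor_seq_def)
  then consider p' where "y = p' @ r" "lowers i (replicate m V_Plus) p p'"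
    | r' where "y = p @ r'" "lowers i (replicate n V_Minus) r r'"
    using lowers_append w(2) by (metis length_replicate)
  then show ?thesis
  proof cases
    case 1
    then show ?thesis
      unfolding stat_def using w lowers_uniform[OF 1(2), of V_Plus]
      by (intro exI[of _ p'] exI[of _ r]) (cases i; auto simp: set_replicate_conv_if)
  next
    case 2
    then show ?thesis
      unfolding stat_def using w lowers_uniform[OF 2(2), of V_Minus]
      by (intro exI[of _ p] exI[of _ r']) (cases i; auto simp: set_replicate_conv_if)
  qed
qed

lemma stat_tact_F_power:
  assumes "\<And>w. Poly_Mapping.lookup x w \<noteq> 0 \<Longrightarrow> stat m n \<alpha> \<beta> \<gamma> w"
    and "Poly_Mapping.lookup ((tact (factor_seq m n) (F i) ^^ t) x) y \<noteq> 0"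
  shows "stat m n (\<alpha> + (if i = N1 then t else 0)) (\<beta> + (if i = N1 then 0 else t)) \<gamma> y"
  using assms(2)
proof (induction t arbitrary: y)
  case 0
  then show ?case
    using assms(1) by simp
next
  case (Suc t)
  then obtain w where "Poly_Mapping.lookup ((tact (factor_seq m n) (F i) ^^ t) x) w \<noteq> 0"
    "lowers i (factor_seq m n) w y"
    using tact_F_support by fastforce
  then show ?case
    using stat_lowers[OF Suc.IH, of w i y] by (cases i) auto
qed

text \<open>\<open>F\<^sub>1\<^sup>a F\<^sub>2\<^sup>b F\<^sub>1\<^sup>c\<close> applied to the highest weight vector.\<close>

definition lowered_top :: "nat \<Rightarrow> nat \<Rightarrow> nat \<Rightarrow> nat \<Rightarrow> nat \<Rightarrow> (int list \<Rightarrow>\<^sub>0 kk)" where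
  "lowered_top m n a b c = (tact (factor_seq m n) (F N1) ^^ a) ((tact (factor_seq m n) (F N2) ^^ b)
     ((tact (factor_seq m n) (F N1) ^^ c) (top_vector (m + n))))"

lemma funpow_closed: "(\<And>x. x \<in> S \<Longrightarrow> f x \<in> S) \<Longrightarrow> x \<in> S \<Longrightarrow> (f ^^ k) x \<in> S"
  by (induction k) simp_all

lemma lowered_top_in:
  "top_vector (m + n) \<in> S \<Longrightarrow> (\<And>i x. x \<in> S \<Longrightarrow> tact (factor_seq m n) (F i) x \<in> S) \<Longrightarrow> lowered_top m n a b c \<in> S"
  unfolding lowered_top_def by (intro funpow_closed)

lemma lowered_top_H0: "lowered_top m n a b c \<in> H0 m n"
  by (rule lowered_top_in) (simp_all add: H0_top H0_tact)

lemma lowered_top_stat: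
  assumes "Poly_Mapping.lookup (lowered_top m n a b c) y \<noteq> 0"
  shows "stat m n (c + a) b c y"
proof -
  have 0: "stat m n 0 0 0 w" if "Poly_Mapping.lookup (top_vector (m + n)) w \<noteq> 0" for w
  proof -
    have "w = replicate m 1 @ replicate n 1"
      using that by (auto simp: top_vector_def lookup_single when_def replicate_add split: if_splits)
    then show ?thesis
      unfolding stat_def by (intro exI[of _ "replicate m 1"] exI[of _ "replicate n 1"]) simp
  qed
  have 1: "stat m n c 0 c w"
    if "Poly_Mapping.lookup ((tact (factor_seq m n) (F N1) ^^ c) (top_vector (m + n))) w \<noteq> 0" for w
  proof -
    have "stat m n (0 + (if N1 = N1 then c else 0)) (0 + (if N1 = N1 then 0 else c)) 0 w"
      by (rule stat_tact_F_power[OF 0 that])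
    then have "stat m n c 0 0 w"
      by simp
    then obtain p r where w: "w = p @ r" "length p = m" "length r = n" "non_top p + bottoms r = c"
      "bottoms p + non_top r = 0"
      unfolding stat_def by (elim exE conjE) (rule that)
    moreover have "bottoms r = 0"
      using w bottoms_le_non_top[of r] by simp
    ultimately show ?thesis
      unfolding stat_def by (intro exI[of _ p] exI[of _ r]) simp
  qed
  have 2: "stat m n c b c w" if "Poly_Mapping.lookup ((tact (factor_seq m n) (F N2) ^^ b)
     ((tact (factor_seq m n) (F N1) ^^ c) (top_vector (m + n)))) w \<noteq> 0" for w
  proof -
    have "stat m n (c + (if N2 = N1 then b else 0)) (0 + (if N2 = N1 then 0 else b)) c w"
      by (rule stat_tact_F_power[OF 1 that])
    then show ?thesis
      by simp
  qed
  have "stat m n (c + (if N1 = N1 then a else 0)) (b + (if N1 = N1 then 0 else a)) c y"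
    by (rule stat_tact_F_power[OF 2 assms[unfolded lowered_top_def]])
  then show ?thesis
    by simp
qed

lemma nonneg_vec_top: "nonneg_vec (top_vector N)"
  by (simp add: nonneg_vec_def top_vector_def lookup_single when_def nonneg_def positive_1)

text \<open>
  The largest word of a lowered top vector.  The words \<open>x\<close> of this form are exactly those without
  good pairs: they decrease weakly on the letters of \<open>V\<^sub>+\<close> and on those of \<open>V\<^sub>-\<close>, and if the former
  end with \<open>-1\<close> then the latter do not begin with \<open>1\<close>.
\<close>

lemma lowered_top_leading:
  assumes "k \<le> c" "c \<le> m" "a \<le> t" "t \<le> n" "k = 0 \<or> t = n"
  defines "x \<equiv> decreasing m c k @ decreasing n t a"
  shows "Poly_Mapping.lookup (lowered_top m n a (k + t) c) x \<noteq> 0"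
    and "Poly_Mapping.lookup (lowered_top m n a (k + t) c) y \<noteq> 0 \<Longrightarrow> y \<le> x"
proof -
  let ?l = "\<lambda>i. lowers i (factor_seq m n)"
  have "(?l N1 ^^ c) ([] @ replicate ((m - c) + c) (0 + 1) @ replicate n 1)
    ([] @ replicate (m - c) (0 + 1) @ replicate c 0 @ replicate n 1)"
    by (rule lowers_replicate) (use assms(2) in \<open>auto simp: nth_factor_seq\<close>)
  then have 1: "(?l N1 ^^ c) (replicate (m + n) 1) (replicate (m - c) 1 @ replicate c 0 @ replicate n 1)"
    using assms(2) by (simp add: replicate_add)
  have "(?l N2 ^^ t) ((replicate (m - c) 1 @ replicate c 0) @ replicate ((n - t) + t) (0 + 1) @ [])
    ((replicate (m - c) 1 @ replicate c 0) @ replicate (n - t) (0 + 1) @ replicate t 0 @ [])"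
    by (rule lowers_replicate) (use assms(2,4) in \<open>auto simp: nth_factor_seq\<close>)
  then have 2: "(?l N2 ^^ t) (replicate (m - c) 1 @ replicate c 0 @ replicate n 1)
    (replicate (m - c) 1 @ replicate c 0 @ replicate (n - t) 1 @ replicate t 0)"
    using assms(4) by simp
  have "(?l N2 ^^ k) (replicate (m - c) 1 @ replicate ((c - k) + k) (-1 + 1) @ replicate (n - t) 1 @ replicate t 0)
    (replicate (m - c) 1 @ replicate (c - k) (-1 + 1) @ replicate k (-1) @ replicate (n - t) 1 @ replicate t 0)"
    by (rule lowers_replicate) (use assms(1,2) in \<open>auto simp: nth_factor_seq\<close>)
  then have 3: "(?l N2 ^^ k) (replicate (m - c) 1 @ replicate c 0 @ replicate (n - t) 1 @ replicate t 0)
    (decreasing m c k @ replicate (n - t) 1 @ replicate t 0)"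
    using assms(1) by (simp add: decreasing_def)
  have "(?l N1 ^^ a) ((decreasing m c k @ replicate (n - t) 1) @ replicate ((t - a) + a) (-1 + 1) @ [])
    ((decreasing m c k @ replicate (n - t) 1) @ replicate (t - a) (-1 + 1) @ replicate a (-1) @ [])"
    by (rule lowers_replicate) (use assms(1-4) in \<open>auto simp: nth_factor_seq decreasing_stats\<close>)
  then have 4: "(?l N1 ^^ a) (decreasing m c k @ replicate (n - t) 1 @ replicate t 0) x"
    using assms(3) by (simp add: x_def decreasing_def)
  have "Poly_Mapping.lookup (top_vector (m + n)) (replicate (m + n) 1) \<noteq> 0"
    by (simp add: top_vector_def)
  from tact_F_power_support_nonneg[OF 1 nonneg_vec_top this]
  have "Poly_Mapping.lookup ((tact (factor_seq m n) (F N1) ^^ c) (top_vector (m + n)))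
    (replicate (m - c) 1 @ replicate c 0 @ replicate n 1) \<noteq> 0" .
  from tact_F_power_support_nonneg[OF 2 _ this]
  have "Poly_Mapping.lookup ((tact (factor_seq m n) (F N2) ^^ t)
    ((tact (factor_seq m n) (F N1) ^^ c) (top_vector (m + n))))
    (replicate (m - c) 1 @ replicate c 0 @ replicate (n - t) 1 @ replicate t 0) \<noteq> 0"
    by (simp add: nonneg_vec_tact_F_power nonneg_vec_top)
  from tact_F_power_support_nonneg[OF 3 _ this]
  have "Poly_Mapping.lookup ((tact (factor_seq m n) (F N2) ^^ (k + t))
    ((tact (factor_seq m n) (F N1) ^^ c) (top_vector (m + n))))
    (decreasing m c k @ replicate (n - t) 1 @ replicate t 0) \<noteq> 0"
    by (simp add: nonneg_vec_tact_F_power nonneg_vec_top funpow_add)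
  from tact_F_power_support_nonneg[OF 4 _ this]
  show "Poly_Mapping.lookup (lowered_top m n a (k + t) c) x \<noteq> 0"
    by (simp add: nonneg_vec_tact_F_power nonneg_vec_top lowered_top_def)
  assume y: "Poly_Mapping.lookup (lowered_top m n a (k + t) c) y \<noteq> 0"
  then obtain p r where pr: "y = p @ r" "length p = m" "length r = n" "non_top p + bottoms r = c + a"
    "bottoms p + non_top r = k + t" "c \<le> non_top p"
    using lowered_top_stat[OF y] unfolding stat_def by (elim exE conjE) (rule that)
  have "set y \<subseteq> {-1, 0, 1}"
    using valid_factor_seq_word[OF _ y, of m n] lowered_top_H0[of m n] by (simp add: H0_def)
  then have set: "set p \<subseteq> {-1, 0, 1}" "set r \<subseteq> {-1, 0, 1}"
    by (auto simp: pr(1))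
  have "k \<le> bottoms p"
    using assms(5) pr(3,5) non_top_le_length[of r] by auto
  then have p: "p \<le> decreasing m c k"
    using le_decreasing[OF set(1) pr(6) _ assms(1)] pr(2) by simp
  have r: "r \<le> decreasing n t a" if "p = decreasing m c k"
  proof -
    have "non_top p = c" "bottoms p = k"
      using that assms(1,2) by (simp_all add: decreasing_stats)
    then show ?thesis
      using le_decreasing[OF set(2), of t a] pr assms(3) by simp
  qed
  have len: "length p = length (decreasing m c k)"
    using assms(1,2) pr(2) by (simp add: decreasing_stats)
  show "y \<le> x"
    unfolding x_def pr(1) append_less_append[OF len]
    using p r order.not_eq_order_implies_strict by blast
qed

text \<open>
  The largest word of a vector in the kernel has no good pair: an ascent could be replaced by the
  descent, and \<open>(-1, 1)\<close> at the change of colour by \<open>(0, 0)\<close> or \<open>(1, -1)\<close>, which are larger.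
\<close>

lemma H0_leading:
  assumes x: "x \<in> H0 m n" and w: "Poly_Mapping.lookup x w \<noteq> 0"
    and max: "\<And>y. Poly_Mapping.lookup x y \<noteq> 0 \<Longrightarrow> y \<le> w"
  obtains k c a t where "k \<le> c" "c \<le> m" "a \<le> t" "t \<le> n" "k = 0 \<or> t = n"
    "w = decreasing m c k @ decreasing n t a"
proof -
  have x: "valid (factor_seq m n) x" "harmonic (factor_seq m n) x"
    using x by (simp_all add: H0_def)
  have len: "length w = m + n" and set: "set w \<subseteq> {-1, 0, 1}"
    using valid_factor_seq_word[OF x(1) w] by auto
  define p r where "p = take m w" and "r = drop m w"
  have pr: "w = p @ r" "length p = m" "length r = n"
    using len by (simp_all add: p_def r_def)
  have lab: "set p \<subseteq> {-1, 0, 1}" "set r \<subseteq> {-1, 0, 1}"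
    using set pr(1) by auto
  have *: "b \<le> a" if "w = u @ a # b # v" "factor_seq m n ! length u = factor_seq m n ! Suc (length u)" for u a b v
  proof (rule ccontr)
    assume "\<not> b \<le> a"
    moreover have "a \<in> {-1, 0, 1}" "b \<in> {-1, 0, 1}"
      using set that(1) by auto
    moreover have "Suc (length u) < length (factor_seq m n)"
      using len that(1) by simp
    ultimately have "Poly_Mapping.lookup x (u @ b # a # v) \<noteq> 0"
      using harmonic_swap[OF x(2) _ that(2), of a b v] w that(1) by auto
    then have "u @ b # a # v \<le> u @ a # b # v"
      using max that(1) by blast
    then show False
      using \<open>\<not> b \<le> a\<close> by (simp add: append_less_append)
  qed
  have "sorted_wrt (\<ge>) p"
  proof (rule sorted_if_no_ascent)
    fix u a b v assume "p = u @ a # b # v"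
    then show "b \<le> a"
      using *[of u a b "v @ r"] pr by (auto simp: nth_factor_seq)
  qed
  moreover have "sorted_wrt (\<ge>) r"
  proof (rule sorted_if_no_ascent)
    fix u a b v assume "r = u @ a # b # v"
    then show "b \<le> a"
      using *[of "p @ u" a b v] pr by (auto simp: nth_factor_seq)
  qed
  ultimately have w_eq: "p = decreasing m (non_top p) (bottoms p)" "r = decreasing n (non_top r) (bottoms r)"
    using decreasing_if_sorted[OF lab(1)] decreasing_if_sorted[OF lab(2)] pr by simp_all
  have "bottoms p = 0 \<or> non_top r = n"
  proof (rule ccontr)
    assume "\<not> (bottoms p = 0 \<or> non_top r = n)"
    then obtain B where B: "bottoms p = Suc B" and r: "non_top r < n"
      using non_top_le_length[of r] pr by (cases "bottoms p") auto
    obtain u where u: "p = u @ [-1]"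
      using arg_cong[OF w_eq(1), of "\<lambda>p. p"] B
      by (metis append.assoc decreasing_def replicate_Suc replicate_append_same)
    obtain v where v: "r = 1 # v"
      using w_eq(2) decreasing_Cons(1)[OF r] by metis
    have m: "m = Suc (length u)" "n = Suc (length v)"
      using pr u v by auto
    have w': "w = u @ -1 # 1 # v"
      by (simp add: pr u v)
    have "Poly_Mapping.lookup x (u @ 0 # 0 # v) =
      inverse q * Poly_Mapping.lookup x (u @ -1 # 1 # v) + q * Poly_Mapping.lookup x (u @ 1 # -1 # v)"
      by (rule harmonic_contract[OF x(2)]) (simp_all add: m nth_factor_seq)
    then have "Poly_Mapping.lookup x (u @ 0 # 0 # v) \<noteq> 0 \<or> Poly_Mapping.lookup x (u @ 1 # -1 # v) \<noteq> 0"
      using w unfolding w' by auto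
    then show False
      using max unfolding w' by (fastforce simp: append_less_append)
  qed
  with that[of "bottoms p" "non_top p" "bottoms r" "non_top r"] show ?thesis
    using w_eq pr bottoms_le_non_top non_top_le_length by metis
qed

text \<open>
  A finite spanning set.  The bounds on the exponents suffice to reach every word without good
  pairs.
\<close>

definition spanning :: "nat \<Rightarrow> nat \<Rightarrow> (int list \<Rightarrow>\<^sub>0 kk) set" where
  "spanning m n = (\<lambda>(a, b, c). lowered_top m n a b c) ` ({..n} \<times> {..m + n} \<times> {..m})"

lemma finite_spanning: "finite (spanning m n)"
  by (simp add: spanning_def)

lemma finite_words: "finite {w :: int list. length w = N \<and> set w \<subseteq> {-1, 0, 1}}"
  using finite_lists_length_eq[of "{-1, 0, 1 :: int}" N] by (simp add: conj_commute)

text \<open>Subtraction of a multiple of a lowered top vector removes the largest word.\<close>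

lemma H0_span: "x \<in> H0 m n \<Longrightarrow> x \<in> free.span (spanning m n)"
proof (induction "card {w. length w = m + n \<and> set w \<subseteq> {-1, 0, 1} \<and> (\<exists>y. Poly_Mapping.lookup x y \<noteq> 0 \<and> w \<le> y)}"
    arbitrary: x rule: less_induct)
  case less
  show ?case
  proof (cases "x = 0")
    case True
    then show ?thesis
      by (simp add: free.span_zero)
  next
    case False
    define w where "w = Max (Poly_Mapping.keys x)"
    have "Poly_Mapping.keys x \<noteq> {}"
      using False by (metis poly_mapping_eqI empty_iff in_keys_iff lookup_zero)
    then have w: "Poly_Mapping.lookup x w \<noteq> 0"
      unfolding w_def in_keys_iff[symmetric] by (intro Max_in) auto
    have max: "y \<le> w" if "Poly_Mapping.lookup x y \<noteq> 0" for y
      unfolding w_def using that by (intro Max_ge) (auto simp: in_keys_iff)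
    obtain k c a t where kc: "k \<le> c" "c \<le> m" "a \<le> t" "t \<le> n" "k = 0 \<or> t = n"
      and w_eq: "w = decreasing m c k @ decreasing n t a"
      using H0_leading[OF less.prems w max] by blast
    define u where "u = lowered_top m n a (k + t) c"
    have u: "Poly_Mapping.lookup u w \<noteq> 0" "\<And>y. Poly_Mapping.lookup u y \<noteq> 0 \<Longrightarrow> y \<le> w"
      using lowered_top_leading[OF kc] unfolding u_def w_eq by blast+
    have "u \<in> spanning m n"
      unfolding u_def spanning_def using kc by (intro image_eqI[of _ _ "(a, k + t, c)"]) auto
    define d where "d = Poly_Mapping.lookup x w / Poly_Mapping.lookup u w"
    define x' where "x' = x - scale d u"
    have x': "x' \<in> H0 m n"
      unfolding x'_def using less.prems lowered_top_H0 by (simp add: u_def H0_minus H0_scale)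
    have lt: "y < w" if "Poly_Mapping.lookup x' y \<noteq> 0" for y
    proof -
      have "Poly_Mapping.lookup x' w = 0"
        using u(1) by (simp add: x'_def d_def lookup_minus)
      moreover have "y \<le> w"
        using that max[of y] u(2)[of y]
        by (cases "Poly_Mapping.lookup x y = 0") (auto simp: x'_def lookup_minus)
      ultimately show ?thesis
        using that by (metis order.not_eq_order_implies_strict)
    qed
    have "x' \<in> free.span (spanning m n)"
    proof (rule less.hyps[OF _ x'], rule psubset_card_mono)
      show "finite {w. length w = m + n \<and> set w \<subseteq> {-1, 0, 1} \<and> (\<exists>y. Poly_Mapping.lookup x y \<noteq> 0 \<and> w \<le> y)}"
        by (rule finite_subset[OF _ finite_words[of "m + n"]]) auto
      have "w \<notin> {w. length w = m + n \<and> set w \<subseteq> {-1, 0, 1} \<and> (\<exists>y. Poly_Mapping.lookup x' y \<noteq> 0 \<and> w \<le> y)}"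
        using lt by fastforce
      moreover have "w \<in> {w. length w = m + n \<and> set w \<subseteq> {-1, 0, 1} \<and> (\<exists>y. Poly_Mapping.lookup x y \<noteq> 0 \<and> w \<le> y)}"
        using w valid_factor_seq_word[OF _ w, of m n] less.prems by (auto simp: H0_def)
      moreover have "{w. length w = m + n \<and> set w \<subseteq> {-1, 0, 1} \<and> (\<exists>y. Poly_Mapping.lookup x' y \<noteq> 0 \<and> w \<le> y)}
        \<subseteq> {w. length w = m + n \<and> set w \<subseteq> {-1, 0, 1} \<and> (\<exists>y. Poly_Mapping.lookup x y \<noteq> 0 \<and> w \<le> y)}"
        using lt w by (fastforce intro: less_imp_le order.trans)
      ultimately show "{w. length w = m + n \<and> set w \<subseteq> {-1, 0, 1} \<and> (\<exists>y. Poly_Mapping.lookup x' y \<noteq> 0 \<and> w \<le> y)}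
        \<subset> {w. length w = m + n \<and> set w \<subseteq> {-1, 0, 1} \<and> (\<exists>y. Poly_Mapping.lookup x y \<noteq> 0 \<and> w \<le> y)}"
        by blast
    qed
    then have "x' + scale d u \<in> free.span (spanning m n)"
      using \<open>u \<in> spanning m n\<close> by (rule free.span_add[OF _ free.span_scale[OF free.span_base]])
    then show ?thesis
      by (simp add: x'_def)
  qed
qed


section \<open>A contravariant Hermitian form\<close>

text \<open>
  The words are orthogonal, and the word \<open>w\<close> has norm \<open>q\<close> to the power minus the sum of its
  letters.  The form is conjugate linear in its first argument.
\<close>

fun herm :: "factor list \<Rightarrow> (int list \<Rightarrow>\<^sub>0 kk) \<Rightarrow> (int list \<Rightarrow>\<^sub>0 kk) \<Rightarrow> kk" where
  "herm [] u y = conjugate (Poly_Mapping.lookup u []) * Poly_Mapping.lookup y []"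
| "herm (V # Vs) u y = (\<Sum>a\<in>labels V. q powi (-a) * herm Vs (slice a u) (slice a y))"

lemma finite_labels [simp]: "finite (labels V)"
  by (cases V) simp_all

lemma herm_add_right: "herm Vs u (y + z) = herm Vs u y + herm Vs u z"
  by (induction Vs arbitrary: u y z) (simp_all add: lookup_add algebra_simps sum.distrib)

lemma herm_add_left: "herm Vs (u + v) y = herm Vs u y + herm Vs v y"
  by (induction Vs arbitrary: u v y) (simp_all add: lookup_add conjugate_add algebra_simps sum.distrib)

lemma herm_scale_right: "herm Vs u (scale c y) = c * herm Vs u y"
  by (induction Vs arbitrary: u y) (simp_all add: mult_ac sum_distrib_left)

lemma herm_scale_left: "herm Vs (scale c u) y = conjugate c * herm Vs u y"
  by (induction Vs arbitrary: u y) (simp_all add: conjugate_mult mult_ac sum_distrib_left)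

lemma herm_0 [simp]: "herm Vs 0 y = 0" "herm Vs u 0 = 0"
  using herm_scale_left[of Vs 0 0 y] herm_scale_right[of Vs u 0 0] by simp_all

lemma nonneg_herm: "nonneg (herm Vs u u)"
  by (induction Vs arbitrary: u)
    (simp_all add: nonneg_norm nonneg_sum nonneg_mult nonneg_q_powi)

lemma herm_anisotropic: "valid Vs u \<Longrightarrow> herm Vs u u = 0 \<Longrightarrow> u = 0"
proof (induction Vs arbitrary: u)
  case Nil
  obtain c where u: "u = Poly_Mapping.single [] c"
    using Nil.prems(1) unfolding valid_Nil ..
  then show ?case
    using Nil.prems(2) by simp
next
  case (Cons V Vs)
  have "\<forall>a\<in>labels V. q powi (-a) * herm Vs (slice a u) (slice a u) = 0"
    using Cons.prems(2) by (simp add: nonneg_sum_eq_0 nonneg_mult nonneg_q_powi nonneg_herm)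
  then have "slice a u = 0" if "a \<in> labels V" for a
    using that Cons.IH[OF valid_slice[OF Cons.prems(1)]] by simp
  then show ?case
    using slice_outside[OF Cons.prems(1)] valid_lookup_Nil[OF Cons.prems(1)]
    by - (rule slice_eqI, metis slice_0, simp)
qed

lemma tact_E_Nil: "tact [] (E i) x = 0"
proof -
  have "word_act [] (E i) w = 0" for w
    by (cases w) simp_all
  then show ?thesis
    by (simp add: tact_def lin_ext_def)
qed

text \<open>The operators \<open>K i F i\<close> and \<open>E i\<close> are adjoint, and \<open>K i\<close> is self-adjoint.\<close>

lemma herm_adjoint: "herm Vs (tact Vs (F i) u) (tact Vs (K i) y) = herm Vs u (tact Vs (E i) y)"
proof (induction Vs arbitrary: u y)
  case Nil
  then show ?case
    by (simp add: tact_F_Nil tact_E_Nil)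
next
  case (Cons V Vs)
  show ?case
    using Cons.IH by (cases V; cases i)
      (simp_all add: slice_tact herm_add_left herm_add_right herm_scale_left herm_scale_right
        q_powi_simps algebra_simps q_inverse_cancel)
qed

lemma herm_top:
  "V_Triv \<notin> set Vs \<Longrightarrow>
    herm Vs (top_vector (length Vs)) y = q powi (- int (length Vs)) * Poly_Mapping.lookup y (replicate (length Vs) 1)"
proof (induction Vs arbitrary: y)
  case Nil
  then show ?case
    by (simp add: top_vector_def)
next
  case (Cons V Vs)
  have "labels V = {-1, 0, 1}"
    using Cons.prems by (cases V) auto
  then show ?case
    using Cons by (simp add: power_int_diff power_int_minus divide_inverse)
qed

text \<open>The operator \<open>K\<^sub>1 K\<^sub>2\<close> has the words as eigenvectors; it sees the sum of the letters.\<close>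

lemma lookup_tact_K_K:
  "valid Vs x \<Longrightarrow> Poly_Mapping.lookup (tact Vs (K N1) (tact Vs (K N2) x)) w =
    q powi (sum_list w) * Poly_Mapping.lookup x w"
proof (induction Vs arbitrary: x w)
  case Nil
  then obtain c where "x = Poly_Mapping.single [] c"
    unfolding valid_Nil ..
  then show ?case
    by (simp add: tact_def lookup_single when_def)
next
  case (Cons V Vs)
  show ?case
  proof (cases w)
    case Nil
    then show ?thesis
      using valid_lookup_Nil[OF Cons.prems] by simp
  next
    case (Cons a v)
    have "Poly_Mapping.lookup (tact (V # Vs) (K N1) (tact (V # Vs) (K N2) x)) w =
      Poly_Mapping.lookup (slice a (tact (V # Vs) (K N1) (tact (V # Vs) (K N2) x))) v"
      by (simp add: Cons)
    also have "\<dots> = q powi (weight V N1 a + weight V N2 a) * (q powi sum_list v * Poly_Mapping.lookup x w)"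
      unfolding slice_tact using Cons.IH[OF valid_slice[OF Cons.prems]] by (simp add: Cons power_int_add)
    also have "\<dots> = q powi sum_list w * Poly_Mapping.lookup x w"
    proof (cases "a \<in> labels V")
      case True
      then have "weight V N1 a + weight V N2 a = a"
        by (cases V) auto
      then show ?thesis
        by (simp add: Cons power_int_add)
    next
      case False
      then have "Poly_Mapping.lookup (slice a x) v = 0"
        using slice_outside[OF Cons.prems] by simp
      then show ?thesis
        by (simp add: Cons)
    qed
    finally show ?thesis .
  qed
qed


section \<open>Simplicity\<close>

text \<open>An invariant subspace is closed under the product of the operators \<open>K\<^sub>1 K\<^sub>2 - q\<^sup>s\<close> over \<open>s\<close> in \<open>S\<close>.\<close>

lemma weight_projection:
  assumes "\<And>x. x \<in> N \<Longrightarrow> valid Vs x" "\<And>x y. x \<in> N \<Longrightarrow> y \<in> N \<Longrightarrow> x + y \<in> N"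
    "\<And>c x. x \<in> N \<Longrightarrow> scale c x \<in> N" "\<And>g x. x \<in> N \<Longrightarrow> tact Vs g x \<in> N"
    and "finite S" "y \<in> N"
  shows "\<exists>y'\<in>N. \<forall>w. Poly_Mapping.lookup y' w =
    (\<Prod>s\<in>S. q powi sum_list w - q powi s) * Poly_Mapping.lookup y w"
  using assms(5)
proof (induction S)
  case empty
  then show ?case
    using assms(6) by auto
next
  case (insert s S)
  then obtain z where z: "z \<in> N" "\<And>w. Poly_Mapping.lookup z w =
    (\<Prod>s\<in>S. q powi sum_list w - q powi s) * Poly_Mapping.lookup y w"
    by blast
  let ?z = "tact Vs (K N1) (tact Vs (K N2) z) + scale (- (q powi s)) z"
  have "?z \<in> N"
    by (intro assms(2-4) z(1))
  moreover have "\<forall>w. Poly_Mapping.lookup ?z w =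
    (\<Prod>s\<in>insert s S. q powi sum_list w - q powi s) * Poly_Mapping.lookup y w"
    using insert.hyps lookup_tact_K_K[OF assms(1)[OF z(1)]] z(2)
    by (simp add: lookup_add lookup_minus algebra_simps)
  ultimately show ?case
    by blast
qed

lemma sum_list_le_length: "set w \<subseteq> {-1, 0, 1} \<Longrightarrow> \<bar>sum_list w\<bar> \<le> int (length w)"
  by (induction w) auto

lemma sum_list_eq_length: "set w \<subseteq> {-1, 0, 1} \<Longrightarrow> sum_list w = int (length w) \<Longrightarrow> w = replicate (length w) 1"
proof (induction w)
  case (Cons a w)
  then have "a = 1" "sum_list w = int (length w)"
    using sum_list_le_length[of w] by auto
  then show ?case
    using Cons by simp
qed simp

lemma top_in_submodule:
  assumes N: "N \<subseteq> H0 m n" "\<And>x y. x \<in> N \<Longrightarrow> y \<in> N \<Longrightarrow> x + y \<in> N"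
    "\<And>c x. x \<in> N \<Longrightarrow> scale c x \<in> N" "\<And>g x. x \<in> N \<Longrightarrow> tact (factor_seq m n) g x \<in> N"
    and x: "x \<in> N" "x \<noteq> 0"
  shows "top_vector (m + n) \<in> N"
proof -
  let ?Vs = "factor_seq m n" and ?t = "replicate (m + n) (1 :: int)"
  have valid: "valid ?Vs y" if "y \<in> N" for y
    using that N(1) by (auto simp: H0_def)
  \<comment> \<open>Otherwise the orthogonal complement of \<open>N\<close> would contain the top vector, and with it the whole
    space that it generates, which contains \<open>N\<close>.\<close>
  have "\<exists>y\<in>N. Poly_Mapping.lookup y ?t \<noteq> 0"
  proof (rule ccontr)
    assume "\<not> (\<exists>y\<in>N. Poly_Mapping.lookup y ?t \<noteq> 0)"
    then have *: "Poly_Mapping.lookup y ?t = 0" if "y \<in> N" for y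
      using that by blast
    define S where "S = {u. \<forall>y\<in>N. herm ?Vs u y = 0}"
    have "lowered_top m n a b c \<in> S" for a b c
    proof (rule lowered_top_in)
      show "top_vector (m + n) \<in> S"
        using herm_top[of ?Vs] * by (simp add: S_def)
      show "tact ?Vs (F i) u \<in> S" if "u \<in> S" for i u
        unfolding S_def
      proof (intro CollectI ballI)
        fix y assume y: "y \<in> N"
        have "herm ?Vs (tact ?Vs (F i) u) (tact ?Vs (K i) (tact ?Vs (Kinv i) y)) = 0"
          unfolding herm_adjoint using that y N(4) by (simp add: S_def)
        then show "herm ?Vs (tact ?Vs (F i) u) y = 0"
          by (simp add: tact_K_Kinv valid y)
      qed
    qed
    then have "spanning m n \<subseteq> S"
      by (auto simp: spanning_def)
    moreover have "free.subspace S"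
      by (rule free.subspaceI) (simp_all add: S_def herm_add_left herm_scale_left)
    ultimately have "free.span (spanning m n) \<subseteq> S"
      by (rule free.span_minimal)
    then have "x \<in> S"
      using H0_span x(1) N(1) by blast
    then show False
      using herm_anisotropic[OF valid[OF x(1)]] x by (simp add: S_def)
  qed
  then obtain y where y: "y \<in> N" "Poly_Mapping.lookup y ?t \<noteq> 0"
    by blast
  \<comment> \<open>The top word is the only one whose letters have the sum \<open>m + n\<close>.\<close>
  define S where "S = {- int (m + n)..<int (m + n)}"
  obtain y' where y': "y' \<in> N" "\<And>w. Poly_Mapping.lookup y' w =
    (\<Prod>s\<in>S. q powi sum_list w - q powi s) * Poly_Mapping.lookup y w"
    using weight_projection[OF valid N(2-4) _ y(1), of S] by (auto simp: S_def)
  define c where "c = Poly_Mapping.lookup y' ?t"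
  have "c \<noteq> 0"
    using y(2) unfolding c_def y'(2) by (auto simp: S_def q_powi_inj sum_list_replicate)
  have "y' = scale c (top_vector (m + n))"
  proof (rule poly_mapping_eqI)
    fix w
    show "Poly_Mapping.lookup y' w = Poly_Mapping.lookup (scale c (top_vector (m + n))) w"
    proof (cases "w = ?t")
      case True
      then show ?thesis
        by (simp add: c_def top_vector_def)
    next
      case False
      have "Poly_Mapping.lookup y' w = 0"
      proof (rule ccontr)
        assume w: "Poly_Mapping.lookup y' w \<noteq> 0"
        then have len: "length w = m + n" "set w \<subseteq> {-1, 0, 1}"
          using valid_factor_seq_word[OF valid[OF y'(1)]] by auto
        then have "sum_list w \<in> S"
          using sum_list_le_length[of w] sum_list_eq_length[of w] False by (force simp: S_def)
        then show False
          using w unfolding y'(2) by (auto simp: S_def)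
      qed
      then show ?thesis
        using False by (simp add: top_vector_def lookup_single)
    qed
  qed
  then have "top_vector (m + n) = scale (inverse c) y'"
    using \<open>c \<noteq> 0\<close> by simp
  then show ?thesis
    using y'(1) N(3) by simp
qed

text \<open>The space \<open>H0\<close> as a module.\<close>

definition H0_module :: "nat \<Rightarrow> nat \<Rightarrow> (int list \<Rightarrow>\<^sub>0 kk) uq_module" where
  "H0_module m n = tensor_module (factor_seq m n)\<lparr>carrier := H0 m n\<rparr>"

lemma H0_module_simps [simp]:
  "carrier (H0_module m n) = H0 m n" "x \<oplus>\<^bsub>H0_module m n\<^esub> y = x + y"
  "\<zero>\<^bsub>H0_module m n\<^esub> = 0" "c \<odot>\<^bsub>H0_module m n\<^esub> x = scale c x"
  "act (H0_module m n) g x = tact (factor_seq m n) g x"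
  by (simp_all add: H0_module_def)

lemma uq_sl3_module_H0: "uq_sl3_module (H0_module m n)"
  unfolding H0_module_def
proof (rule uq_sl3_module_subspace)
  show "valid (factor_seq m n) x" if "x \<in> H0 m n" for x
    using that by (simp add: H0_def)
qed (simp_all add: H0_zero H0_add H0_scale H0_tact)

lemma simple_H0_module: "simple_uq_module (H0_module m n)"
  unfolding simple_uq_module_def
proof (intro conjI allI impI)
  show "uq_sl3_module (H0_module m n)"
    by (rule uq_sl3_module_H0)
  have "top_vector (m + n) \<noteq> 0"
    by (simp add: top_vector_def poly_mapping_eq_iff fun_eq_iff lookup_single when_def)
  then show "carrier (H0_module m n) \<noteq> {\<zero>\<^bsub>H0_module m n\<^esub>}"
    using H0_top[of m n] by auto
next
  fix N assume "uq_submodule N (H0_module m n)"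
  then interpret N: submodule N kk_ring "H0_module m n"
    by (simp add: uq_submodule_def)
  have N: "N \<subseteq> H0 m n" "\<And>x y. x \<in> N \<Longrightarrow> y \<in> N \<Longrightarrow> x + y \<in> N" "0 \<in> N"
    "\<And>c x. x \<in> N \<Longrightarrow> scale c x \<in> N" "\<And>g x. x \<in> N \<Longrightarrow> tact (factor_seq m n) g x \<in> N"
    using N.subset N.m_closed N.one_closed N.smult_closed \<open>uq_submodule N (H0_module m n)\<close>
    by (simp_all add: uq_submodule_def ring_of_type_algebra_def)
  show "N = {\<zero>\<^bsub>H0_module m n\<^esub>} \<or> N = carrier (H0_module m n)"
  proof (cases "N = {0}")
    case False
    then obtain x where "x \<in> N" "x \<noteq> 0"
      using N(3) by blast
    then have "top_vector (m + n) \<in> N"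
      using top_in_submodule[OF N(1,2,4,5)] by blast
    then have "lowered_top m n a b c \<in> N" for a b c
      by (rule lowered_top_in) (rule N(5))
    then have "spanning m n \<subseteq> N"
      by (auto simp: spanning_def)
    moreover have "free.subspace N"
      by (rule free.subspaceI) (simp_all add: N)
    ultimately have "free.span (spanning m n) \<subseteq> N"
      by (rule free.span_minimal)
    then show ?thesis
      using H0_span N(1) by auto
  qed simp
qed

lemma finsum_H0_module:
  assumes "finite A" "A \<subseteq> H0 m n"
  shows "(\<Oplus>\<^bsub>H0_module m n\<^esub>a\<in>A. c a \<odot>\<^bsub>H0_module m n\<^esub> a) = (\<Sum>a\<in>A. scale (c a) a)"
proof -
  interpret uq_sl3_module "H0_module m n"
    by (rule uq_sl3_module_H0)
  show ?thesis
    using assms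
  proof (induction A rule: finite_induct)
    case (insert x A)
    then show ?case
      by (subst finsum_insert) (auto simp: H0_scale)
  qed simp
qed

lemma finite_dimensional_H0_module: "finite_dimensional (H0_module m n)"
  unfolding finite_dimensional_def
proof (intro exI[of _ "spanning m n"] conjI ballI)
  show sub: "spanning m n \<subseteq> carrier (H0_module m n)"
    by (auto simp: spanning_def lowered_top_H0)
  fix v assume "v \<in> carrier (H0_module m n)"
  then have "v \<in> free.span (spanning m n)"
    by (simp add: H0_span)
  then obtain c where "v = (\<Sum>a\<in>spanning m n. scale (c a) a)"
    unfolding free.span_finite[OF finite_spanning] by blast
  then have "v = (\<Oplus>\<^bsub>H0_module m n\<^esub>a\<in>spanning m n. c a \<odot>\<^bsub>H0_module m n\<^esub> a)"
    using finsum_H0_module[OF finite_spanning] sub by simp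
  then show "\<exists>c. v = (\<Oplus>\<^bsub>H0_module m n\<^esub>a\<in>spanning m n. c a \<odot>\<^bsub>H0_module m n\<^esub> a)"
    by blast
qed (rule finite_spanning)

lemma is_V_H0_module: "is_V m n (H0_module m n)"
  unfolding is_V_def
proof (intro conjI bexI[of _ "top_vector (m + n)"])
  show "act (H0_module m n) (K N1) (top_vector (m + n)) = q ^ m \<odot>\<^bsub>H0_module m n\<^esub> top_vector (m + n)"
    "act (H0_module m n) (K N2) (top_vector (m + n)) = q ^ n \<odot>\<^bsub>H0_module m n\<^esub> top_vector (m + n)"
    using tact_K_top[of "factor_seq m n"]
    by (simp_all add: factor_seq_def sum_list_replicate)
  show "act (H0_module m n) (E N1) (top_vector (m + n)) = \<zero>\<^bsub>H0_module m n\<^esub>"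
    "act (H0_module m n) (E N2) (top_vector (m + n)) = \<zero>\<^bsub>H0_module m n\<^esub>"
    using tact_E_top[of "factor_seq m n"] by simp_all
  show "top_vector (m + n) \<noteq> \<zero>\<^bsub>H0_module m n\<^esub>"
    by (simp add: top_vector_def poly_mapping_eq_iff fun_eq_iff lookup_single when_def)
qed (simp_all add: simple_H0_module finite_dimensional_H0_module H0_top)


section \<open>Uniqueness of simple highest weight modules\<close>

lemma kk_ring_simps [simp]:
  "carrier kk_ring = UNIV" "a \<oplus>\<^bsub>kk_ring\<^esub> b = a + b" "a \<otimes>\<^bsub>kk_ring\<^esub> b = a * b"
  "\<one>\<^bsub>kk_ring\<^esub> = 1" "\<zero>\<^bsub>kk_ring\<^esub> = 0"
  by (simp_all add: ring_of_type_algebra_def)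

context uq_sl3_module
begin

lemma act_zero [simp]: "act M g \<zero> = \<zero>"
proof -
  have "act M g (\<zero> \<oplus> \<zero>) = act M g \<zero> \<oplus> act M g \<zero>"
    by (rule act_add) simp_all
  then show ?thesis
    using M.add.r_cancel_one[of "act M g \<zero>" "act M g \<zero>"] by (simp add: act_closed)
qed

lemma smult_zero_left [simp]: "x \<in> carrier M \<Longrightarrow> 0 \<odot>\<^bsub>M\<^esub> x = \<zero>"
  using smult_l_null[of x] by simp

lemma smult_zero_right [simp]: "c \<odot>\<^bsub>M\<^esub> \<zero> = \<zero>"
  using smult_r_null[of c] by simp

lemma minus_smult: "x \<in> carrier M \<Longrightarrow> \<ominus> x = (-1) \<odot>\<^bsub>M\<^esub> x"
proof -
  assume x: "x \<in> carrier M"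
  have "(-1) \<odot>\<^bsub>M\<^esub> x \<oplus> x = (-1 + 1) \<odot>\<^bsub>M\<^esub> x"
    using x smult_l_distr[of "-1" 1 x] smult_one[of x] by simp
  then show ?thesis
    using x by (simp add: M.minus_equality)
qed

lemma eq_if_minus_zero:
  assumes "x \<in> carrier M" "y \<in> carrier M" "x \<ominus> y = \<zero>"
  shows "x = y"
proof -
  have "x = (x \<ominus> y) \<oplus> y"
    using assms(1,2) by (simp add: M.minus_eq M.a_assoc M.l_neg)
  then show ?thesis
    using assms by simp
qed

lemma smult_closed' [simp]: "x \<in> carrier M \<Longrightarrow> c \<odot>\<^bsub>M\<^esub> x \<in> carrier M"
  by (rule smult_closed) simp_all

lemma smult_smult [simp]: "x \<in> carrier M \<Longrightarrow> c \<odot>\<^bsub>M\<^esub> (d \<odot>\<^bsub>M\<^esub> x) = (c * d) \<odot>\<^bsub>M\<^esub> x"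
  using smult_assoc1[of c d x] by simp

lemma smult_1 [simp]: "x \<in> carrier M \<Longrightarrow> 1 \<odot>\<^bsub>M\<^esub> x = x"
  using smult_one[of x] by simp

lemma smult_add_left: "x \<in> carrier M \<Longrightarrow> (c + d) \<odot>\<^bsub>M\<^esub> x = c \<odot>\<^bsub>M\<^esub> x \<oplus> d \<odot>\<^bsub>M\<^esub> x"
  using smult_l_distr[of c d x] by simp

lemma smult_add_right:
  "x \<in> carrier M \<Longrightarrow> y \<in> carrier M \<Longrightarrow> c \<odot>\<^bsub>M\<^esub> (x \<oplus> y) = c \<odot>\<^bsub>M\<^esub> x \<oplus> c \<odot>\<^bsub>M\<^esub> y"
  using smult_r_distr[of c x y] by simp

lemma smult_eq_zero: "x \<in> carrier M \<Longrightarrow> c \<odot>\<^bsub>M\<^esub> x = \<zero> \<Longrightarrow> c = 0 \<or> x = \<zero>"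
  by (metis left_inverse smult_1 smult_smult smult_zero_right)

lemma K_F: "x \<in> carrier M \<Longrightarrow>
  act M (K i) (act M (F j) x) = (q powi (- cartan i j)) \<odot>\<^bsub>M\<^esub> act M (F j) (act M (K i) x)"
  using K_F_same[of x i] K_F_diff[of x i j] by (cases "i = j") (simp_all add: cartan_def power_int_minus)

lemma Kinv_F: "x \<in> carrier M \<Longrightarrow>
  act M (Kinv i) (act M (F j) x) = (q powi cartan i j) \<odot>\<^bsub>M\<^esub> act M (F j) (act M (Kinv i) x)"
proof -
  assume x: "x \<in> carrier M"
  let ?y = "act M (Kinv i) x" and ?c = "q powi cartan i j"
  have y: "?y \<in> carrier M"
    using x by (rule act_closed)
  have "act M (F j) x = act M (F j) (act M (K i) ?y)"
    using x by (simp add: K_Kinv)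
  also have "\<dots> = ?c \<odot>\<^bsub>M\<^esub> act M (K i) (act M (F j) ?y)"
    using y by (simp add: K_F act_closed power_int_minus)
  finally show ?thesis
    using y by (simp add: act_smult act_closed Kinv_K)
qed

lemma Kinv_eigenvector:
  assumes v: "v \<in> carrier M" "act M (K i) v = q ^ k \<odot>\<^bsub>M\<^esub> v"
  shows "act M (Kinv i) v = inverse (q ^ k) \<odot>\<^bsub>M\<^esub> v"
proof -
  have "v = act M (Kinv i) (act M (K i) v)"
    by (simp only: Kinv_K[OF v(1)])
  then have "v = q ^ k \<odot>\<^bsub>M\<^esub> act M (Kinv i) v"
    unfolding v(2) act_smult[OF v(1)] .
  then have "inverse (q ^ k) \<odot>\<^bsub>M\<^esub> v = inverse (q ^ k) \<odot>\<^bsub>M\<^esub> (q ^ k \<odot>\<^bsub>M\<^esub> act M (Kinv i) v)"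
    by simp
  then show ?thesis
    using v(1) by (simp add: act_closed)
qed

lemma E_F: "x \<in> carrier M \<Longrightarrow> act M (E i) (act M (F i) x) = act M (F i) (act M (E i) x) \<oplus>
  inverse (q - inverse q) \<odot>\<^bsub>M\<^esub> (act M (K i) x \<oplus> (-1) \<odot>\<^bsub>M\<^esub> act M (Kinv i) x)"
proof -
  assume x: "x \<in> carrier M"
  let ?a = "act M (E i) (act M (F i) x)" and ?b = "act M (F i) (act M (E i) x)"
  have cl: "?a \<in> carrier M" "?b \<in> carrier M"
    using x by (simp_all add: act_closed)
  then have "?a \<ominus> ?b \<in> carrier M"
    by simp
  then have "?a \<ominus> ?b = inverse (q - inverse q) \<odot>\<^bsub>M\<^esub> ((q - inverse q) \<odot>\<^bsub>M\<^esub> (?a \<ominus> ?b))"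
    by (simp only: smult_smult left_inverse[OF q_minus_inverse_nonzero] smult_1)
  also have "\<dots> = inverse (q - inverse q) \<odot>\<^bsub>M\<^esub> (act M (K i) x \<oplus> (-1) \<odot>\<^bsub>M\<^esub> act M (Kinv i) x)"
    unfolding E_F_same[OF x] using x by (simp add: M.minus_eq minus_smult act_closed)
  finally have "?b \<oplus> (?a \<ominus> ?b) = ?b \<oplus>
    inverse (q - inverse q) \<odot>\<^bsub>M\<^esub> (act M (K i) x \<oplus> (-1) \<odot>\<^bsub>M\<^esub> act M (Kinv i) x)"
    by simp
  moreover have "?b \<oplus> (?a \<ominus> ?b) = ?a"
    using cl by (simp add: M.minus_eq M.a_lcomm M.r_neg)
  ultimately show ?thesis
    by simp
qed

text \<open>\<open>K\<^sub>1 K\<^sub>2 - q\<^sup>s\<close>, and products of such operators; they separate the weight spaces.\<close>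

definition shift :: "int \<Rightarrow> 'v \<Rightarrow> 'v" where
  "shift s x = act M (K N1) (act M (K N2) x) \<oplus> (- (q powi s)) \<odot>\<^bsub>M\<^esub> x"

definition shifts :: "int list \<Rightarrow> 'v \<Rightarrow> 'v" where
  "shifts = foldr shift"

lemma shifts_simps [simp]: "shifts [] x = x" "shifts (s # ss) x = shift s (shifts ss x)"
  "shifts (ss @ tt) x = shifts ss (shifts tt x)"
  by (simp_all add: shifts_def)

lemma shift_closed: "x \<in> carrier M \<Longrightarrow> shift s x \<in> carrier M"
  by (simp add: shift_def act_closed)

lemma shift_zero [simp]: "shift s \<zero> = \<zero>"
  by (simp add: shift_def)

lemma shift_add: "x \<in> carrier M \<Longrightarrow> y \<in> carrier M \<Longrightarrow> shift s (x \<oplus> y) = shift s x \<oplus> shift s y"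
  by (simp add: shift_def act_closed act_add smult_add_right M.a_ac)

lemma shift_smult: "x \<in> carrier M \<Longrightarrow> shift s (c \<odot>\<^bsub>M\<^esub> x) = c \<odot>\<^bsub>M\<^esub> shift s x"
  by (simp add: shift_def act_closed act_smult smult_add_right mult.commute)

lemma shift_commute: "x \<in> carrier M \<Longrightarrow> shift s (shift t x) = shift t (shift s x)"
  by (simp add: shift_def act_closed act_add act_smult smult_add_right M.a_ac mult.commute)

lemma shifts_closed: "x \<in> carrier M \<Longrightarrow> shifts ss x \<in> carrier M"
  by (induction ss) (simp_all add: shift_closed)

lemma shifts_zero [simp]: "shifts ss \<zero> = \<zero>"
  by (induction ss) simp_all

lemma shifts_add: "x \<in> carrier M \<Longrightarrow> y \<in> carrier M \<Longrightarrow> shifts ss (x \<oplus> y) = shifts ss x \<oplus> shifts ss y"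
  by (induction ss) (simp_all add: shift_add shifts_closed)

lemma shifts_smult: "x \<in> carrier M \<Longrightarrow> shifts ss (c \<odot>\<^bsub>M\<^esub> x) = c \<odot>\<^bsub>M\<^esub> shifts ss x"
  by (induction ss) (simp_all add: shift_smult shifts_closed)

lemma shifts_shift: "x \<in> carrier M \<Longrightarrow> shifts ss (shift s x) = shift s (shifts ss x)"
  by (induction ss) (simp_all add: shift_commute shifts_closed)

lemma shifts_commute: "x \<in> carrier M \<Longrightarrow> shifts ss (shifts tt x) = shifts tt (shifts ss x)"
  by (induction tt) (simp_all add: shifts_shift shifts_closed)

lemma shift_F: "x \<in> carrier M \<Longrightarrow> shift (s - 1) (act M (F i) x) = inverse q \<odot>\<^bsub>M\<^esub> act M (F i) (shift s x)"
proof -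
  assume x: "x \<in> carrier M"
  have c: "q powi (- cartan N1 i) * q powi (- cartan N2 i) = inverse q"
    by (cases i) (simp_all add: cartan_def q_powi_simps)
  then have c': "q powi (- cartan N2 i) * q powi (- cartan N1 i) = inverse q"
    by (simp add: mult.commute)
  have "q powi (s - 1) = inverse q * q powi s"
    by (simp add: power_int_diff divide_inverse mult.commute)
  then show ?thesis
    using x c c' by (simp add: shift_def act_closed act_add act_smult smult_add_right K_F)
qed

lemma shifts_F: "x \<in> carrier M \<Longrightarrow>
  \<exists>c. shifts (map (\<lambda>s. s - 1) ss) (act M (F i) x) = c \<odot>\<^bsub>M\<^esub> act M (F i) (shifts ss x)"
proof (induction ss)
  case Nil
  then show ?case
    by (intro exI[of _ 1]) (simp add: act_closed)
next
  case (Cons s ss)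
  then obtain c where "shifts (map (\<lambda>s. s - 1) ss) (act M (F i) x) = c \<odot>\<^bsub>M\<^esub> act M (F i) (shifts ss x)"
    by blast
  then show ?case
    using Cons.prems
    by (intro exI[of _ "c * inverse q"]) (simp add: shift_smult shift_F act_closed shifts_closed shift_closed)
qed

lemma shifts_eigenvector:
  assumes "v \<in> carrier M" "act M (K N1) (act M (K N2) v) = (q powi t) \<odot>\<^bsub>M\<^esub> v" "\<forall>s\<in>set ss. s < t"
  shows "\<exists>c. c \<noteq> 0 \<and> shifts ss v = c \<odot>\<^bsub>M\<^esub> v"
  using assms(3)
proof (induction ss)
  case Nil
  then show ?case
    using assms(1) by (intro exI[of _ 1]) simp
next
  case (Cons s ss)
  then obtain c where c: "c \<noteq> 0" "shifts ss v = c \<odot>\<^bsub>M\<^esub> v"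
    by auto
  have "shift s v = (q powi t - q powi s) \<odot>\<^bsub>M\<^esub> v"
    using assms(1,2) smult_add_left[of v "q powi t" "- (q powi s)"] by (simp add: shift_def)
  moreover have "q powi t \<noteq> q powi s"
    using Cons.prems by (simp add: q_powi_inj)
  ultimately show ?case
    using c assms(1) by (intro exI[of _ "c * (q powi t - q powi s)"]) (simp add: shift_smult)
qed

lemma uq_submoduleI:
  assumes "H \<subseteq> carrier M" "\<zero> \<in> H" "\<And>x y. x \<in> H \<Longrightarrow> y \<in> H \<Longrightarrow> x \<oplus> y \<in> H"
    "\<And>c x. x \<in> H \<Longrightarrow> c \<odot>\<^bsub>M\<^esub> x \<in> H" "\<And>g x. x \<in> H \<Longrightarrow> act M g x \<in> H"
  shows "uq_submodule H M"
  unfolding uq_submodule_def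
proof (intro conjI allI ballI)
  show "submodule H kk_ring M"
  proof (rule submoduleI)
    fix x assume "x \<in> H"
    then show "\<ominus> x \<in> H"
      using assms(1,4) minus_smult by auto
  qed (use assms in auto)
qed (rule assms(5))

end

text \<open>
  The submodule of \<open>M \<oplus> N\<close> generated by the pair of highest weight vectors \<open>v\<close> and \<open>w\<close>, as a
  relation; it is the graph of an isomorphism if \<open>M\<close> and \<open>N\<close> are simple.
\<close>

inductive orbit :: "'v uq_module \<Rightarrow> 'w uq_module \<Rightarrow> 'v \<Rightarrow> 'w \<Rightarrow> 'v \<Rightarrow> 'w \<Rightarrow> bool"
  for M N v w where
  orbit_start: "orbit M N v w v w"
| orbit_F: "orbit M N v w x y \<Longrightarrow> orbit M N v w (act M (F i) x) (act N (F i) y)"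
| orbit_add: "orbit M N v w x y \<Longrightarrow> orbit M N v w x' y' \<Longrightarrow> orbit M N v w (x \<oplus>\<^bsub>M\<^esub> x') (y \<oplus>\<^bsub>N\<^esub> y')"
| orbit_smult: "orbit M N v w x y \<Longrightarrow> orbit M N v w (c \<odot>\<^bsub>M\<^esub> x) (c \<odot>\<^bsub>N\<^esub> y)"

text \<open>Two modules with highest weight vectors of the same weight.\<close>

locale highest_weight_pair = M: uq_sl3_module M + N: uq_sl3_module N
  for M :: "'v uq_module" and N :: "'w uq_module" +
  fixes v w and wt :: "node \<Rightarrow> nat"
  assumes v: "v \<in> carrier M" "v \<noteq> \<zero>\<^bsub>M\<^esub>" "act M (E i) v = \<zero>\<^bsub>M\<^esub>" "act M (K i) v = q ^ wt i \<odot>\<^bsub>M\<^esub> v"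
    and w: "w \<in> carrier N" "w \<noteq> \<zero>\<^bsub>N\<^esub>" "act N (E i) w = \<zero>\<^bsub>N\<^esub>" "act N (K i) w = q ^ wt i \<odot>\<^bsub>N\<^esub> w"
begin

abbreviation "rel \<equiv> orbit M N v w"

lemma rel_closed: "rel x y \<Longrightarrow> x \<in> carrier M \<and> y \<in> carrier N"
  by (induction rule: orbit.induct) (simp_all add: v w M.act_closed N.act_closed)

lemma rel_zero: "rel \<zero>\<^bsub>M\<^esub> \<zero>\<^bsub>N\<^esub>"
  using orbit_smult[OF orbit_start, of M N v w 0] v w by simp

lemmas Kinv_v = M.Kinv_eigenvector[OF v(1,4)] and Kinv_w = N.Kinv_eigenvector[OF w(1,4)]

lemma rel_K: "rel x y \<Longrightarrow> rel (act M (K i) x) (act N (K i) y)"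
proof (induction rule: orbit.induct)
  case orbit_start
  then show ?case
    unfolding v(4) w(4) by (intro orbit_smult orbit.orbit_start)
next
  case (orbit_F x y j)
  then show ?case
    using rel_closed by (simp add: M.K_F N.K_F orbit_smult orbit.orbit_F)
next
  case (orbit_add x y x' y')
  then show ?case
    using rel_closed by (simp add: M.act_add N.act_add orbit.orbit_add)
next
  case (orbit_smult x y c)
  then show ?case
    using rel_closed by (simp add: M.act_smult N.act_smult orbit.orbit_smult)
qed

lemma rel_Kinv: "rel x y \<Longrightarrow> rel (act M (Kinv i) x) (act N (Kinv i) y)"
proof (induction rule: orbit.induct)
  case orbit_start
  then show ?case
    unfolding Kinv_v Kinv_w by (intro orbit_smult orbit.orbit_start)
next
  case (orbit_F x y j)
  then show ?case
    using rel_closed by (simp add: M.Kinv_F N.Kinv_F orbit_smult orbit.orbit_F)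
next
  case (orbit_add x y x' y')
  then show ?case
    using rel_closed by (simp add: M.act_add N.act_add orbit.orbit_add)
next
  case (orbit_smult x y c)
  then show ?case
    using rel_closed by (simp add: M.act_smult N.act_smult orbit.orbit_smult)
qed

lemma rel_E: "rel x y \<Longrightarrow> rel (act M (E i) x) (act N (E i) y)"
proof (induction rule: orbit.induct)
  case orbit_start
  then show ?case
    unfolding v(3) w(3) by (rule rel_zero)
next
  case (orbit_F x y j)
  note cl = rel_closed[OF orbit_F.hyps]
  show ?case
  proof (cases "i = j")
    case True
    have "rel (act M (F i) (act M (E i) x) \<oplus>\<^bsub>M\<^esub> inverse (q - inverse q) \<odot>\<^bsub>M\<^esub>
        (act M (K i) x \<oplus>\<^bsub>M\<^esub> (-1) \<odot>\<^bsub>M\<^esub> act M (Kinv i) x))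
      (act N (F i) (act N (E i) y) \<oplus>\<^bsub>N\<^esub> inverse (q - inverse q) \<odot>\<^bsub>N\<^esub>
        (act N (K i) y \<oplus>\<^bsub>N\<^esub> (-1) \<odot>\<^bsub>N\<^esub> act N (Kinv i) y))"
      using orbit_F by (intro orbit_add orbit.orbit_F orbit_smult rel_K rel_Kinv)
    then show ?thesis
      using cl True by (simp add: M.E_F N.E_F)
  next
    case False
    then show ?thesis
      using cl orbit_F by (simp add: M.E_F_diff N.E_F_diff orbit.orbit_F)
  qed
next
  case (orbit_add x y x' y')
  then show ?case
    using rel_closed by (simp add: M.act_add N.act_add orbit.orbit_add)
next
  case (orbit_smult x y c)
  then show ?case
    using rel_closed by (simp add: M.act_smult N.act_smult orbit.orbit_smult)
qed

lemma rel_act: "rel x y \<Longrightarrow> rel (act M g x) (act N g y)"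
  by (cases g) (simp_all add: rel_K rel_Kinv rel_E orbit_F)

text \<open>Pairs with components in the sum of the weight spaces below the highest weight.\<close>

definition below :: "'v \<Rightarrow> 'w \<Rightarrow> bool" where
  "below x y \<longleftrightarrow> x \<in> carrier M \<and> y \<in> carrier N \<and>
    (\<exists>ss. (\<forall>s\<in>set ss. s < int (wt N1 + wt N2)) \<and> M.shifts ss x = \<zero>\<^bsub>M\<^esub> \<and> N.shifts ss y = \<zero>\<^bsub>N\<^esub>)"

lemma K_K_v: "act M (K N1) (act M (K N2) v) = (q powi int (wt N1 + wt N2)) \<odot>\<^bsub>M\<^esub> v"
  using v(1) unfolding power_int_of_nat power_add by (simp add: v(4) M.act_smult mult.commute)

lemma K_K_w: "act N (K N1) (act N (K N2) w) = (q powi int (wt N1 + wt N2)) \<odot>\<^bsub>N\<^esub> w"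
  using w(1) unfolding power_int_of_nat power_add by (simp add: w(4) N.act_smult mult.commute)

lemma below_zero: "below \<zero>\<^bsub>M\<^esub> \<zero>\<^bsub>N\<^esub>"
  unfolding below_def by (auto intro: exI[of _ "[]"])

lemma below_smult: "below x y \<Longrightarrow> below (c \<odot>\<^bsub>M\<^esub> x) (c \<odot>\<^bsub>N\<^esub> y)"
  unfolding below_def using M.shifts_smult N.shifts_smult by fastforce

lemma below_add:
  assumes "below x y" "below x' y'"
  shows "below (x \<oplus>\<^bsub>M\<^esub> x') (y \<oplus>\<^bsub>N\<^esub> y')"
proof -
  obtain ss where ss: "\<forall>s\<in>set ss. s < int (wt N1 + wt N2)" "M.shifts ss x = \<zero>\<^bsub>M\<^esub>" "N.shifts ss y = \<zero>\<^bsub>N\<^esub>"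
    using assms(1) unfolding below_def by blast
  obtain tt where tt: "\<forall>s\<in>set tt. s < int (wt N1 + wt N2)" "M.shifts tt x' = \<zero>\<^bsub>M\<^esub>" "N.shifts tt y' = \<zero>\<^bsub>N\<^esub>"
    using assms(2) unfolding below_def by blast
  have cl: "x \<in> carrier M" "y \<in> carrier N" "x' \<in> carrier M" "y' \<in> carrier N"
    using assms by (simp_all add: below_def)
  have "M.shifts (ss @ tt) (x \<oplus>\<^bsub>M\<^esub> x') = \<zero>\<^bsub>M\<^esub>"
    using cl ss(2) tt(2) M.shifts_commute[of x ss tt] by (simp add: M.shifts_add M.shifts_closed)
  moreover have "N.shifts (ss @ tt) (y \<oplus>\<^bsub>N\<^esub> y') = \<zero>\<^bsub>N\<^esub>"
    using cl ss(3) tt(3) N.shifts_commute[of y ss tt] by (simp add: N.shifts_add N.shifts_closed)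
  ultimately show ?thesis
    unfolding below_def using cl ss(1) tt(1) by (intro conjI exI[of _ "ss @ tt"]) auto
qed

lemma below_F:
  assumes "below x y"
  shows "below (act M (F i) x) (act N (F i) y)"
proof -
  obtain ss where ss: "\<forall>s\<in>set ss. s < int (wt N1 + wt N2)" "M.shifts ss x = \<zero>\<^bsub>M\<^esub>" "N.shifts ss y = \<zero>\<^bsub>N\<^esub>"
    using assms unfolding below_def by blast
  have cl: "x \<in> carrier M" "y \<in> carrier N"
    using assms by (simp_all add: below_def)
  have "M.shifts (map (\<lambda>s. s - 1) ss) (act M (F i) x) = \<zero>\<^bsub>M\<^esub>"
    using M.shifts_F[OF cl(1), of ss i] ss(2) by auto
  moreover have "N.shifts (map (\<lambda>s. s - 1) ss) (act N (F i) y) = \<zero>\<^bsub>N\<^esub>"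
    using N.shifts_F[OF cl(2), of ss i] ss(3) by auto
  ultimately show ?thesis
    unfolding below_def using cl ss(1)
    by (intro conjI exI[of _ "map (\<lambda>s. s - 1) ss"]) (auto simp: M.act_closed N.act_closed)
qed

lemma shift_v: "M.shift (int (wt N1 + wt N2)) v = \<zero>\<^bsub>M\<^esub>"
  unfolding M.shift_def K_K_v M.smult_add_left[OF v(1), symmetric] by (simp add: v(1))

lemma shift_w: "N.shift (int (wt N1 + wt N2)) w = \<zero>\<^bsub>N\<^esub>"
  unfolding N.shift_def K_K_w N.smult_add_left[OF w(1), symmetric] by (simp add: w(1))

lemma below_F_start: "below (act M (F i) v) (act N (F i) w)"
proof -
  have "M.shift (int (wt N1 + wt N2) - 1) (act M (F i) v) = \<zero>\<^bsub>M\<^esub>"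
    using shift_v by (simp add: M.shift_F v(1))
  moreover have "N.shift (int (wt N1 + wt N2) - 1) (act N (F i) w) = \<zero>\<^bsub>N\<^esub>"
    using shift_w by (simp add: N.shift_F w(1))
  ultimately show ?thesis
    unfolding below_def using v(1) w(1)
    by (intro conjI exI[of _ "[int (wt N1 + wt N2) - 1]"]) (simp_all add: M.act_closed N.act_closed)
qed

text \<open>
  Applying \<open>F i\<close> to \<open>(v, w)\<close> leads to lower weight spaces, so only the multiple of \<open>(v, w)\<close> itself
  stays at the top.
\<close>

lemma rel_decompose:
  "rel x y \<Longrightarrow> \<exists>c x' y'. below x' y' \<and> x = c \<odot>\<^bsub>M\<^esub> v \<oplus>\<^bsub>M\<^esub> x' \<and> y = c \<odot>\<^bsub>N\<^esub> w \<oplus>\<^bsub>N\<^esub> y'"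
proof (induction rule: orbit.induct)
  case orbit_start
  show ?case
    using below_zero v(1) w(1) by (intro exI[of _ 1] exI[of _ "\<zero>\<^bsub>M\<^esub>"] exI[of _ "\<zero>\<^bsub>N\<^esub>"]) simp
next
  case (orbit_F x y i)
  then obtain c x' y' where *: "below x' y'" "x = c \<odot>\<^bsub>M\<^esub> v \<oplus>\<^bsub>M\<^esub> x'" "y = c \<odot>\<^bsub>N\<^esub> w \<oplus>\<^bsub>N\<^esub> y'"
    by blast
  have cl: "x' \<in> carrier M" "y' \<in> carrier N"
    using *(1) by (simp_all add: below_def)
  have "below (c \<odot>\<^bsub>M\<^esub> act M (F i) v \<oplus>\<^bsub>M\<^esub> act M (F i) x') (c \<odot>\<^bsub>N\<^esub> act N (F i) w \<oplus>\<^bsub>N\<^esub> act N (F i) y')"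
    using *(1) by (intro below_add below_smult below_F below_F_start)
  then show ?case
    using cl v(1) w(1) by (intro exI[of _ 0] exI conjI) (assumption,
      simp_all add: *(2,3) M.act_add N.act_add M.act_smult N.act_smult M.act_closed N.act_closed)
next
  case (orbit_add x1 y1 x2 y2)
  then obtain c x' y' d x'' y'' where
    *: "below x' y'" "x1 = c \<odot>\<^bsub>M\<^esub> v \<oplus>\<^bsub>M\<^esub> x'" "y1 = c \<odot>\<^bsub>N\<^esub> w \<oplus>\<^bsub>N\<^esub> y'"
    "below x'' y''" "x2 = d \<odot>\<^bsub>M\<^esub> v \<oplus>\<^bsub>M\<^esub> x''" "y2 = d \<odot>\<^bsub>N\<^esub> w \<oplus>\<^bsub>N\<^esub> y''"
    by blast
  have cl: "x' \<in> carrier M" "y' \<in> carrier N" "x'' \<in> carrier M" "y'' \<in> carrier N"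
    using *(1,4) by (simp_all add: below_def)
  show ?case
    using below_add[OF *(1,4)] cl v(1) w(1)
    by (intro exI[of _ "c + d"] exI conjI) (assumption,
      simp_all add: *(2,3,5,6) M.smult_add_left N.smult_add_left M.a_ac N.a_ac)
next
  case (orbit_smult x y d)
  then obtain c x' y' where *: "below x' y'" "x = c \<odot>\<^bsub>M\<^esub> v \<oplus>\<^bsub>M\<^esub> x'" "y = c \<odot>\<^bsub>N\<^esub> w \<oplus>\<^bsub>N\<^esub> y'"
    by blast
  have cl: "x' \<in> carrier M" "y' \<in> carrier N"
    using *(1) by (simp_all add: below_def)
  show ?case
    using below_smult[OF *(1), of d] cl v(1) w(1)
    by (intro exI[of _ "d * c"] exI conjI) (assumption,
      simp_all add: *(2,3) M.smult_add_right N.smult_add_right)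
qed

text \<open>Among the pairs \<open>(a v, b w)\<close> only the multiples of \<open>(v, w)\<close> lie in the orbit.\<close>

lemma rel_highest:
  assumes "rel (a \<odot>\<^bsub>M\<^esub> v) (b \<odot>\<^bsub>N\<^esub> w)"
  shows "a = b"
proof -
  obtain c x y where xy: "below x y" and M: "a \<odot>\<^bsub>M\<^esub> v = c \<odot>\<^bsub>M\<^esub> v \<oplus>\<^bsub>M\<^esub> x" and N: "b \<odot>\<^bsub>N\<^esub> w = c \<odot>\<^bsub>N\<^esub> w \<oplus>\<^bsub>N\<^esub> y"
    using rel_decompose[OF assms] by blast
  obtain ss where ss: "\<forall>s\<in>set ss. s < int (wt N1 + wt N2)" "M.shifts ss x = \<zero>\<^bsub>M\<^esub>" "N.shifts ss y = \<zero>\<^bsub>N\<^esub>"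
    using xy unfolding below_def by blast
  have cl: "x \<in> carrier M" "y \<in> carrier N"
    using xy by (simp_all add: below_def)
  obtain k where k: "k \<noteq> 0" "M.shifts ss v = k \<odot>\<^bsub>M\<^esub> v"
    using M.shifts_eigenvector[OF v(1) K_K_v ss(1)] by blast
  obtain l where l: "l \<noteq> 0" "N.shifts ss w = l \<odot>\<^bsub>N\<^esub> w"
    using N.shifts_eigenvector[OF w(1) K_K_w ss(1)] by blast
  have "M.shifts ss (a \<odot>\<^bsub>M\<^esub> v) = M.shifts ss (c \<odot>\<^bsub>M\<^esub> v \<oplus>\<^bsub>M\<^esub> x)"
    by (simp only: M)
  then have "(a * k) \<odot>\<^bsub>M\<^esub> v = (c * k) \<odot>\<^bsub>M\<^esub> v"
    using v(1) cl(1) ss(2) k(2) by (simp add: M.shifts_add M.shifts_smult)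
  then have "(a * k + - (c * k)) \<odot>\<^bsub>M\<^esub> v = (c * k + - (c * k)) \<odot>\<^bsub>M\<^esub> v"
    by (simp only: M.smult_add_left[OF v(1)])
  then have "a = c"
    using v(1,2) k(1) M.smult_eq_zero[OF v(1)] by fastforce
  have "N.shifts ss (b \<odot>\<^bsub>N\<^esub> w) = N.shifts ss (c \<odot>\<^bsub>N\<^esub> w \<oplus>\<^bsub>N\<^esub> y)"
    by (simp only: N)
  then have "(b * l) \<odot>\<^bsub>N\<^esub> w = (c * l) \<odot>\<^bsub>N\<^esub> w"
    using w(1) cl(2) ss(3) l(2) by (simp add: N.shifts_add N.shifts_smult)
  then have "(b * l + - (c * l)) \<odot>\<^bsub>N\<^esub> w = (c * l + - (c * l)) \<odot>\<^bsub>N\<^esub> w"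
    by (simp only: N.smult_add_left[OF w(1)])
  then have "b = c"
    using w(1,2) l(1) N.smult_eq_zero[OF w(1)] by fastforce
  with \<open>a = c\<close> show ?thesis
    by simp
qed

end

lemma uq_isomorphic_is_V:
  assumes "is_V m n M" "is_V m n N"
  shows "uq_isomorphic M N"
proof -
  have "simple_uq_module M" "simple_uq_module N"
    using assms by (simp_all add: is_V_def)
  then have M: "uq_sl3_module M" "\<And>H. uq_submodule H M \<Longrightarrow> H = {\<zero>\<^bsub>M\<^esub>} \<or> H = carrier M"
    and N: "uq_sl3_module N" "\<And>H. uq_submodule H N \<Longrightarrow> H = {\<zero>\<^bsub>N\<^esub>} \<or> H = carrier N"
    by (simp_all add: simple_uq_module_def)
  define wt where "wt = (\<lambda>i. case i of N1 \<Rightarrow> m | N2 \<Rightarrow> n)"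
  obtain v where v: "v \<in> carrier M" "v \<noteq> \<zero>\<^bsub>M\<^esub>" "act M (E N1) v = \<zero>\<^bsub>M\<^esub>" "act M (E N2) v = \<zero>\<^bsub>M\<^esub>"
    "act M (K N1) v = q ^ m \<odot>\<^bsub>M\<^esub> v" "act M (K N2) v = q ^ n \<odot>\<^bsub>M\<^esub> v"
    using assms(1) unfolding is_V_def by blast
  obtain w where w: "w \<in> carrier N" "w \<noteq> \<zero>\<^bsub>N\<^esub>" "act N (E N1) w = \<zero>\<^bsub>N\<^esub>" "act N (E N2) w = \<zero>\<^bsub>N\<^esub>"
    "act N (K N1) w = q ^ m \<odot>\<^bsub>N\<^esub> w" "act N (K N2) w = q ^ n \<odot>\<^bsub>N\<^esub> w"
    using assms(2) unfolding is_V_def by blast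
  have E: "act M (E i) v = \<zero>\<^bsub>M\<^esub>" "act N (E i) w = \<zero>\<^bsub>N\<^esub>" for i
    using v w by (cases i; simp)+
  have K: "act M (K i) v = q ^ wt i \<odot>\<^bsub>M\<^esub> v" "act N (K i) w = q ^ wt i \<odot>\<^bsub>N\<^esub> w" for i
    using v w by (cases i; simp add: wt_def)+
  interpret highest_weight_pair M N v w wt
    unfolding highest_weight_pair_def highest_weight_pair_axioms_def using M N v w E K by blast
  \<comment> \<open>The kernels of both projections of the relation are proper submodules, and its domain and range
    are non-zero submodules.\<close>
  have "uq_submodule {x. rel x \<zero>\<^bsub>N\<^esub>} M"
  proof (rule M.uq_submoduleI)
    fix x y assume "x \<in> {x. rel x \<zero>\<^bsub>N\<^esub>}" "y \<in> {x. rel x \<zero>\<^bsub>N\<^esub>}"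
    then show "x \<oplus>\<^bsub>M\<^esub> y \<in> {x. rel x \<zero>\<^bsub>N\<^esub>}"
      using orbit_add[of M N v w x "\<zero>\<^bsub>N\<^esub>" y "\<zero>\<^bsub>N\<^esub>"] by simp
  next
    fix c x assume "x \<in> {x. rel x \<zero>\<^bsub>N\<^esub>}"
    then show "c \<odot>\<^bsub>M\<^esub> x \<in> {x. rel x \<zero>\<^bsub>N\<^esub>}"
      using orbit_smult[of M N v w x "\<zero>\<^bsub>N\<^esub>" c] by simp
  next
    fix g x assume "x \<in> {x. rel x \<zero>\<^bsub>N\<^esub>}"
    then show "act M g x \<in> {x. rel x \<zero>\<^bsub>N\<^esub>}"
      using rel_act[of x "\<zero>\<^bsub>N\<^esub>" g] by simp
  qed (use rel_closed rel_zero in auto)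
  moreover have "\<not> rel v \<zero>\<^bsub>N\<^esub>"
    using rel_highest[of 1 0] v(1) w(1) by auto
  ultimately have ker1: "rel x \<zero>\<^bsub>N\<^esub> \<Longrightarrow> x = \<zero>\<^bsub>M\<^esub>" for x
    using M(2) v(1) by blast
  have "uq_submodule {y. rel \<zero>\<^bsub>M\<^esub> y} N"
  proof (rule N.uq_submoduleI)
    fix x y assume "x \<in> {y. rel \<zero>\<^bsub>M\<^esub> y}" "y \<in> {y. rel \<zero>\<^bsub>M\<^esub> y}"
    then show "x \<oplus>\<^bsub>N\<^esub> y \<in> {y. rel \<zero>\<^bsub>M\<^esub> y}"
      using orbit_add[of M N v w "\<zero>\<^bsub>M\<^esub>" x "\<zero>\<^bsub>M\<^esub>" y] by simp
  next
    fix c x assume "x \<in> {y. rel \<zero>\<^bsub>M\<^esub> y}"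
    then show "c \<odot>\<^bsub>N\<^esub> x \<in> {y. rel \<zero>\<^bsub>M\<^esub> y}"
      using orbit_smult[of M N v w "\<zero>\<^bsub>M\<^esub>" x c] by simp
  next
    fix g x assume "x \<in> {y. rel \<zero>\<^bsub>M\<^esub> y}"
    then show "act N g x \<in> {y. rel \<zero>\<^bsub>M\<^esub> y}"
      using rel_act[of "\<zero>\<^bsub>M\<^esub>" x g] by simp
  qed (use rel_closed rel_zero in auto)
  moreover have "\<not> rel \<zero>\<^bsub>M\<^esub> w"
    using rel_highest[of 0 1] v(1) w(1) by auto
  ultimately have ker2: "rel \<zero>\<^bsub>M\<^esub> y \<Longrightarrow> y = \<zero>\<^bsub>N\<^esub>" for y
    using N(2) w(1) by blast
  have "uq_submodule {x. \<exists>y. rel x y} M"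
    by (rule M.uq_submoduleI)
      (use rel_closed rel_zero in \<open>auto intro: orbit_add orbit_smult rel_act\<close>)
  then have dom: "x \<in> carrier M \<Longrightarrow> \<exists>y. rel x y" for x
    using M(2) v(2) orbit_start[of M N v w] by blast
  have "uq_submodule {y. \<exists>x. rel x y} N"
    by (rule N.uq_submoduleI)
      (use rel_closed rel_zero in \<open>auto intro: orbit_add orbit_smult rel_act\<close>)
  then have ran: "y \<in> carrier N \<Longrightarrow> \<exists>x. rel x y" for y
    using N(2) w(2) orbit_start[of M N v w] by blast
  have uniq: "y = y'" if "rel x y" "rel x y'" for x y y'
  proof -
    have cl: "x \<in> carrier M" "y \<in> carrier N" "y' \<in> carrier N"
      using that rel_closed by auto
    have "rel (x \<oplus>\<^bsub>M\<^esub> (-1) \<odot>\<^bsub>M\<^esub> x) (y \<oplus>\<^bsub>N\<^esub> (-1) \<odot>\<^bsub>N\<^esub> y')"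
      using that by (intro orbit_add orbit_smult)
    then have "y \<ominus>\<^bsub>N\<^esub> y' = \<zero>\<^bsub>N\<^esub>"
      using cl ker2 by (simp add: M.M.r_neg N.M.minus_eq flip: M.minus_smult N.minus_smult)
    then show ?thesis
      using cl by (simp add: N.eq_if_minus_zero)
  qed
  have inj: "x = x'" if "rel x y" "rel x' y" for x x' y
  proof -
    have cl: "x \<in> carrier M" "x' \<in> carrier M" "y \<in> carrier N"
      using that rel_closed by auto
    have "rel (x \<oplus>\<^bsub>M\<^esub> (-1) \<odot>\<^bsub>M\<^esub> x') (y \<oplus>\<^bsub>N\<^esub> (-1) \<odot>\<^bsub>N\<^esub> y)"
      using that by (intro orbit_add orbit_smult)
    then have "x \<ominus>\<^bsub>M\<^esub> x' = \<zero>\<^bsub>M\<^esub>"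
      using cl ker1 by (simp add: N.M.r_neg M.M.minus_eq flip: M.minus_smult N.minus_smult)
    then show ?thesis
      using cl by (simp add: M.eq_if_minus_zero)
  qed
  define f where "f x = (THE y. rel x y)" for x
  have f: "f x = y" if "rel x y" for x y
    unfolding f_def using that uniq by (intro the_equality) blast+
  have rel_f: "rel x (f x)" if "x \<in> carrier M" for x
    using dom[OF that] f by auto
  have "f \<in> uq_hom M N"
    unfolding uq_hom_def
    using rel_f rel_closed orbit_add[of M N v w] orbit_smult[of M N v w] rel_act
    by (auto intro!: f)
  moreover have "bij_betw f (carrier M) (carrier N)"
  proof (rule bij_betwI')
    show "f x = f y \<longleftrightarrow> x = y" if "x \<in> carrier M" "y \<in> carrier M" for x y
      using inj rel_f[OF that(1)] rel_f[OF that(2)] by auto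
    show "f x \<in> carrier N" if "x \<in> carrier M" for x
      using rel_f[OF that] rel_closed by blast
    show "\<exists>x\<in>carrier M. y = f x" if "y \<in> carrier N" for y
      using ran[OF that] f rel_closed by blast
  qed
  ultimately show ?thesis
    unfolding uq_isomorphic_def by blast
qed


section \<open>Exactness by a matching\<close>

text \<open>
  A form of algebraic discrete Morse theory.  The basis elements in \<open>X1\<close> are filtered by \<open>wd\<close>;
  up to terms that are lower in the filtration, the matrix \<open>D\<close> matches each element of \<open>X1\<close> with
  an element of \<open>X0\<close> (if it satisfies \<open>U\<close>) or of \<open>X2\<close> (otherwise).  Given a cocycle, a
  coboundary is subtracted that agrees with it on the elements of the highest level \<open>x\<close> that satisfy
  \<open>U\<close>; by the cocycle condition the other coefficients of this level then vanish as well.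
\<close>

lemma exact_if_matching:
  fixes D :: "'b \<Rightarrow> 'b \<Rightarrow> 'k::field" and wd :: "'b \<Rightarrow> 'c::linorder"
  assumes fin: "finite X0" "finite X1" "finite X2"
    and DD: "\<And>a c. a \<in> X0 \<Longrightarrow> c \<in> X2 \<Longrightarrow> (\<Sum>b\<in>X1. D a b * D b c) = 0"
    and ord0: "\<And>a b. a \<in> X0 \<Longrightarrow> b \<in> X1 \<Longrightarrow> D a b \<noteq> 0 \<Longrightarrow> wd b \<le> wd a"
    and ord1: "\<And>b c. b \<in> X1 \<Longrightarrow> c \<in> X2 \<Longrightarrow> D b c \<noteq> 0 \<Longrightarrow> wd c \<le> wd b"
    and down: "\<And>u. u \<in> X1 \<Longrightarrow> U u \<Longrightarrow> \<exists>l\<in>X0. wd l = wd u \<and> D l u \<noteq> 0 \<and>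
      (\<forall>u'\<in>X1. U u' \<and> wd u' = wd u \<and> D l u' \<noteq> 0 \<longrightarrow> u' = u)"
    and up: "\<And>l. l \<in> X1 \<Longrightarrow> \<not> U l \<Longrightarrow> \<exists>u\<in>X2. wd u = wd l \<and> D l u \<noteq> 0 \<and>
      (\<forall>l'\<in>X1. \<not> U l' \<and> wd l' = wd l \<and> D l' u \<noteq> 0 \<longrightarrow> l' = l)"
  shows "(\<forall>c\<in>X2. (\<Sum>b\<in>X1. z b * D b c) = 0) \<Longrightarrow> \<exists>y. \<forall>b\<in>X1. z b = (\<Sum>a\<in>X0. y a * D a b)"
proof (induction "card {b \<in> X1. \<exists>b'\<in>X1. z b' \<noteq> 0 \<and> wd b \<le> wd b'}" arbitrary: z rule: less_induct)
  case less
  show ?case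
  proof (cases "\<forall>b\<in>X1. z b = 0")
    case True
    then show ?thesis
      by (intro exI[of _ "\<lambda>_. 0"]) simp
  next
    case False
    define S where "S = {b \<in> X1. z b \<noteq> 0}"
    have S: "finite (wd ` S)" "wd ` S \<noteq> {}"
      using False fin(2) by (auto simp: S_def)
    define x where "x = Max (wd ` S)"
    have "x \<in> wd ` S"
      unfolding x_def using S by (rule Max_in)
    then obtain t where t: "t \<in> X1" "z t \<noteq> 0" "wd t = x"
      by (auto simp: S_def)
    have max: "wd b \<le> x" if "b \<in> X1" "z b \<noteq> 0" for b
      unfolding x_def using that S(1) by (intro Max_ge) (auto simp: S_def)
    define Ux where "Ux = {u \<in> X1. U u \<and> wd u = x}"
    have finU: "finite Ux"
      using fin(2) by (simp add: Ux_def)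
    have "\<forall>u\<in>Ux. \<exists>l. l \<in> X0 \<and> wd l = wd u \<and> D l u \<noteq> 0 \<and>
      (\<forall>u'\<in>X1. U u' \<and> wd u' = wd u \<and> D l u' \<noteq> 0 \<longrightarrow> u' = u)"
      using down by (auto simp: Ux_def)
    then obtain \<mu> where \<mu>: "\<And>u. u \<in> Ux \<Longrightarrow> \<mu> u \<in> X0 \<and> wd (\<mu> u) = wd u \<and> D (\<mu> u) u \<noteq> 0 \<and>
      (\<forall>u'\<in>X1. U u' \<and> wd u' = wd u \<and> D (\<mu> u) u' \<noteq> 0 \<longrightarrow> u' = u)"
      by metis
    define y where "y a = (\<Sum>u\<in>Ux. if \<mu> u = a then z u / D (\<mu> u) u else 0)" for a
    have dy: "(\<Sum>a\<in>X0. y a * D a b) = (\<Sum>u\<in>Ux. z u / D (\<mu> u) u * D (\<mu> u) b)" for b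
    proof -
      have "(\<Sum>a\<in>X0. y a * D a b) = (\<Sum>a\<in>X0. \<Sum>u\<in>Ux. if \<mu> u = a then z u / D (\<mu> u) u * D (\<mu> u) b else 0)"
        unfolding y_def sum_distrib_right by (intro sum.cong) auto
      also have "\<dots> = (\<Sum>u\<in>Ux. \<Sum>a\<in>X0. if \<mu> u = a then z u / D (\<mu> u) u * D (\<mu> u) b else 0)"
        by (rule sum.swap)
      also have "\<dots> = (\<Sum>u\<in>Ux. z u / D (\<mu> u) u * D (\<mu> u) b)"
        by (intro sum.cong) (use \<mu> fin(1) in auto)
      finally show ?thesis .
    qed
    define z' where "z' b = z b - (\<Sum>a\<in>X0. y a * D a b)" for b
    have z'_U: "z' b = 0" if "b \<in> Ux" for b
    proof -
      have "(\<Sum>u\<in>Ux. z u / D (\<mu> u) u * D (\<mu> u) b) = (\<Sum>u\<in>Ux. if u = b then z b else 0)"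
      proof (rule sum.cong)
        fix u assume u: "u \<in> Ux"
        show "z u / D (\<mu> u) u * D (\<mu> u) b = (if u = b then z b else 0)"
        proof (cases "u = b")
          case False
          have "b \<in> X1" "U b" "wd b = wd u"
            using that u by (auto simp: Ux_def)
          then have "D (\<mu> u) b = 0"
            using \<mu>[OF u] False by blast
          then show ?thesis
            using False by simp
        qed (use \<mu>[OF u] in auto)
      qed simp
      then show ?thesis
        unfolding z'_def dy using that finU by simp
    qed
    have z'_le: "wd b \<le> x" if "b \<in> X1" "z' b \<noteq> 0" for b
    proof (rule ccontr)
      assume "\<not> wd b \<le> x"
      then have "z b = 0"
        using max that(1) by blast
      moreover have "D (\<mu> u) b = 0" if "u \<in> Ux" for u
      proof (rule ccontr)
        assume "D (\<mu> u) b \<noteq> 0"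
        then have "wd b \<le> wd (\<mu> u)"
          using ord0 \<mu>[OF that] \<open>b \<in> X1\<close> by blast
        then show False
          using \<open>\<not> wd b \<le> x\<close> \<mu>[OF that] that by (simp add: Ux_def)
      qed
      ultimately show False
        using that(2) unfolding z'_def dy by simp
    qed
    have cocycle: "(\<Sum>b\<in>X1. z' b * D b c) = 0" if "c \<in> X2" for c
    proof -
      have "(\<Sum>b\<in>X1. (\<Sum>a\<in>X0. y a * D a b) * D b c) = (\<Sum>a\<in>X0. y a * (\<Sum>b\<in>X1. D a b * D b c))"
        unfolding sum_distrib_right sum_distrib_left by (subst sum.swap) (simp add: mult.assoc)
      also have "\<dots> = 0"
        using DD that by simp
      finally show ?thesis
        using less.prems that unfolding z'_def left_diff_distrib sum_subtractf by simp
    qed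
    have z'_lt: "wd b < x" if "b \<in> X1" "z' b \<noteq> 0" for b
    proof (rule ccontr)
      assume "\<not> wd b < x"
      then have b: "wd b = x"
        using z'_le[OF that] by simp
      then have "\<not> U b"
        using z'_U[of b] that by (auto simp: Ux_def)
      with up[OF that(1)] obtain c where c: "c \<in> X2" "wd c = wd b" "D b c \<noteq> 0"
        "\<And>l'. l' \<in> X1 \<Longrightarrow> \<not> U l' \<Longrightarrow> wd l' = wd b \<Longrightarrow> D l' c \<noteq> 0 \<Longrightarrow> l' = b"
        by blast
      have "z' b' * D b' c = (if b' = b then z' b * D b c else 0)" if b': "b' \<in> X1" for b'
      proof (cases "b' = b \<or> z' b' = 0 \<or> D b' c = 0")
        case False
        then have "wd b' \<le> x" "x \<le> wd b'"
          using z'_le[OF b'] ord1[OF b' c(1)] b c(2) by auto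
        then have "wd b' = wd b"
          using b by simp
        moreover have "\<not> U b'"
          using False z'_U[of b'] b' \<open>wd b' = wd b\<close> b by (auto simp: Ux_def)
        ultimately show ?thesis
          using c(4)[OF b'] False by blast
      qed auto
      then have "(\<Sum>b'\<in>X1. z' b' * D b' c) = (\<Sum>b'\<in>X1. if b' = b then z' b * D b c else 0)"
        by (intro sum.cong) auto
      then have "z' b * D b c = 0"
        using cocycle[OF c(1)] that(1) fin(2) by simp
      then show False
        using that(2) c(3) by simp
    qed
    have "\<exists>y. \<forall>b\<in>X1. z' b = (\<Sum>a\<in>X0. y a * D a b)"
    proof (rule less.hyps)
      show "card {b \<in> X1. \<exists>b'\<in>X1. z' b' \<noteq> 0 \<and> wd b \<le> wd b'} < card {b \<in> X1. \<exists>b'\<in>X1. z b' \<noteq> 0 \<and> wd b \<le> wd b'}"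
      proof (rule psubset_card_mono)
        have "t \<in> {b \<in> X1. \<exists>b'\<in>X1. z b' \<noteq> 0 \<and> wd b \<le> wd b'}"
          using t by blast
        moreover have "t \<notin> {b \<in> X1. \<exists>b'\<in>X1. z' b' \<noteq> 0 \<and> wd b \<le> wd b'}"
          using z'_lt t(3) by fastforce
        moreover have "{b \<in> X1. \<exists>b'\<in>X1. z' b' \<noteq> 0 \<and> wd b \<le> wd b'} \<subseteq> {b \<in> X1. \<exists>b'\<in>X1. z b' \<noteq> 0 \<and> wd b \<le> wd b'}"
          using z'_le t by (blast intro: order.trans)
        ultimately show "{b \<in> X1. \<exists>b'\<in>X1. z' b' \<noteq> 0 \<and> wd b \<le> wd b'} \<subset> {b \<in> X1. \<exists>b'\<in>X1. z b' \<noteq> 0 \<and> wd b \<le> wd b'}"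
          by blast
      qed (use fin(2) in simp)
    qed (use cocycle in blast)
    then obtain y' where "\<forall>b\<in>X1. z' b = (\<Sum>a\<in>X0. y' a * D a b)"
      by blast
    then have "\<forall>b\<in>X1. z b = (\<Sum>a\<in>X0. (y a + y' a) * D a b)"
      by (simp add: z'_def distrib_right sum.distrib algebra_simps)
    then show ?thesis
      by (intro exI[of _ "\<lambda>a. y a + y' a"])
  qed
qed


section \<open>Labelled partitions\<close>

text \<open>The blocks that occur in a compatible partition.\<close>

definition block :: "sign list \<Rightarrow> bool" where
  "block B \<longleftrightarrow> B \<in> {[Pos], [Neg], [Pos, Pos], [Neg, Neg], [Pos, Neg], [Pos, Pos, Pos], [Neg, Neg, Neg]}"

text \<open>
  The label of a block stands for one basis vector, written as a word with one letter per dot: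
  the word of the leading term of this vector as a product of basis vectors of \<open>V\<^sub>+\<close> and \<open>V\<^sub>-\<close>.
\<close>

definition expand :: "sign list \<Rightarrow> int \<Rightarrow> int list" where
  "expand B c = (if length B = 1 then [c]
     else if length B = 2 then (if c = -1 then [-1, 0] else if c = 0 then [-1, 1] else [0, 1])
     else [-1, 0, 1])"

text \<open>Neighbouring letters that may be joined without change of the word.\<close>

fun good :: "sign \<times> int \<Rightarrow> sign \<times> int \<Rightarrow> bool" where
  "good (s, a) (t, b) \<longleftrightarrow> (s = t \<and> a < b) \<or> (s = Pos \<and> t = Neg \<and> a = -1 \<and> b = 1)"

text \<open>
  The edge maps send the product of the basis vectors with labels \<open>a\<close> and \<open>b\<close> to this multiple of
  the basis vector with label \<open>a + b\<close>.
\<close>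

definition merge_coeff :: "sign list \<Rightarrow> sign list \<Rightarrow> int \<Rightarrow> int \<Rightarrow> kk" where
  "merge_coeff A B a b =
    (if length A = 1 \<and> length B = 1 \<and> A = B then
       (if a < b then inverse q_half else if b < a then - q_half else 0)
     else if (a, b) = (-1, 1) then - inverse q
     else if (a, b) = (0, 0) then 1
     else if (a, b) = (1, -1) then - q
     else 0)"

lemma block_append_cases:
  assumes "block A" "block B" "block (A @ B)"
  shows "(A, B) \<in> {([Pos], [Pos]), ([Neg], [Neg]), ([Pos], [Neg]), ([Pos, Pos], [Pos]), ([Pos], [Pos, Pos]),
    ([Neg, Neg], [Neg]), ([Neg], [Neg, Neg])}"
  using assms unfolding block_def by (elim insertE; simp)

lemma merge_map_eq:
  assumes "block A" "block B" "block (A @ B)" "a \<in> labels (block_factor A)" "b \<in> labels (block_factor B)"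
  shows "merge_map A B a b = scale (merge_coeff A B a b) (basis_vec (a + b))"
  using block_append_cases[OF assms(1-3)] assms(4,5)
  by (elim insertE; simp add: block_factor_def)
    (elim disjE; simp add: merge_map_def h_map_def d_map_def merge_coeff_def single_uminus del: single_one)+

lemma merge_label:
  assumes "block A" "block B" "block (A @ B)" "a \<in> labels (block_factor A)" "b \<in> labels (block_factor B)"
    "merge_coeff A B a b \<noteq> 0"
  shows "a + b \<in> labels (block_factor (A @ B))"
  using block_append_cases[OF assms(1-3)] assms(4-6)
  by (elim insertE; simp add: block_factor_def)
    (elim disjE; simp add: merge_coeff_def)+

lemma merge_expand_le:
  assumes "block A" "block B" "block (A @ B)" "a \<in> labels (block_factor A)" "b \<in> labels (block_factor B)"
    "merge_coeff A B a b \<noteq> 0"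
  shows "expand (A @ B) (a + b) \<le> expand A a @ expand B b"
  using block_append_cases[OF assms(1-3)] assms(4-6)
  by (elim insertE; simp add: block_factor_def)
    (elim disjE; simp add: merge_coeff_def expand_def)+

lemma q_half_inverse_q:
  "q_half * inverse q = inverse q_half" "inverse q * q_half = inverse q_half"
  "q * inverse q_half = q_half" "inverse q_half * q = q_half"
  by (simp_all add: field_simps flip: q_half_square)

text \<open>The squares of neighbouring edges commute.\<close>

lemma merge_coeff_assoc:
  assumes "block A" "block B" "block D" "block (A @ B @ D)"
    "a \<in> labels (block_factor A)" "b \<in> labels (block_factor B)" "c \<in> labels (block_factor D)"
  shows "block (A @ B)" "block (B @ D)"
    "merge_coeff B D b c * merge_coeff A (B @ D) a (b + c) = merge_coeff A B a b * merge_coeff (A @ B) D (a + b) c"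
proof -
  have *: "(A, B, D) \<in> {([Pos], [Pos], [Pos]), ([Neg], [Neg], [Neg])}"
  proof -
    have len: "1 \<le> length B' \<and> length B' \<le> 3" if "block B'" for B'
      using that by (auto simp: block_def)
    have "length A = 1" "length B = 1" "length D = 1"
      using len[OF assms(1)] len[OF assms(2)] len[OF assms(3)] len[OF assms(4)] by simp_all
    then obtain x y z where "A = [x]" "B = [y]" "D = [z]"
      by (auto simp: length_Suc_conv)
    then show ?thesis
      using assms(4) by (cases x; cases y; cases z) (auto simp: block_def)
  qed
  then show "block (A @ B)" "block (B @ D)"
    by (auto simp: block_def)
  show "merge_coeff B D b c * merge_coeff A (B @ D) a (b + c) = merge_coeff A B a b * merge_coeff (A @ B) D (a + b) c"
  proof -
    have abc: "a \<in> {-1, 0, 1}" "b \<in> {-1, 0, 1}" "c \<in> {-1, 0, 1}"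
      using * assms(5-7) by (auto simp: block_factor_def)
    have "merge_coeff [s] [s] b c * merge_coeff [s] [s, s] a (b + c) =
      merge_coeff [s] [s] a b * merge_coeff [s, s] [s] (a + b) c" for s
      using abc by (elim insertE emptyE) (simp_all add: merge_coeff_def q_half_inverse_q)
    then show ?thesis
      using * by auto
  qed
qed

lemma length_expand: "block B \<Longrightarrow> length (expand B c) = length B"
  by (auto simp: block_def expand_def)

lemma block_nonempty: "block B \<Longrightarrow> B \<noteq> []"
  by (auto simp: block_def)

text \<open>A good pair of a single dot and a block can be joined.\<close>

lemma join_good:
  assumes "block B" "a \<in> labels (block_factor [s])" "b \<in> labels (block_factor B)"
    "good (s, a) (hd B, hd (expand B b))"
  shows "block (s # B)" "merge_coeff [s] B a b \<noteq> 0" "expand (s # B) (a + b) = a # expand B b"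
proof -
  have a: "a \<in> {-1, 0, 1}"
    using assms(2) by (cases s) (simp_all add: block_factor_def)
  have "block (s # B) \<and> merge_coeff [s] B a b \<noteq> 0 \<and> expand (s # B) (a + b) = a # expand B b"
    using assms(1)[unfolded block_def] assms(3,4) a
    by (elim insertE[of B] emptyE; cases s)
      (auto simp: block_def block_factor_def expand_def merge_coeff_def)
  then show "block (s # B)" "merge_coeff [s] B a b \<noteq> 0" "expand (s # B) (a + b) = a # expand B b"
    by blast+
qed

text \<open>Conversely the first dot of a longer block can be split off.\<close>

lemma split_block:
  assumes "block B" "1 < length B" "c \<in> labels (block_factor B)"
  obtains s D a b where "B = s # D" "block [s]" "block D" "a \<in> labels (block_factor [s])"
    "b \<in> labels (block_factor D)" "a + b = c" "merge_coeff [s] D a b \<noteq> 0" "expand B c = a # expand D b"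
proof -
  define a where "a = hd (expand B c)"
  have "block [hd B]" "block (tl B)" "a \<in> labels (block_factor [hd B])"
    "c - a \<in> labels (block_factor (tl B))" "merge_coeff [hd B] (tl B) a (c - a) \<noteq> 0"
    "expand B c = a # expand (tl B) (c - a)"
    using assms(1)[unfolded block_def] assms(2,3) unfolding a_def
    by (elim insertE[of B] emptyE; auto simp: block_def block_factor_def expand_def merge_coeff_def)+
  moreover have "B = hd B # tl B" "a + (c - a) = c"
    using assms(2) by (cases B; simp)+
  ultimately show ?thesis
    using that by blast
qed

lemma good_in_block:
  assumes "block B" "1 < length B" "c \<in> labels (block_factor B)"
  shows "\<exists>\<alpha> \<beta> r. zip B (expand B c) = \<alpha> # \<beta> # r \<and> good \<alpha> \<beta>"
  using assms(1)[unfolded block_def] assms(2,3)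
  by (elim insertE[of B] emptyE) (auto simp: expand_def block_factor_def)


text \<open>A basis element of the complex is a partition together with a label for each of its blocks.\<close>

type_synonym labelled = "(sign list \<times> int) list"

abbreviation ok_block :: "sign list \<times> int \<Rightarrow> bool" where
  "ok_block T \<equiv> block (fst T) \<and> snd T \<in> labels (block_factor (fst T))"

definition ok :: "nat \<Rightarrow> nat \<Rightarrow> labelled \<Rightarrow> bool" where
  "ok m n L \<longleftrightarrow> concat (map fst L) = dots m n \<and> (\<forall>T\<in>set L. ok_block T)"

text \<open>The word of a basis element, without and with the colours of the dots.\<close>

definition letters :: "labelled \<Rightarrow> int list" where
  "letters L = concat (map (\<lambda>T. expand (fst T) (snd T)) L)"

definition flat :: "labelled \<Rightarrow> (sign \<times> int) list" where
  "flat L = concat (map (\<lambda>T. zip (fst T) (expand (fst T) (snd T))) L)"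

lemma flat_simps [simp]: "flat [] = []" "flat (T # L) = zip (fst T) (expand (fst T) (snd T)) @ flat L"
  "flat (L @ L') = flat L @ flat L'"
  by (simp_all add: flat_def)

lemma letters_simps [simp]: "letters [] = []" "letters (T # L) = expand (fst T) (snd T) @ letters L"
  "letters (L @ L') = letters L @ letters L'"
  by (simp_all add: letters_def)

lemma flat_eq_zip: "\<forall>T\<in>set L. ok_block T \<Longrightarrow> flat L = zip (concat (map fst L)) (letters L)"
  by (induction L) (simp_all add: length_expand zip_append)

lemma flat_eq_if_letters_eq: "ok m n L \<Longrightarrow> ok m n L' \<Longrightarrow> letters L = letters L' \<Longrightarrow> flat L = flat L'"
  by (simp add: ok_def flat_eq_zip)

text \<open>
  The edges of the graph on the level of basis elements.  The blocks \<open>k\<close> and \<open>k + 1\<close>, counted from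
  \<open>0\<close>, are merged; the sign depends only on \<open>k\<close> and on the number of dots
  in the blocks \<open>0, \<dots>, k\<close>.
\<close>

definition merge_at :: "labelled \<Rightarrow> nat \<Rightarrow> labelled" where
  "merge_at L k = take k L @ (fst (L ! k) @ fst (L ! Suc k), snd (L ! k) + snd (L ! Suc k)) # drop (Suc (Suc k)) L"

definition coeff_at :: "labelled \<Rightarrow> nat \<Rightarrow> kk" where
  "coeff_at L k = merge_coeff (fst (L ! k)) (fst (L ! Suc k)) (snd (L ! k)) (snd (L ! Suc k))"

definition merges :: "labelled \<Rightarrow> nat set" where
  "merges L = {k. Suc k < length L \<and> block (fst (L ! k) @ fst (L ! Suc k))}"

definition dots_upto :: "labelled \<Rightarrow> nat \<Rightarrow> nat" where
  "dots_upto L k = length (concat (map fst (take (Suc k) L)))"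

definition sign_at :: "labelled \<Rightarrow> nat \<Rightarrow> kk" where
  "sign_at L k = (-1) ^ (dots_upto L k + Suc k)"

abbreviation scalar_at :: "labelled \<Rightarrow> nat \<Rightarrow> kk" where
  "scalar_at L k \<equiv> sign_at L k * coeff_at L k"

text \<open>The matrix of the differential.\<close>

definition entry :: "labelled \<Rightarrow> labelled \<Rightarrow> kk" where
  "entry L L' = (\<Sum>k\<in>merges L. if merge_at L k = L' then scalar_at L k else 0)"

lemma finite_merges [simp]: "finite (merges L)"
  by (rule finite_subset[of _ "{..<length L}"]) (auto simp: merges_def)

lemma at_decomposed:
  assumes "length p = k"
  shows "merge_at (p @ (A, a) # (B, b) # r) k = p @ (A @ B, a + b) # r"
    "coeff_at (p @ (A, a) # (B, b) # r) k = merge_coeff A B a b"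
    "k \<in> merges (p @ (A, a) # (B, b) # r) \<longleftrightarrow> block (A @ B)"
    "dots_upto (p @ (A, a) # r) k = length (concat (map fst p)) + length A"
  using assms by (auto simp: merge_at_def coeff_at_def merges_def dots_upto_def nth_append)

lemma decompose_at:
  assumes "Suc k < length L"
  obtains p A a B b r where "L = p @ (A, a) # (B, b) # r" "length p = k"
proof -
  have "L = take k L @ L ! k # L ! Suc k # drop (Suc (Suc k)) L"
    using assms by (metis Cons_nth_drop_Suc Suc_lessD append_take_drop_id)
  then show ?thesis
    using that[of "take k L" "fst (L ! k)" "snd (L ! k)" "fst (L ! Suc k)" "snd (L ! Suc k)"] assms
    by simp
qed

lemma merges_decompose:
  assumes "k \<in> merges L"
  obtains p A a B b r where "L = p @ (A, a) # (B, b) # r" "length p = k" "block (A @ B)"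
proof -
  have "Suc k < length L"
    using assms by (simp add: merges_def)
  then obtain p A a B b r where L: "L = p @ (A, a) # (B, b) # r" "length p = k"
    by (rule decompose_at)
  then show ?thesis
    using that assms by (simp add: at_decomposed)
qed

lemma entry_nonzeroD: "entry L L' \<noteq> 0 \<Longrightarrow> \<exists>k\<in>merges L. merge_at L k = L' \<and> coeff_at L k \<noteq> 0"
  unfolding entry_def by (rule ccontr) (auto intro!: sum.neutral)

lemma ok_merge_at:
  assumes "ok m n L" "k \<in> merges L" "coeff_at L k \<noteq> 0"
  shows "ok m n (merge_at L k)"
proof -
  obtain p A a B b r where L: "L = p @ (A, a) # (B, b) # r" "length p = k" and AB: "block (A @ B)"
    using assms(2) by (rule merges_decompose)
  show ?thesis
    using assms(1,3) merge_label[of A B a b] AB unfolding L(1) at_decomposed[OF L(2)] ok_def by auto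
qed

lemma length_merge_at: "k \<in> merges L \<Longrightarrow> Suc (length (merge_at L k)) = length L"
  by (auto simp: merge_at_def merges_def)

lemma append_mono_le:
  "length y = length y' \<Longrightarrow> y \<le> y' \<Longrightarrow> u @ y @ v \<le> u @ y' @ (v :: int list)"
  by (induction u) (auto simp: append_less_append order.order_iff_strict[of y])

lemma letters_merge_at_le:
  assumes "ok m n L" "k \<in> merges L" "coeff_at L k \<noteq> 0"
  shows "letters (merge_at L k) \<le> letters L"
proof -
  obtain p A a B b r where L: "L = p @ (A, a) # (B, b) # r" "length p = k" and AB: "block (A @ B)"
    using assms(2) by (rule merges_decompose)
  have ok: "block A" "block B" "a \<in> labels (block_factor A)" "b \<in> labels (block_factor B)"
    using assms(1) by (auto simp: ok_def L)
  have "expand (A @ B) (a + b) \<le> expand A a @ expand B b"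
    using assms(3) merge_expand_le[OF ok(1,2) AB ok(3,4)] unfolding L(1) at_decomposed[OF L(2)] by blast
  then have "letters p @ expand (A @ B) (a + b) @ letters r \<le> letters p @ (expand A a @ expand B b) @ letters r"
    by (intro append_mono_le) (simp_all add: length_expand AB ok)
  then show ?thesis
    unfolding L(1) at_decomposed[OF L(2)] by simp
qed

lemma merge_at_nth: "j < k \<Longrightarrow> k \<in> merges L \<Longrightarrow> merge_at L k ! j = L ! j"
  "k \<in> merges L \<Longrightarrow> fst (merge_at L k ! k) = fst (L ! k) @ fst (L ! Suc k)"
  by (auto simp: merge_at_def merges_def nth_append)

lemma ok_nonempty: "ok m n L \<Longrightarrow> k < length L \<Longrightarrow> fst (L ! k) \<noteq> []"
  using block_nonempty nth_mem[of k L] by (auto simp: ok_def)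

lemma merge_at_inj:
  assumes "ok m n L" "k \<in> merges L" "l \<in> merges L" "merge_at L k = merge_at L l"
  shows "k = l"
proof -
  have *: False if "k \<in> merges L" "l \<in> merges L" "k < l" "merge_at L k = merge_at L l" for k l
  proof -
    have "Suc k < length L"
      using that by (simp add: merges_def)
    then have "fst (L ! Suc k) \<noteq> []"
      by (rule ok_nonempty[OF assms(1)])
    moreover have "fst (L ! k) @ fst (L ! Suc k) = fst (L ! k)"
      using merge_at_nth(2)[OF that(1)] merge_at_nth(1)[OF that(3,2)] that(4) by simp
    ultimately show False
      by simp
  qed
  show ?thesis
    using *[OF assms(2,3)] *[OF assms(3,2)] assms(4) by (metis linorder_neqE_nat)
qed

lemma entry_merge_at:
  assumes "ok m n L" "k \<in> merges L" "coeff_at L k \<noteq> 0"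
  shows "entry L (merge_at L k) \<noteq> 0"
proof -
  have "entry L (merge_at L k) = (\<Sum>l\<in>merges L. if l = k then scalar_at L k else 0)"
    unfolding entry_def using merge_at_inj[OF assms(1) _ assms(2)] by (intro sum.cong) auto
  also have "\<dots> = scalar_at L k"
    using assms(2) by simp
  finally show ?thesis
    using assms(3) by (simp add: sign_at_def)
qed


section \<open>The differential squares to zero\<close>

text \<open>Merging twice: the index of the second boundary shifts when it lies to the right of the first.\<close>

lemma merge_twice:
  assumes "ok m n L" "k \<le> l"
  shows "(k \<in> merges L \<and> l \<in> merges (merge_at L k) \<longleftrightarrow> Suc l \<in> merges L \<and> k \<in> merges (merge_at L (Suc l))) \<and>
    (k \<in> merges L \<and> l \<in> merges (merge_at L k) \<longrightarrow> merge_at (merge_at L (Suc l)) k = merge_at (merge_at L k) l \<and>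
      scalar_at L (Suc l) * scalar_at (merge_at L (Suc l)) k = - (scalar_at L k * scalar_at (merge_at L k) l))"
proof (cases "Suc (Suc l) < length L")
  case False
  then have "Suc l \<notin> merges L"
    by (simp add: merges_def)
  moreover have "\<not> (k \<in> merges L \<and> l \<in> merges (merge_at L k))"
  proof
    assume *: "k \<in> merges L \<and> l \<in> merges (merge_at L k)"
    then have "Suc l < length (merge_at L k)"
      by (simp add: merges_def)
    then show False
      using length_merge_at[of k L] * False by simp
  qed
  ultimately show ?thesis
    by blast
next
  case len: True
  then obtain u Z z W w r where L: "L = u @ (Z, z) # (W, w) # r" and u: "length u = Suc l"
    by (rule decompose_at)
  note second = at_decomposed(1-3)[OF u, of Z z W w r, folded L]
  note second_dots = at_decomposed(4)[OF u, of Z z "(W, w) # r", folded L]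
  show ?thesis
  proof (cases "k = l")
    case True
    then have kl: "l = k"
      by simp
    obtain p T x where uX: "u = p @ [(T, x)]" "length p = k"
      using u kl by (cases u rule: rev_cases) auto
    have L': "L = p @ (T, x) # (Z, z) # (W, w) # r"
      by (simp add: L uX)
    note first = at_decomposed(1-3)[OF uX(2), of T x Z z "(W, w) # r", folded L']
    note first_dots = at_decomposed(4)[OF uX(2), of T x "(Z, z) # (W, w) # r", folded L']
    note first2 = at_decomposed(1-3)[OF uX(2), of "T @ Z" "x + z" W w r]
    note first2_dots = at_decomposed(4)[OF uX(2), of "T @ Z" "x + z" "(W, w) # r"]
    note second2 = at_decomposed(1-3)[OF uX(2), of T x "Z @ W" "z + w" r]
    note second2_dots = at_decomposed(4)[OF uX(2), of T x "(Z @ W, z + w) # r"]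
    have ok: "block T" "block Z" "block W" "x \<in> labels (block_factor T)" "z \<in> labels (block_factor Z)"
      "w \<in> labels (block_factor W)"
      using assms(1) by (auto simp: ok_def L')
    have m2: "merge_at L (Suc l) = p @ (T, x) # (Z @ W, z + w) # r"
      using second(1) by (simp add: uX)
    have iff: "block (T @ Z) \<and> block ((T @ Z) @ W) \<longleftrightarrow> block (Z @ W) \<and> block (T @ Z @ W)"
      using merge_coeff_assoc(1,2)[OF ok(1-3) _ ok(4-6)] by auto
    have sgn: "sign_at L (Suc l) * sign_at (merge_at L (Suc l)) k = - (sign_at L k * sign_at (merge_at L k) l)"
      using second_dots first_dots first2_dots second2_dots kl uX unfolding sign_at_def first(1) m2
      by (simp add: power_add)
    show ?thesis
    proof (intro conjI impI)
      show "k \<in> merges L \<and> l \<in> merges (merge_at L k) \<longleftrightarrow> Suc l \<in> merges L \<and> k \<in> merges (merge_at L (Suc l))"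
        unfolding first(1,3) second(3) m2 second2(3) using iff first2(3) kl by simp
      assume *: "k \<in> merges L \<and> l \<in> merges (merge_at L k)"
      show "merge_at (merge_at L (Suc l)) k = merge_at (merge_at L k) l"
        using kl unfolding first(1) m2 second2(1) by (simp add: first2(1) add.assoc)
      have "block (T @ Z @ W)"
        using * kl unfolding first(1,3) by (simp add: first2(3))
      from merge_coeff_assoc(3)[OF ok(1-3) this ok(4-6)]
      have "coeff_at L (Suc l) * coeff_at (merge_at L (Suc l)) k = coeff_at L k * coeff_at (merge_at L k) l"
        using kl unfolding first(1,2) second(2) m2 second2(2) by (simp add: first2(2))
      then show "scalar_at L (Suc l) * scalar_at (merge_at L (Suc l)) k =
        - (scalar_at L k * scalar_at (merge_at L k) l)"
        using sgn by (metis (no_types, lifting) mult.assoc mult.left_commute mult_minus_left)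
    qed
  next
    case False
    then have "Suc k < length u"
      using assms(2) u by simp
    then obtain p T x Y y s where uX: "u = p @ (T, x) # (Y, y) # s" and p: "length p = k"
      by (rule decompose_at)
    have L': "L = p @ (T, x) # (Y, y) # s @ (Z, z) # (W, w) # r"
      by (simp add: L uX)
    have l: "length (p @ (T @ Y, x + y) # s) = l"
      using u p uX by simp
    note first = at_decomposed(1-3)[OF p, of T x Y y "s @ (Z, z) # (W, w) # r", folded L']
    note first_dots = at_decomposed(4)[OF p, of T x "(Y, y) # s @ (Z, z) # (W, w) # r", folded L']
    note first2 = at_decomposed(1-3)[OF l, of Z z W w r]
    note first2_dots = at_decomposed(4)[OF l, of Z z "(W, w) # r"]
    note second2 = at_decomposed(1-3)[OF p, of T x Y y "s @ (Z @ W, z + w) # r"]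
    note second2_dots = at_decomposed(4)[OF p, of T x "(Y, y) # s @ (Z @ W, z + w) # r"]
    have m1: "merge_at L k = (p @ (T @ Y, x + y) # s) @ (Z, z) # (W, w) # r"
      using first(1) by simp
    have m2: "merge_at L (Suc l) = p @ (T, x) # (Y, y) # s @ (Z @ W, z + w) # r"
      using second(1) by (simp add: uX)
    have sgn: "sign_at L (Suc l) * sign_at (merge_at L (Suc l)) k = - (sign_at L k * sign_at (merge_at L k) l)"
      using second_dots first_dots first2_dots second2_dots uX p u unfolding sign_at_def m1 m2
      by (simp add: power_add)
    have coeff: "coeff_at L (Suc l) * coeff_at (merge_at L (Suc l)) k = coeff_at L k * coeff_at (merge_at L k) l"
      unfolding m1 m2 first(2) second(2) first2(2) second2(2) by simp
    show ?thesis
    proof (intro conjI impI)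
      show "k \<in> merges L \<and> l \<in> merges (merge_at L k) \<longleftrightarrow> Suc l \<in> merges L \<and> k \<in> merges (merge_at L (Suc l))"
        unfolding first(3) second(3) m1 m2 first2(3) second2(3) by blast
      show "merge_at (merge_at L (Suc l)) k = merge_at (merge_at L k) l"
        unfolding m1 m2 first2(1) second2(1) by simp
      show "scalar_at L (Suc l) * scalar_at (merge_at L (Suc l)) k =
        - (scalar_at L k * scalar_at (merge_at L k) l)"
        using sgn coeff by (metis (no_types, lifting) mult.assoc mult.left_commute mult_minus_left)
    qed
  qed
qed

text \<open>A partition with \<open>N\<close> blocks has degree \<open>m + n - N\<close>.\<close>

definition basis_of_length :: "nat \<Rightarrow> nat \<Rightarrow> nat \<Rightarrow> labelled set" where
  "basis_of_length m n N = {L. ok m n L \<and> length L = N}"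

lemma finite_basis_of_length: "finite (basis_of_length m n N)"
proof (rule finite_subset)
  show "finite {L :: labelled. set L \<subseteq> {B. block B} \<times> {-1, 0, 1} \<and> length L = N}"
    by (rule finite_lists_length_eq) (simp add: block_def)
  have "labels V \<subseteq> {-1, 0, 1}" for V
    by (cases V) auto
  then show "basis_of_length m n N \<subseteq> {L. set L \<subseteq> {B. block B} \<times> {-1, 0, 1} \<and> length L = N}"
    by (fastforce simp: basis_of_length_def ok_def)
qed

lemma entry_entry:
  assumes "ok m n L" "length L = Suc N"
  shows "(\<Sum>b\<in>basis_of_length m n N. entry L b * entry b c) = 0"
proof -
  let ?T = "basis_of_length m n N"
  define g where "g = (\<lambda>(k, l). if merge_at (merge_at L k) l = c
    then scalar_at L k * scalar_at (merge_at L k) l else 0)"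
  define S where "S = (SIGMA k:merges L. merges (merge_at L k))"
  have "finite S"
    by (simp add: S_def)
  have "(\<Sum>b\<in>?T. entry L b * entry b c) =
    (\<Sum>b\<in>?T. \<Sum>k\<in>merges L. if merge_at L k = b then scalar_at L k * entry (merge_at L k) c else 0)"
    unfolding entry_def[of L] sum_distrib_right by (intro sum.cong) auto
  also have "\<dots> = (\<Sum>k\<in>merges L. \<Sum>b\<in>?T. if merge_at L k = b then scalar_at L k * entry (merge_at L k) c else 0)"
    by (rule sum.swap)
  also have "\<dots> = (\<Sum>k\<in>merges L. scalar_at L k * entry (merge_at L k) c)"
  proof (rule sum.cong)
    fix k assume k: "k \<in> merges L"
    have "coeff_at L k = 0 \<or> merge_at L k \<in> ?T"
      using ok_merge_at[OF assms(1) k] length_merge_at[OF k] assms(2) by (auto simp: basis_of_length_def)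
    then show "(\<Sum>b\<in>?T. if merge_at L k = b then scalar_at L k * entry (merge_at L k) c else 0) =
      scalar_at L k * entry (merge_at L k) c"
      using finite_basis_of_length by auto
  qed simp
  also have "\<dots> = (\<Sum>k\<in>merges L. \<Sum>l\<in>merges (merge_at L k). g (k, l))"
    unfolding entry_def[of "merge_at L _"] sum_distrib_left g_def by (intro sum.cong) (auto simp: mult.assoc)
  also have "\<dots> = sum g S"
    unfolding S_def by (subst sum.Sigma) auto
  also have "S = {(k, l) \<in> S. k \<le> l} \<union> {(k, l) \<in> S. l < k}"
    by auto
  also have "sum g \<dots> = sum g {(k, l) \<in> S. k \<le> l} + sum g {(k, l) \<in> S. l < k}"
    by (rule sum.union_disjoint) (auto intro: finite_subset[OF _ \<open>finite S\<close>])
  also have "sum g {(k, l) \<in> S. l < k} = (\<Sum>x\<in>{(k, l) \<in> S. k \<le> l}. - g x)"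
  proof (rule sum.reindex_bij_witness[where i = "\<lambda>(k, l). (Suc l, k)" and j = "\<lambda>(k, l). (l, k - 1)"])
    fix x assume "x \<in> {(k, l) \<in> S. l < k}"
    then obtain k l where x: "x = (k, l)" "k \<in> merges L" "l \<in> merges (merge_at L k)" "l < k"
      by (auto simp: S_def)
    have k: "Suc (k - 1) = k" "l \<le> k - 1"
      using x(4) by auto
    show "(case (case x of (k, l) \<Rightarrow> (l, k - 1)) of (k, l) \<Rightarrow> (Suc l, k)) = x"
      using x k by simp
    have *: "l \<in> merges L" "k - 1 \<in> merges (merge_at L l)"
      using merge_twice[OF assms(1) k(2), THEN conjunct1] x k(1) by auto
    show "(case x of (k, l) \<Rightarrow> (l, k - 1)) \<in> {(k, l) \<in> S. k \<le> l}"
      using * x(1) k(2) by (simp add: S_def)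
    show "- g (case x of (k, l) \<Rightarrow> (l, k - 1)) = g x"
      using merge_twice[OF assms(1) k(2), THEN conjunct2] * unfolding k(1) x(1) g_def by auto
  next
    fix x assume "x \<in> {(k, l) \<in> S. k \<le> l}"
    then obtain k l where x: "x = (k, l)" "k \<in> merges L" "l \<in> merges (merge_at L k)" "k \<le> l"
      by (auto simp: S_def)
    show "(case (case x of (k, l) \<Rightarrow> (Suc l, k)) of (k, l) \<Rightarrow> (l, k - 1)) = x"
      using x by simp
    show "(case x of (k, l) \<Rightarrow> (Suc l, k)) \<in> {(k, l) \<in> S. l < k}"
      using merge_twice[OF assms(1) x(4), THEN conjunct1] x by (simp add: S_def)
  qed
  also have "sum g {(k, l) \<in> S. k \<le> l} + (\<Sum>x\<in>{(k, l) \<in> S. k \<le> l}. - g x) = 0"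
    by (simp add: sum_negf)
  finally show ?thesis .
qed


section \<open>The matching\<close>

text \<open>The position of the first good pair of neighbours.\<close>

fun ascent :: "(sign \<times> int) list \<Rightarrow> nat" where
  "ascent (x # y # r) = (if good x y then 0 else Suc (ascent (y # r)))"
| "ascent _ = 0"

abbreviation no_good :: "(sign \<times> int) list \<Rightarrow> bool" where
  "no_good \<equiv> successively (\<lambda>x y. \<not> good x y)"

lemma ascent_decompose:
  "\<not> no_good cs \<Longrightarrow> \<exists>p x y r. cs = p @ x # y # r \<and> length p = ascent cs \<and> good x y \<and> no_good (p @ [x])"
proof (induction cs rule: ascent.induct)
  case (1 x y r)
  show ?case
  proof (cases "good x y")
    case True
    then show ?thesis
      by (intro exI[of _ "[]"]) simp
  next
    case False
    then obtain p x' y' r' where *: "y # r = p @ x' # y' # r'" "length p = ascent (y # r)" "good x' y'"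
      "no_good (p @ [x'])"
      using 1 by auto
    have "no_good ((x # p) @ [x'])"
      using *(1,4) False by (cases p) auto
    moreover have "ascent (x # y # r) = Suc (ascent (y # r))"
      using False by simp
    then have "length (x # p) = ascent (x # y # r)"
      using *(2) by simp
    moreover have "x # y # r = (x # p) @ x' # y' # r'"
      using *(1) by simp
    ultimately show ?thesis
      using *(3) by blast
  qed
qed simp_all

text \<open>A block that consists of one dot, with its letter as the label.\<close>

definition single_dot :: "sign \<times> int \<Rightarrow> sign list \<times> int" where
  "single_dot x = ([fst x], snd x)"

text \<open>The blocks to the left of the first good pair are single dots.\<close>

lemma single_dots_prefix:
  "\<forall>T\<in>set L. ok_block T \<Longrightarrow> flat L = p @ x # y # r \<Longrightarrow> no_good (p @ [x]) \<Longrightarrow>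
    \<exists>L'. L = map single_dot p @ L' \<and> flat L' = x # y # r"
proof (induction p arbitrary: L)
  case (Cons z p)
  then obtain B c L1 where L: "L = (B, c) # L1"
    by (cases L) auto
  have B: "block B" "c \<in> labels (block_factor B)"
    using Cons.prems(1) L by auto
  have "length B = 1"
  proof (rule ccontr)
    assume "length B \<noteq> 1"
    then have "1 < length B"
      using block_nonempty[OF B(1)] by (cases B) auto
    then obtain \<alpha> \<beta> s where s: "zip B (expand B c) = \<alpha> # \<beta> # s" "good \<alpha> \<beta>"
      using good_in_block[OF B(1) _ B(2)] by blast
    have "\<alpha> # \<beta> # s @ flat L1 = z # p @ x # y # r"
      using Cons.prems(2) s(1) by (simp add: L)
    then have "\<alpha> = z" "\<beta> = hd (p @ [x])"
      by (cases p; simp)+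
    then show False
      using s(2) Cons.prems(3) by (cases p) auto
  qed
  then obtain s where s: "B = [s]"
    by (auto simp: length_Suc_conv)
  then have "z = (s, c)" "flat L1 = p @ x # y # r"
    using Cons.prems(2) by (simp_all add: L expand_def)
  moreover have "no_good (p @ [x])"
    using Cons.prems(3) by (cases p) auto
  moreover have "\<forall>T\<in>set L1. ok_block T"
    using Cons.prems(1) by (simp add: L)
  ultimately obtain L' where "L1 = map single_dot p @ L'" "flat L' = x # y # r"
    using Cons.IH by blast
  then show ?case
    by (intro exI[of _ L']) (simp add: L s single_dot_def \<open>z = (s, c)\<close>)
qed simp

text \<open>The first good pair is joined in \<open>L\<close>.\<close>

definition joined_first :: "labelled \<Rightarrow> bool" where
  "joined_first L \<longleftrightarrow> 1 < length (fst (L ! ascent (flat L)))"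

lemma has_good_pair:
  assumes "ok m n L" "length L < m + n"
  shows "\<not> no_good (flat L)"
proof -
  have blocks: "\<forall>T\<in>set L. ok_block T"
    using assms(1) by (simp add: ok_def)
  have "\<exists>T\<in>set L. length (fst T) \<noteq> 1"
  proof (rule ccontr)
    assume "\<not> (\<exists>T\<in>set L. length (fst T) \<noteq> 1)"
    then have "length (concat (map fst L)) = length L"
      by (induction L) auto
    moreover have "length (concat (map fst L)) = m + n"
      using assms(1) by (simp add: ok_def dots_def)
    ultimately show False
      using assms(2) by simp
  qed
  then obtain T u v where L: "L = u @ T # v" and T: "length (fst T) \<noteq> 1"
    by (metis split_list)
  have "ok_block T"
    using blocks L by simp
  moreover have "1 < length (fst T)"
    using T block_nonempty calculation by (cases "fst T") auto
  ultimately obtain \<alpha> \<beta> s where s: "zip (fst T) (expand (fst T) (snd T)) = \<alpha> # \<beta> # s" "good \<alpha> \<beta>"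
    using good_in_block by blast
  then have "flat L = flat u @ \<alpha> # \<beta> # (s @ flat v)"
    by (simp add: L)
  then show ?thesis
    using s(2) by (simp add: successively_append_iff)
qed

text \<open>Splitting the block at the first good pair.\<close>

lemma matched_down:
  assumes "ok m n L" "length L < m + n" "joined_first L"
  shows "\<exists>l. ok m n l \<and> length l = Suc (length L) \<and> letters l = letters L \<and> entry l L \<noteq> 0 \<and>
    (\<forall>L'. ok m n L' \<and> joined_first L' \<and> letters L' = letters L \<and> entry l L' \<noteq> 0 \<longrightarrow> L' = L)"
proof -
  obtain p x y r where pxy: "flat L = p @ x # y # r" "length p = ascent (flat L)" "good x y" "no_good (p @ [x])"
    using ascent_decompose[OF has_good_pair[OF assms(1,2)]] by blast
  have prefix: "\<exists>M. L' = map single_dot p @ M \<and> flat M = x # y # r"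
    if "ok m n L'" "letters L' = letters L" for L'
    using single_dots_prefix[of L' p x y r] flat_eq_if_letters_eq[OF that(1) assms(1) that(2)] pxy that(1)
    by (simp add: ok_def)
  obtain M where M: "L = map single_dot p @ M" "flat M = x # y # r"
    using prefix[OF assms(1)] by blast
  obtain B c M' where M': "M = (B, c) # M'"
    using M(2) by (cases M) auto
  have B: "block B" "c \<in> labels (block_factor B)"
    using assms(1) by (auto simp: ok_def M M')
  have "1 < length B"
    using assms(3) pxy(2) by (simp add: joined_first_def M(1) M' nth_append)
  from split_block[OF B(1) this B(2)] obtain s D a b where D: "B = s # D" "block [s]" "block D" "a \<in> labels (block_factor [s])"
    "b \<in> labels (block_factor D)" "a + b = c" "merge_coeff [s] D a b \<noteq> 0" "expand B c = a # expand D b"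
    by blast
  define l where "l = map single_dot p @ ([s], a) # (D, b) # M'"
  note at = at_decomposed(1-3)[of "map single_dot p" "length p" "[s]" a D b M', folded l_def]
  have at': "merge_at l (length p) = L" "coeff_at l (length p) \<noteq> 0" "length p \<in> merges l"
    using at D B(1) by (simp_all add: M(1) M')
  have ok: "ok m n l"
    using assms(1) D by (auto simp: ok_def l_def M(1) M')
  have "letters l = letters L"
    using D(8) by (simp add: l_def M(1) M') (simp add: expand_def)
  moreover have "entry l L \<noteq> 0"
    using entry_merge_at[OF ok at'(3,2)] at'(1) by simp
  moreover have "L' = L" if L': "ok m n L'" "joined_first L'" "letters L' = letters L" "entry l L' \<noteq> 0" for L'
  proof -
    obtain k where k: "k \<in> merges l" "merge_at l k = L'"
      using entry_nonzeroD[OF L'(4)] by blast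
    obtain N where N: "L' = map single_dot p @ N"
      using prefix[OF L'(1,3)] by blast
    have joined: "1 < length (fst (L' ! length p))"
      using L'(2) flat_eq_if_letters_eq[OF L'(1) assms(1) L'(3)] pxy(2) by (simp add: joined_first_def)
    \<comment> \<open>A merger further left would join a dot that is single in \<open>L'\<close>, and a merger further right
      would keep the dot at the first good pair single.\<close>
    consider "k < length p" | "k = length p" | "length p < k"
      by linarith
    then show ?thesis
    proof cases
      case 1
      have "fst (L' ! k) = fst (l ! k) @ fst (l ! Suc k)"
        using merge_at_nth(2)[OF k(1)] k(2) by simp
      moreover have "Suc k < length l"
        using k(1) by (simp add: merges_def)
      then have "fst (l ! k) \<noteq> []" "fst (l ! Suc k) \<noteq> []"
        by (simp_all add: ok_nonempty[OF ok])
      moreover have "length (fst (L' ! k)) = 1"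
        using 1 by (simp add: N nth_append single_dot_def)
      ultimately show ?thesis
        by (cases "fst (l ! k)"; cases "fst (l ! Suc k)") auto
    next
      case 2
      then show ?thesis
        using k(2) at'(1) by simp
    next
      case 3
      then have "L' ! length p = l ! length p"
        using merge_at_nth(1)[OF 3 k(1)] k(2) by simp
      then show ?thesis
        using joined by (simp add: l_def nth_append)
    qed
  qed
  ultimately show ?thesis
    using ok by (intro exI[of _ l]) (auto simp: l_def M(1) M')
qed

text \<open>Joining the first good pair.\<close>

lemma matched_up:
  assumes "ok m n L" "length L < m + n" "\<not> joined_first L"
  shows "\<exists>u. ok m n u \<and> Suc (length u) = length L \<and> letters u = letters L \<and> entry L u \<noteq> 0 \<and>
    (\<forall>L'. ok m n L' \<and> \<not> joined_first L' \<and> letters L' = letters L \<and> entry L' u \<noteq> 0 \<longrightarrow> L' = L)"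
proof -
  obtain p x y r where pxy: "flat L = p @ x # y # r" "length p = ascent (flat L)" "good x y" "no_good (p @ [x])"
    using ascent_decompose[OF has_good_pair[OF assms(1,2)]] by blast
  have prefix: "\<exists>B c M. L' = map single_dot p @ single_dot x # (B, c) # M \<and> flat ((B, c) # M) = y # r"
    if "ok m n L'" "letters L' = letters L" "\<not> joined_first L'" for L'
  proof -
    have flat: "flat L' = flat L"
      by (rule flat_eq_if_letters_eq[OF that(1) assms(1) that(2)])
    have "\<exists>M. L' = map single_dot p @ M \<and> flat M = x # y # r"
      by (rule single_dots_prefix) (use that(1) flat pxy in \<open>simp_all add: ok_def\<close>)
    then obtain M where M: "L' = map single_dot p @ M" "flat M = x # y # r"
      by blast
    obtain A a M' where M': "M = (A, a) # M'"
      using M(2) by (cases M) auto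
    have "\<not> 1 < length A"
      using that(3) pxy(2) flat by (simp add: joined_first_def M(1) M' nth_append)
    moreover have "A \<noteq> []"
      using that(1) block_nonempty by (auto simp: ok_def M(1) M')
    ultimately obtain s where "A = [s]"
      by (cases A) auto
    then have "(A, a) = single_dot x" "flat M' = y # r"
      using M(2) by (auto simp: M' expand_def single_dot_def)
    moreover obtain B c M'' where "M' = (B, c) # M''"
      using calculation(2) by (cases M') auto
    ultimately show ?thesis
      using M(1) M' by auto
  qed
  obtain B c M where M: "L = map single_dot p @ single_dot x # (B, c) # M" "flat ((B, c) # M) = y # r"
    using prefix[OF assms(1) _ assms(3)] by blast
  obtain s a where x: "x = (s, a)"
    by (cases x)
  have ok: "a \<in> labels (block_factor [s])" "block B" "c \<in> labels (block_factor B)"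
    using assms(1) by (auto simp: ok_def M(1) single_dot_def x)
  have "y = (hd B, hd (expand B c))"
    using M(2) length_expand[OF ok(2), of c] block_nonempty[OF ok(2)]
    by (cases B; cases "expand B c") auto
  then have join: "block (s # B)" "merge_coeff [s] B a c \<noteq> 0" "expand (s # B) (a + c) = a # expand B c"
    using join_good[OF ok(2,1,3)] pxy(3) x by simp_all
  define u where "u = map single_dot p @ (s # B, a + c) # M"
  have L: "L = map single_dot p @ ([s], a) # (B, c) # M"
    by (simp add: M(1) single_dot_def x)
  note at = at_decomposed(1-3)[of "map single_dot p" "length p" "[s]" a B c M, folded L]
  have at': "merge_at L (length p) = u" "coeff_at L (length p) \<noteq> 0" "length p \<in> merges L"
    using at join by (simp_all add: u_def)
  have "ok m n u"
    using ok_merge_at[OF assms(1) at'(3,2)] at'(1) by simp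
  moreover have "letters u = letters L"
    using join(3) by (simp add: u_def L) (simp add: expand_def)
  moreover have "entry L u \<noteq> 0"
    using entry_merge_at[OF assms(1) at'(3,2)] at'(1) by simp
  moreover have "L' = L" if L': "ok m n L'" "\<not> joined_first L'" "letters L' = letters L" "entry L' u \<noteq> 0" for L'
  proof -
    obtain k where k: "k \<in> merges L'" "merge_at L' k = u"
      using entry_nonzeroD[OF L'(4)] by blast
    obtain B' c' M' where N: "L' = map single_dot p @ single_dot x # (B', c') # M'"
      using prefix[OF L'(1,3,2)] by blast
    have "B \<noteq> []"
      using block_nonempty[OF ok(2)] .
    \<comment> \<open>A merger further left would join a dot that is single in \<open>u\<close>, and a merger further right
      would keep the dot at the first good pair single.\<close>
    consider "k < length p" | "k = length p" | "length p < k"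
      by linarith
    then show ?thesis
    proof cases
      case 1
      have "fst (u ! k) = fst (L' ! k) @ fst (L' ! Suc k)"
        using merge_at_nth(2)[OF k(1)] k(2) by simp
      moreover have "Suc k < length L'"
        using k(1) by (simp add: merges_def)
      then have "fst (L' ! k) \<noteq> []" "fst (L' ! Suc k) \<noteq> []"
        by (simp_all add: ok_nonempty[OF L'(1)])
      moreover have "length (fst (u ! k)) = 1"
        using 1 by (simp add: u_def nth_append single_dot_def)
      ultimately show ?thesis
        by (cases "fst (L' ! k)"; cases "fst (L' ! Suc k)") auto
    next
      case 2
      have "merge_at L' k = map single_dot p @ (s # B', a + c') # M'"
        using at_decomposed(1)[of "map single_dot p" k "[s]" a B' c' M'] 2 by (simp add: N single_dot_def x)
      then have "s # B' = s # B" "a + c' = a + c" "M' = M"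
        using k(2) by (simp_all add: u_def)
      then show ?thesis
        by (simp add: N M(1))
    next
      case 3
      then have "u ! length p = L' ! length p"
        using merge_at_nth(1)[OF 3 k(1)] k(2) by simp
      then show ?thesis
        using \<open>B \<noteq> []\<close> by (simp add: u_def N nth_append single_dot_def)
    qed
  qed
  ultimately show ?thesis
    by (intro exI[of _ u]) (auto simp: u_def L)
qed

lemma entry_nonzero_props:
  assumes "ok m n L" "entry L L' \<noteq> 0"
  shows "ok m n L'" "Suc (length L') = length L" "letters L' \<le> letters L"
  using entry_nonzeroD[OF assms(2)] ok_merge_at[OF assms(1)] length_merge_at letters_merge_at_le[OF assms(1)]
  by blast+

lemma entry_exact:
  assumes "Suc N \<le> m + n" "\<And>c. c \<in> basis_of_length m n (N - 1) \<Longrightarrow> (\<Sum>b\<in>basis_of_length m n N. z b * entry b c) = 0"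
    "0 < N"
  shows "\<exists>y. \<forall>b\<in>basis_of_length m n N. z b = (\<Sum>a\<in>basis_of_length m n (Suc N). y a * entry a b)"
proof (rule exact_if_matching[where wd = letters and U = joined_first and ?X2.0 = "basis_of_length m n (N - 1)"])
  show "(\<Sum>b\<in>basis_of_length m n N. entry a b * entry b c) = 0" if "a \<in> basis_of_length m n (Suc N)" for a c
    using that entry_entry by (simp add: basis_of_length_def)
  show "letters b \<le> letters a" if "a \<in> basis_of_length m n (Suc N)" "entry a b \<noteq> 0" for a b
    using that entry_nonzero_props(3)[of m n a b] by (simp add: basis_of_length_def)
  show "letters b \<le> letters a" if "a \<in> basis_of_length m n N" "entry a b \<noteq> 0" for a b
    using that entry_nonzero_props(3)[of m n a b] by (simp add: basis_of_length_def)
  show "\<exists>l\<in>basis_of_length m n (Suc N). letters l = letters u \<and> entry l u \<noteq> 0 \<and>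
    (\<forall>u'\<in>basis_of_length m n N. joined_first u' \<and> letters u' = letters u \<and> entry l u' \<noteq> 0 \<longrightarrow> u' = u)"
    if "u \<in> basis_of_length m n N" "joined_first u" for u
    using matched_down[of m n u] that assms(1) by (auto simp: basis_of_length_def)
  show "\<exists>u\<in>basis_of_length m n (N - 1). letters u = letters l \<and> entry l u \<noteq> 0 \<and>
    (\<forall>l'\<in>basis_of_length m n N. \<not> joined_first l' \<and> letters l' = letters l \<and> entry l' u \<noteq> 0 \<longrightarrow> l' = l)"
    if "l \<in> basis_of_length m n N" "\<not> joined_first l" for l
    using matched_up[of m n l] that assms(1) by (auto simp: basis_of_length_def)
qed (use assms finite_basis_of_length in auto)


section \<open>Coordinates on the complex\<close>

text \<open>Admissibility alone does not exclude the block \<open>[Neg, Pos]\<close>, but the order of the dots does.\<close>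

lemma block_if_admissible:
  assumes "pre @ B @ post = dots m n" "admissible_block B"
  shows "block B"
proof -
  have "B = take (length B) (drop (length pre) (dots m n))"
    unfolding assms(1)[symmetric] by simp
  then obtain i j where B: "B = replicate i Pos @ replicate j Neg"
    by (simp add: dots_def take_replicate drop_replicate)
  have len: "1 \<le> i + j" "i + j \<le> 3"
    using assms(2) by (auto simp: admissible_block_def B)
  then have "i \<in> {0, 1, 2, 3}" "j \<in> {0, 1, 2, 3}"
    by auto
  then show ?thesis
    using len assms(2)
    by (elim insertE emptyE) (simp_all add: B block_def admissible_block_def numeral_eq_Suc)
qed

lemma admissible_if_block: "block B \<Longrightarrow> admissible_block B"
  unfolding block_def by (elim insertE) (simp_all add: admissible_block_def)

lemma block_if_compatible: "compatible m n P \<Longrightarrow> B \<in> set P \<Longrightarrow> block B"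
proof -
  assume P: "compatible m n P" and "B \<in> set P"
  then obtain u v where "P = u @ B # v"
    by (meson split_list)
  then show ?thesis
    using P block_if_admissible[of "concat u" B "concat v" m n] by (simp add: compatible_def)
qed

lemma in_listset_iff: "w \<in> listset As \<longleftrightarrow> length w = length As \<and> (\<forall>j<length As. w ! j \<in> As ! j)"
proof (induction As arbitrary: w)
  case (Cons A As)
  show ?case
    by (cases w) (auto simp: set_Cons_def Cons.IH less_Suc_eq_0_disj)
qed auto

lemma ok_zip_iff:
  assumes "length P = length w"
  shows "ok m n (zip P w) \<longleftrightarrow> compatible m n P \<and> w \<in> listset (map labels (map block_factor P))"
proof
  assume ok: "ok m n (zip P w)"
  have *: "block (P ! j) \<and> w ! j \<in> labels (block_factor (P ! j))" if "j < length P" for j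
  proof -
    have "zip P w ! j \<in> set (zip P w)"
      using that assms by (intro nth_mem) simp
    then have "ok_block (zip P w ! j)"
      using ok unfolding ok_def by blast
    then show ?thesis
      using that assms by simp
  qed
  moreover have "concat P = dots m n"
    using ok assms by (simp add: ok_def)
  ultimately show "compatible m n P \<and> w \<in> listset (map labels (map block_factor P))"
    using assms by (auto simp: compatible_def in_listset_iff in_set_conv_nth admissible_if_block)
next
  assume *: "compatible m n P \<and> w \<in> listset (map labels (map block_factor P))"
  then have "block (P ! j)" if "j < length P" for j
    using block_if_compatible[of m n P "P ! j"] that * by simp
  then show "ok m n (zip P w)"
    using * assms by (auto simp: ok_def compatible_def in_listset_iff in_set_zip)
qed

lemma carrier_C_iff:
  "x \<in> carrier (C m n i) \<longleftrightarrow> (\<forall>P w. Poly_Mapping.lookup (Poly_Mapping.lookup x P) w \<noteq> 0 \<longrightarrow>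
     length P = length w \<and> ok m n (zip P w) \<and> int (m + n) - int (length P) = i)"
proof -
  have deg: "deg P = int (m + n) - int (length P)" if "compatible m n P" for P
    using that by (simp add: deg_def compatible_def dots_def)
  show ?thesis
  proof
    assume x: "x \<in> carrier (C m n i)"
    show "\<forall>P w. Poly_Mapping.lookup (Poly_Mapping.lookup x P) w \<noteq> 0 \<longrightarrow>
      length P = length w \<and> ok m n (zip P w) \<and> int (m + n) - int (length P) = i"
    proof (intro allI impI)
      fix P w assume nz: "Poly_Mapping.lookup (Poly_Mapping.lookup x P) w \<noteq> 0"
      then have "P \<in> Poly_Mapping.keys x"
        by (auto simp: in_keys_iff)
      then have P: "compatible m n P" "deg P = i" "w \<in> listset (map labels (map block_factor P))"
        using x nz by (auto simp: C_def C_tilde_def valid_def in_keys_iff subset_iff)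
      have len: "length P = length w"
        using P(3) by (simp add: in_listset_iff)
      show "length P = length w \<and> ok m n (zip P w) \<and> int (m + n) - int (length P) = i"
        using P deg[OF P(1)] len ok_zip_iff[OF len] by simp
    qed
  next
    assume *: "\<forall>P w. Poly_Mapping.lookup (Poly_Mapping.lookup x P) w \<noteq> 0 \<longrightarrow>
      length P = length w \<and> ok m n (zip P w) \<and> int (m + n) - int (length P) = i"
    show "x \<in> carrier (C m n i)"
      unfolding C_def
    proof (simp, intro ballI)
      fix P assume "P \<in> Poly_Mapping.keys x"
      then have "Poly_Mapping.lookup x P \<noteq> 0"
        by (simp add: in_keys_iff)
      then obtain w where "Poly_Mapping.lookup (Poly_Mapping.lookup x P) w \<noteq> 0"
        by (metis lookup_zero poly_mapping_eqI)
      then have w: "length P = length w" "ok m n (zip P w)" "int (m + n) - int (length P) = i"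
        using * by blast+
      then have "compatible m n P" "int (m + n) - int (length P) = i"
        using ok_zip_iff[OF w(1), of m n] by blast+
      moreover have "valid (map block_factor P) (Poly_Mapping.lookup x P)"
        unfolding valid_def
      proof
        fix v assume "v \<in> Poly_Mapping.keys (Poly_Mapping.lookup x P)"
        then have v: "length P = length v" "ok m n (zip P v)"
          using * unfolding in_keys_iff by blast+
        then show "v \<in> listset (map labels (map block_factor P))"
          using ok_zip_iff[OF v(1), of m n] by blast
      qed
      ultimately show "compatible m n P \<and> deg P = i \<and> Poly_Mapping.lookup x P \<in> carrier (C_tilde P)"
        using deg by (simp add: C_tilde_def)
    qed
  qed
qed

text \<open>The coefficient of a basis element in a cochain.\<close>

definition coord :: "cochain \<Rightarrow> labelled \<Rightarrow> kk" where
  "coord x L = Poly_Mapping.lookup (Poly_Mapping.lookup x (map fst L)) (map snd L)"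

lemma map_fst_snd_eq_iff: "map fst L = Q \<and> map snd L = u \<longleftrightarrow> length Q = length u \<and> L = zip Q u"
  by (auto simp: zip_map_fst_snd)

lemma map_fst_merge_at: "Suc k < length L \<Longrightarrow> map fst (merge_at L k) = merge (map fst L) k"
  by (simp add: merge_at_def merge_def take_map drop_map)

lemma edges_from_eq_merges:
  assumes "ok m n L"
  shows "edges_from (map fst L) = merges L"
proof -
  have "block (fst (L ! k) @ fst (L ! Suc k))"
    if k: "Suc k < length L" and adm: "admissible_block (fst (L ! k) @ fst (L ! Suc k))" for k
  proof -
    obtain p A a B b r where L: "L = p @ (A, a) # (B, b) # r" "length p = k"
      using k by (rule decompose_at)
    have "concat (map fst p) @ (A @ B) @ concat (map fst r) = dots m n"
      using assms by (simp add: ok_def L(1))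
    moreover have "L ! k = (A, a)" "L ! Suc k = (B, b)"
      using L(2) by (auto simp: L(1) nth_append)
    ultimately show ?thesis
      using block_if_admissible adm by simp
  qed
  then show ?thesis
    by (auto simp: edges_from_def merges_def admissible_if_block)
qed

lemma edge_map_basis:
  assumes "ok m n L" "k \<in> merges L"
  shows "edge_map (map fst L) k (basis_vec (map snd L)) = scale (coeff_at L k) (basis_vec (map snd (merge_at L k)))"
proof -
  obtain p A a B b r where L: "L = p @ (A, a) # (B, b) # r" "length p = k" and AB: "block (A @ B)"
    using assms(2) by (rule merges_decompose)
  have nth: "map fst L ! k = A" "map fst L ! Suc k = B" "map snd L ! k = a" "map snd L ! Suc k = b"
    "take k (map snd L) = map snd p" "drop (Suc (Suc k)) (map snd L) = map snd r"
    using L(2) by (auto simp: L(1) nth_append)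
  have "merge_map A B a b = scale (merge_coeff A B a b) (basis_vec (a + b))"
    using assms(1) AB by (intro merge_map_eq) (auto simp: ok_def L(1))
  moreover have "coeff_at L k = merge_coeff A B a b" "merge_at L k = p @ (A @ B, a + b) # r"
    unfolding L(1) at_decomposed[OF L(2)] by simp_all
  ultimately show ?thesis
    unfolding edge_map_def lin_ext_basis nth by (simp add: linear_map_scale[OF linear_map_lin_ext] del: scale_single)
qed

text \<open>The sign counts the joined neighbours to the left of the boundary.\<close>

lemma edge_sign_eq:
  assumes "\<forall>B\<in>set P. B \<noteq> []" "k < length P"
  shows "edge_sign P k = (-1) ^ (length (concat (take (Suc k) P)) + Suc k)"
proof -
  define pos where "pos j = length (concat (take j P))" for j
  have step: "pos j < pos (Suc j)" if "j < length P" for j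
    using that assms(1) by (simp add: pos_def take_Suc_conv_app_nth)
  have mono: "pos i < pos j" if "i < j" "j \<le> length P" for i j
    using that
  proof (induction j)
    case (Suc j)
    then show ?case
      using step[of j] by (cases "i = j") auto
  qed simp
  have le_iff: "pos i \<le> pos j \<longleftrightarrow> i \<le> j" "pos i < pos j \<longleftrightarrow> i < j" if "i \<le> length P" "j \<le> length P" for i j
    using mono[of i j] mono[of j i] that by (cases i j rule: linorder_cases; simp)+
  have pos0: "pos 0 = 0"
    by (simp add: pos_def)
  have total: "length (concat P) = pos (length P)"
    by (simp add: pos_def)
  have "{j \<in> joined P. j < pos (Suc k)} = {1..<pos (Suc k)} - pos ` {1..k}"
  proof (rule Set.set_eqI, rule iffI)
    fix j assume "j \<in> {j \<in> joined P. j < pos (Suc k)}"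
    then show "j \<in> {1..<pos (Suc k)} - pos ` {1..k}"
      using assms(2) by (auto simp: joined_def pos_def)
  next
    fix j assume j: "j \<in> {1..<pos (Suc k)} - pos ` {1..k}"
    have "j \<noteq> pos i" if "i \<le> length P" for i
    proof
      assume i: "j = pos i"
      then have "0 < i" "i < Suc k"
        using j le_iff(2)[of i "Suc k"] that assms(2) pos0 by (auto intro: gr0I)
      then show False
        using j i by auto
    qed
    moreover have "pos (Suc k) \<le> pos (length P)"
      using le_iff(1)[of "Suc k" "length P"] assms(2) by simp
    ultimately have "j \<in> {1..<pos (length P)} - {pos i |i. i \<le> length P}" "j < pos (Suc k)"
      using j by auto
    then show "j \<in> {j \<in> joined P. j < pos (Suc k)}"
      by (simp add: joined_def total flip: pos_def)
  qed
  moreover have "pos ` {1..k} \<subseteq> {1..<pos (Suc k)}"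
  proof (rule image_subsetI)
    fix i assume "i \<in> {1..k}"
    then show "pos i \<in> {1..<pos (Suc k)}"
      using le_iff(2)[of i "Suc k"] le_iff(2)[of 0 i] assms(2) pos0 by simp
  qed
  moreover have "inj_on pos {1..k}"
  proof (rule inj_onI)
    fix i j assume "i \<in> {1..k}" "j \<in> {1..k}" "pos i = pos j"
    then show "i = j"
      using le_iff(1)[of i j] le_iff(1)[of j i] assms(2) by simp
  qed
  ultimately have "card {j \<in> joined P. j < pos (Suc k)} = pos (Suc k) - 1 - k"
    by (simp add: card_Diff_subset card_image)
  moreover have "Suc j \<le> pos (Suc j)" if "j < length P" for j
    using that
  proof (induction j)
    case 0
    then show ?case
      using step[of 0] by simp
  next
    case (Suc j)
    then show ?case
      using step[of "Suc j"] by simp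
  qed
  then have "pos (Suc k) + Suc k = (pos (Suc k) - 1 - k) + 2 * Suc k"
    using assms(2) by fastforce
  then have "(-1 :: kk) ^ (pos (Suc k) + Suc k) = (-1) ^ (pos (Suc k) - 1 - k)"
    by (simp only: power_add power_mult) simp
  ultimately show ?thesis
    unfolding edge_sign_def pos_def by simp
qed

lemma edge_sign_eq_sign_at:
  assumes "ok m n L" "k < length L"
  shows "edge_sign (map fst L) k = sign_at L k"
proof -
  have "\<forall>B\<in>set (map fst L). B \<noteq> []"
    using assms(1) block_nonempty by (auto simp: ok_def)
  then show ?thesis
    using edge_sign_eq[of "map fst L" k] assms(2) by (simp add: sign_at_def dots_upto_def take_map)
qed

text \<open>The differential in coordinates.\<close>

lemma lookup_differential:
  assumes "x \<in> carrier (C m n i)" "int (m + n) - int N = i"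
  shows "Poly_Mapping.lookup (Poly_Mapping.lookup (differential x) Q) u =
    (\<Sum>L\<in>basis_of_length m n N. coord x L * (if length Q = length u then entry L (zip Q u) else 0))"
proof -
  let ?l = Poly_Mapping.lookup and ?k = Poly_Mapping.keys
  define e where "e L = (if length Q = length u then entry L (zip Q u) else 0)" for L
  have e_eq: "e L = (\<Sum>k\<in>merges L. if map fst (merge_at L k) = Q \<and> map snd (merge_at L k) = u
    then scalar_at L k else 0)" for L
    unfolding map_fst_snd_eq_iff by (auto simp: e_def entry_def intro!: sum.cong sum.neutral)
  have nz: "length P = length w" "ok m n (zip P w)" "length P = N" if "?l (?l x P) w \<noteq> 0" for P w
  proof -
    have "length P = length w \<and> ok m n (zip P w) \<and> int (m + n) - int (length P) = i"
      using assms(1) that unfolding carrier_C_iff by blast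
    then show "length P = length w" "ok m n (zip P w)" "length P = N"
      using assms(2) by linarith+
  qed
  have inner: "(\<Sum>k\<in>edges_from P. ?l (?l (Poly_Mapping.single (merge P k) (scale (edge_sign P k) (edge_map P k (?l x P)))) Q) u) =
    (\<Sum>w\<in>?k (?l x P). ?l (?l x P) w * e (zip P w))" if "P \<in> ?k x" for P
  proof -
    have "?l (?l (Poly_Mapping.single (merge P k) (scale (edge_sign P k) (edge_map P k (?l x P)))) Q) u =
      (\<Sum>w\<in>?k (?l x P). ?l (?l x P) w *
        (if merge P k = Q then edge_sign P k * ?l (edge_map P k (basis_vec w)) u else 0))" for k
    proof (cases "merge P k = Q")
      case True
      have "?l (edge_map P k (?l x P)) u = (\<Sum>w\<in>?k (?l x P). ?l (?l x P) w * ?l (edge_map P k (basis_vec w)) u)"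
        unfolding edge_map_def lin_ext_def[of _ "?l x P"] lookup_sum by simp
      then show ?thesis
        using True by (simp add: sum_distrib_left mult_ac)
    qed (simp add: lookup_single)
    then have "(\<Sum>k\<in>edges_from P. ?l (?l (Poly_Mapping.single (merge P k) (scale (edge_sign P k) (edge_map P k (?l x P)))) Q) u) =
      (\<Sum>w\<in>?k (?l x P). \<Sum>k\<in>edges_from P. ?l (?l x P) w *
        (if merge P k = Q then edge_sign P k * ?l (edge_map P k (basis_vec w)) u else 0))"
      by (simp only:) (rule sum.swap)
    also have "\<dots> = (\<Sum>w\<in>?k (?l x P). ?l (?l x P) w * e (zip P w))"
    proof (rule sum.cong)
      fix w assume "w \<in> ?k (?l x P)"
      then have w: "length P = length w" "ok m n (zip P w)"
        using nz by (auto simp: in_keys_iff)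
      let ?L = "zip P w"
      have L: "map fst ?L = P" "map snd ?L = w"
        using w(1) by simp_all
      have "(if merge P k = Q then edge_sign P k * ?l (edge_map P k (basis_vec w)) u else 0) =
        (if map fst (merge_at ?L k) = Q \<and> map snd (merge_at ?L k) = u then sign_at ?L k * coeff_at ?L k else 0)"
        if "k \<in> merges ?L" for k
      proof -
        have "Suc k < length ?L"
          using that by (simp add: merges_def)
        then show ?thesis
          using edge_map_basis[OF w(2) that] edge_sign_eq_sign_at[OF w(2), of k] map_fst_merge_at[of k ?L]
          unfolding L by (auto simp: lookup_single when_def)
      qed
      then show "(\<Sum>k\<in>edges_from P. ?l (?l x P) w *
          (if merge P k = Q then edge_sign P k * ?l (edge_map P k (basis_vec w)) u else 0)) =
        ?l (?l x P) w * e ?L"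
        unfolding e_eq sum_distrib_left using edges_from_eq_merges[OF w(2)] unfolding L
        by (intro sum.cong) auto
    qed simp
    finally show ?thesis .
  qed
  define S where "S = (SIGMA P:?k x. ?k (?l x P))"
  define T where "T = {L \<in> basis_of_length m n N. coord x L \<noteq> 0}"
  have "?l (?l (differential x) Q) u = (\<Sum>P\<in>?k x. \<Sum>k\<in>edges_from P.
    ?l (?l (Poly_Mapping.single (merge P k) (scale (edge_sign P k) (edge_map P k (?l x P)))) Q) u)"
    unfolding differential_def lookup_sum ..
  also have "\<dots> = (\<Sum>P\<in>?k x. \<Sum>w\<in>?k (?l x P). ?l (?l x P) w * e (zip P w))"
    using inner by (intro sum.cong) auto
  also have "\<dots> = (\<Sum>(P, w)\<in>S. ?l (?l x P) w * e (zip P w))"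
    unfolding S_def by (rule sum.Sigma) auto
  also have "\<dots> = (\<Sum>L\<in>T. coord x L * e L)"
  proof (rule sum.reindex_bij_witness[where i = "\<lambda>L. (map fst L, map snd L)" and j = "\<lambda>(P, w). zip P w"])
    fix y assume "y \<in> S"
    then obtain P w where y: "y = (P, w)" "?l (?l x P) w \<noteq> 0"
      by (auto simp: S_def in_keys_iff)
    note w = nz[OF y(2)]
    show "(map fst (case y of (P, w) \<Rightarrow> zip P w), map snd (case y of (P, w) \<Rightarrow> zip P w)) = y"
      using w by (simp add: y(1))
    show "(case y of (P, w) \<Rightarrow> zip P w) \<in> T"
      using w y by (auto simp: T_def basis_of_length_def coord_def)
    show "coord x (case y of (P, w) \<Rightarrow> zip P w) * e (case y of (P, w) \<Rightarrow> zip P w) =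
      (case y of (P, w) \<Rightarrow> ?l (?l x P) w * e (zip P w))"
      using w by (simp add: y(1) coord_def)
  next
    fix L assume "L \<in> T"
    then have "?l (?l x (map fst L)) (map snd L) \<noteq> 0"
      by (simp add: T_def coord_def)
    then show "(map fst L, map snd L) \<in> S"
      by (auto simp: S_def in_keys_iff)
    show "(case (map fst L, map snd L) of (P, w) \<Rightarrow> zip P w) = L"
      by (simp add: zip_map_fst_snd)
  qed
  also have "\<dots> = (\<Sum>L\<in>basis_of_length m n N. coord x L * e L)"
    using finite_basis_of_length by (intro sum.mono_neutral_left) (auto simp: T_def)
  finally show ?thesis
    unfolding e_def .
qed

lemma length_le_length_concat: "\<forall>B\<in>set P. B \<noteq> [] \<Longrightarrow> length P \<le> length (concat P)"
proof (induction P)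
  case (Cons B P)
  then show ?case
    by (cases B) auto
qed simp

lemma carrier_C_degree:
  assumes "x \<in> carrier (C m n i)" "x \<noteq> 0"
  obtains N where "int (m + n) - int N = i" "N \<le> m + n" "m + n = 0 \<or> 0 < N"
proof -
  obtain P where "Poly_Mapping.lookup x P \<noteq> 0"
    using assms(2) by (metis lookup_zero poly_mapping_eqI)
  then obtain w where "Poly_Mapping.lookup (Poly_Mapping.lookup x P) w \<noteq> 0"
    by (metis lookup_zero poly_mapping_eqI)
  then have *: "length P = length w" "ok m n (zip P w)" "int (m + n) - int (length P) = i"
    using assms(1) carrier_C_iff by blast+
  have c: "concat P = dots m n" "\<forall>B\<in>set P. B \<noteq> []"
    using ok_zip_iff[OF *(1), of m n] *(2) block_if_compatible[of m n P] block_nonempty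
    by (auto simp: compatible_def)
  have "length P \<le> length (concat P)"
    by (rule length_le_length_concat[OF c(2)])
  moreover have "length (concat P) = m + n"
    by (simp add: c(1) dots_def)
  moreover have "m + n = 0 \<or> 0 < length P"
    using calculation by (cases P) auto
  ultimately show ?thesis
    using that[of "length P"] *(3) by simp
qed

lemma C_zero: "0 \<in> carrier (C m n i)"
  by (simp add: carrier_C_iff)

lemma C_add: "x \<in> carrier (C m n i) \<Longrightarrow> y \<in> carrier (C m n i) \<Longrightarrow> x + y \<in> carrier (C m n i)"
  unfolding carrier_C_iff lookup_add by (metis add.right_neutral)

lemma C_uminus: "x \<in> carrier (C m n i) \<Longrightarrow> - x \<in> carrier (C m n i)"
  unfolding carrier_C_iff by (metis lookup_uminus neg_equal_0_iff_equal)

lemma differential_0: "differential 0 = 0"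
  by (simp add: differential_def)

lemma lookup_lookup_eqI:
  "(\<And>P w. Poly_Mapping.lookup (Poly_Mapping.lookup x P) w = Poly_Mapping.lookup (Poly_Mapping.lookup y P) w) \<Longrightarrow> x = y"
  by (intro poly_mapping_eqI)

lemma carrier_C_nat_degree:
  assumes "x \<in> carrier (C m n i)" "x \<noteq> 0"
  shows "int (m + n) - int (nat (int (m + n) - i)) = i"
  using carrier_C_degree[OF assms] by force

lemma differential_add:
  assumes "x \<in> carrier (C m n i)" "y \<in> carrier (C m n i)"
  shows "differential (x + y) = differential x + differential y"
proof (cases "x = 0 \<or> y = 0")
  case False
  then have N: "int (m + n) - int (nat (int (m + n) - i)) = i"
    using carrier_C_nat_degree assms(1) by blast
  show ?thesis
    by (rule lookup_lookup_eqI)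
      (simp add: lookup_differential[OF _ N] assms C_add lookup_add coord_def distrib_right sum.distrib)
qed (auto simp: differential_0)

lemma differential_uminus:
  assumes "x \<in> carrier (C m n i)"
  shows "differential (- x) = - differential x"
proof -
  have "differential x + differential (- x) = 0"
    using differential_add[OF assms C_uminus[OF assms]] by (simp add: differential_0)
  then show ?thesis
    by (simp add: add_eq_0_iff)
qed

lemma differential_carrier:
  assumes "x \<in> carrier (C m n (i - 1))"
  shows "differential x \<in> carrier (C m n i)"
proof (cases "x = 0")
  case False
  then obtain N where N: "int (m + n) - int N = i - 1"
    using carrier_C_degree[OF assms] by blast
  show ?thesis
    unfolding carrier_C_iff
  proof (intro allI impI)
    fix Q u assume "Poly_Mapping.lookup (Poly_Mapping.lookup (differential x) Q) u \<noteq> 0"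
    then obtain L where L: "L \<in> basis_of_length m n N" "length Q = length u" "entry L (zip Q u) \<noteq> 0"
      unfolding lookup_differential[OF assms N]
      by (rule sum.not_neutral_contains_not_neutral) (auto split: if_splits)
    then have "ok m n (zip Q u)" "Suc (length (zip Q u)) = N"
      using entry_nonzero_props[of m n L "zip Q u"] by (auto simp: basis_of_length_def)
    then show "length Q = length u \<and> ok m n (zip Q u) \<and> int (m + n) - int (length Q) = i"
      using L(2) N by auto
  qed
qed (simp add: differential_0 C_zero)

lemma differential_differential:
  assumes "x \<in> carrier (C m n (i - 1))"
  shows "differential (differential x) = 0"
proof (cases "differential x = 0")
  case False
  then have "x \<noteq> 0"
    by (auto simp: differential_0)
  then obtain N where N: "int (m + n) - int N = i - 1"
    using carrier_C_degree[OF assms] by blast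
  obtain N' where N': "int (m + n) - int N' = i"
    using carrier_C_degree[OF differential_carrier[OF assms] False] by blast
  have NN': "N = Suc N'"
    using N N' by simp
  show ?thesis
  proof (rule lookup_lookup_eqI)
    fix Q u
    define c where "c b = (if length Q = length u then entry b (zip Q u) else 0)" for b
    have "(\<Sum>b\<in>basis_of_length m n N'. entry L b * c b) = 0" if "L \<in> basis_of_length m n N" for L
      using that entry_entry[of m n L N' "zip Q u"]
      by (cases "length Q = length u") (simp_all add: basis_of_length_def c_def NN')
    then have "(\<Sum>L\<in>basis_of_length m n N. coord x L * (\<Sum>b\<in>basis_of_length m n N'. entry L b * c b)) = 0"
      by simp
    also have "(\<Sum>L\<in>basis_of_length m n N. coord x L * (\<Sum>b\<in>basis_of_length m n N'. entry L b * c b)) =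
      (\<Sum>b\<in>basis_of_length m n N'. (\<Sum>L\<in>basis_of_length m n N. coord x L * entry L b) * c b)"
      unfolding sum_distrib_left sum_distrib_right by (subst sum.swap) (simp add: mult.assoc)
    also have "\<dots> = (\<Sum>b\<in>basis_of_length m n N'. coord (differential x) b * c b)"
      unfolding coord_def[of "differential x"] lookup_differential[OF assms N] by (simp add: zip_map_fst_snd)
    also have "\<dots> = Poly_Mapping.lookup (Poly_Mapping.lookup (differential (differential x)) Q) u"
      unfolding lookup_differential[OF differential_carrier[OF assms] N'] c_def ..
    finally show "Poly_Mapping.lookup (Poly_Mapping.lookup (differential (differential x)) Q) u =
      Poly_Mapping.lookup (Poly_Mapping.lookup 0 Q) u"
      by simp
  qed
qed (simp add: differential_0)

lemma cocycle_is_coboundary: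
  assumes "i \<noteq> 0" "z \<in> carrier (C m n i)" "differential z = 0"
  shows "z \<in> differential ` carrier (C m n (i - 1))"
proof (cases "z = 0")
  case True
  then show ?thesis
    using differential_0 C_zero by force
next
  case False
  obtain N where N: "int (m + n) - int N = i" "N \<le> m + n" "m + n = 0 \<or> 0 < N"
    using carrier_C_degree[OF assms(2) False] .
  have N': "Suc N \<le> m + n" "0 < N" "int (m + n) - int (Suc N) = i - 1"
    using N assms(1) by auto
  have "\<exists>y. \<forall>b\<in>basis_of_length m n N. coord z b = (\<Sum>a\<in>basis_of_length m n (Suc N). y a * entry a b)"
  proof (rule entry_exact[OF N'(1) _ N'(2)])
    fix c
    have "Poly_Mapping.lookup (Poly_Mapping.lookup (differential z) (map fst c)) (map snd c) = 0"
      by (simp add: assms(3))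
    then show "(\<Sum>b\<in>basis_of_length m n N. coord z b * entry b c) = 0"
      unfolding lookup_differential[OF assms(2) N(1)] by (simp add: zip_map_fst_snd)
  qed
  then obtain y where y: "\<And>b. b \<in> basis_of_length m n N \<Longrightarrow> coord z b = (\<Sum>a\<in>basis_of_length m n (Suc N). y a * entry a b)"
    by blast
  define Y where "Y = (\<Sum>L\<in>basis_of_length m n (Suc N). Poly_Mapping.single (map fst L) (Poly_Mapping.single (map snd L) (y L)))"
  have lookup_Y: "Poly_Mapping.lookup (Poly_Mapping.lookup Y P) w =
    (if length P = length w \<and> zip P w \<in> basis_of_length m n (Suc N) then y (zip P w) else 0)" for P w
  proof -
    have "Poly_Mapping.lookup (Poly_Mapping.lookup Y P) w =
      (\<Sum>L\<in>basis_of_length m n (Suc N). if map fst L = P \<and> map snd L = w then y L else 0)"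
      unfolding Y_def lookup_sum by (intro sum.cong) (auto simp: lookup_single when_def)
    also have "\<dots> = (\<Sum>L\<in>basis_of_length m n (Suc N). if L = zip P w then if length P = length w then y L else 0 else 0)"
      unfolding map_fst_snd_eq_iff by (intro sum.cong) auto
    also have "\<dots> = (if length P = length w \<and> zip P w \<in> basis_of_length m n (Suc N) then y (zip P w) else 0)"
      using finite_basis_of_length by simp
    finally show ?thesis .
  qed
  have Y: "Y \<in> carrier (C m n (i - 1))"
    unfolding carrier_C_iff lookup_Y using N'(3) by (auto simp: basis_of_length_def split: if_splits)
  have coord_Y: "coord Y L = y L" if "L \<in> basis_of_length m n (Suc N)" for L
    using that by (simp add: coord_def lookup_Y zip_map_fst_snd)
  have "differential Y = z"
  proof (rule lookup_lookup_eqI)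
    fix Q u
    have eq: "Poly_Mapping.lookup (Poly_Mapping.lookup (differential Y) Q) u =
      (\<Sum>L\<in>basis_of_length m n (Suc N). y L * (if length Q = length u then entry L (zip Q u) else 0))"
      unfolding lookup_differential[OF Y N'(3)] by (simp add: coord_Y)
    show "Poly_Mapping.lookup (Poly_Mapping.lookup (differential Y) Q) u = Poly_Mapping.lookup (Poly_Mapping.lookup z Q) u"
    proof (cases "length Q = length u \<and> zip Q u \<in> basis_of_length m n N")
      case True
      then show ?thesis
        unfolding eq using y[of "zip Q u"] by (simp add: coord_def)
    next
      case False
      have "Poly_Mapping.lookup (Poly_Mapping.lookup z Q) u = 0"
        using assms(2) False N(1) unfolding carrier_C_iff by (force simp: basis_of_length_def)
      moreover have "entry L (zip Q u) = 0" if "L \<in> basis_of_length m n (Suc N)" "length Q = length u" for L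
        using that False entry_nonzero_props[of m n L "zip Q u"] by (auto simp: basis_of_length_def)
      ultimately show ?thesis
        unfolding eq by (auto intro!: sum.neutral)
    qed
  qed
  then show ?thesis
    using Y by blast
qed


section \<open>Transport along isomorphisms\<close>

lemma is_V_transport:
  assumes M: "is_V m n M" and bij: "bij_betw f (carrier M) (carrier N)"
    and zero: "f \<zero>\<^bsub>M\<^esub> = \<zero>\<^bsub>N\<^esub>"
    and add: "\<And>x y. x \<in> carrier M \<Longrightarrow> y \<in> carrier M \<Longrightarrow> f (x \<oplus>\<^bsub>M\<^esub> y) = f x \<oplus>\<^bsub>N\<^esub> f y"
    and smult: "\<And>c x. x \<in> carrier M \<Longrightarrow> f (c \<odot>\<^bsub>M\<^esub> x) = c \<odot>\<^bsub>N\<^esub> f x"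
    and act: "\<And>g x. x \<in> carrier M \<Longrightarrow> f (act M g x) = act N g (f x)"
  shows "is_V m n N"
proof -
  have simple: "simple_uq_module M" and fd: "finite_dimensional M"
    using M by (simp_all add: is_V_def)
  interpret M: uq_sl3_module M
    using simple by (simp add: simple_uq_module_def)
  have surj: "\<exists>x\<in>carrier M. y = f x" if "y \<in> carrier N" for y
    using bij that by (auto simp: bij_betw_def)
  have cl: "f x \<in> carrier N" if "x \<in> carrier M" for x
    using bij that by (auto simp: bij_betw_def)
  have inj: "f x = f y \<longleftrightarrow> x = y" if "x \<in> carrier M" "y \<in> carrier M" for x y
    using bij that by (auto simp: bij_betw_def inj_on_def)
  have cl_zero: "\<zero>\<^bsub>N\<^esub> \<in> carrier N"
    using cl[OF M.M.zero_closed] by (simp add: zero)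
  note pull = add[symmetric] smult[symmetric] act[symmetric] zero[symmetric]
  have ab: "abelian_group N"
  proof (rule abelian_groupI)
    fix x y assume "x \<in> carrier N" "y \<in> carrier N"
    then obtain x' y' where [simp]: "x' \<in> carrier M" "y' \<in> carrier M" "x = f x'" "y = f y'"
      using surj by blast
    show "x \<oplus>\<^bsub>N\<^esub> y \<in> carrier N"
      by (simp add: pull cl)
    show "x \<oplus>\<^bsub>N\<^esub> y = y \<oplus>\<^bsub>N\<^esub> x"
      by (simp add: pull M.M.a_comm)
    fix z assume "z \<in> carrier N"
    then obtain z' where [simp]: "z' \<in> carrier M" "z = f z'"
      using surj by blast
    show "x \<oplus>\<^bsub>N\<^esub> y \<oplus>\<^bsub>N\<^esub> z = x \<oplus>\<^bsub>N\<^esub> (y \<oplus>\<^bsub>N\<^esub> z)"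
      by (simp add: pull M.M.a_assoc)
  next
    fix x assume "x \<in> carrier N"
    then obtain x' where [simp]: "x' \<in> carrier M" "x = f x'"
      using surj by blast
    show "\<zero>\<^bsub>N\<^esub> \<oplus>\<^bsub>N\<^esub> x = x"
      by (simp add: pull)
    show "\<exists>y\<in>carrier N. y \<oplus>\<^bsub>N\<^esub> x = \<zero>\<^bsub>N\<^esub>"
      by (rule bexI[of _ "f (\<ominus>\<^bsub>M\<^esub> x')"]) (simp_all add: pull cl M.M.l_neg)
  qed (rule cl_zero)
  interpret N: abelian_group N
    by (rule ab)
  have minus: "f x \<ominus>\<^bsub>N\<^esub> f y = f (x \<ominus>\<^bsub>M\<^esub> y)" if "x \<in> carrier M" "y \<in> carrier M" for x y
  proof -
    have "\<ominus>\<^bsub>N\<^esub> f y = f (\<ominus>\<^bsub>M\<^esub> y)"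
      by (rule N.minus_equality) (use that in \<open>simp_all add: pull cl M.M.l_neg\<close>)
    then show ?thesis
      using that by (simp add: a_minus_def pull)
  qed
  have "module kk_ring N"
  proof (rule moduleI[OF cring_from_type_algebra ab])
    fix c d x assume "x \<in> carrier N"
    then obtain x' where [simp]: "x' \<in> carrier M" "x = f x'"
      using surj by blast
    show "c \<odot>\<^bsub>N\<^esub> x \<in> carrier N"
      by (simp add: pull cl)
    show "(c \<oplus>\<^bsub>kk_ring\<^esub> d) \<odot>\<^bsub>N\<^esub> x = c \<odot>\<^bsub>N\<^esub> x \<oplus>\<^bsub>N\<^esub> d \<odot>\<^bsub>N\<^esub> x"
      "(c \<otimes>\<^bsub>kk_ring\<^esub> d) \<odot>\<^bsub>N\<^esub> x = c \<odot>\<^bsub>N\<^esub> (d \<odot>\<^bsub>N\<^esub> x)"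
      by (simp_all add: pull M.smult_add_left)
    show "\<one>\<^bsub>kk_ring\<^esub> \<odot>\<^bsub>N\<^esub> x = x"
      by (simp add: pull)
    fix y assume "y \<in> carrier N"
    then obtain y' where [simp]: "y' \<in> carrier M" "y = f y'"
      using surj by blast
    show "c \<odot>\<^bsub>N\<^esub> (x \<oplus>\<^bsub>N\<^esub> y) = c \<odot>\<^bsub>N\<^esub> x \<oplus>\<^bsub>N\<^esub> c \<odot>\<^bsub>N\<^esub> y"
      by (simp add: pull M.smult_add_right)
  qed
  moreover have "uq_sl3_module_axioms N"
  proof
    fix v w assume "v \<in> carrier N" "w \<in> carrier N"
    then obtain x y where [simp]: "x \<in> carrier M" "v = f x" "y \<in> carrier M" "w = f y"
      using surj by blast
    show "act N g (v \<oplus>\<^bsub>N\<^esub> w) = act N g v \<oplus>\<^bsub>N\<^esub> act N g w" for g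
      by (simp add: pull M.act_add M.act_closed)
  next
    fix v assume "v \<in> carrier N"
    then obtain x where [simp]: "x \<in> carrier M" "v = f x"
      using surj by blast
    note [simp] = M.act_closed
    show "act N g v \<in> carrier N" for g
      by (simp add: pull cl)
    show "act N g (c \<odot>\<^bsub>N\<^esub> v) = c \<odot>\<^bsub>N\<^esub> act N g v" for g c
      by (simp add: pull M.act_smult)
    show "act N (K i) (act N (Kinv i) v) = v" "act N (Kinv i) (act N (K i) v) = v" for i
      by (simp_all add: pull M.K_Kinv M.Kinv_K)
    show "act N (K i) (act N (K j) v) = act N (K j) (act N (K i) v)" for i j
      using M.K_K[of x i j] by (simp add: pull)
    show "act N (K i) (act N (E i) v) = q\<^sup>2 \<odot>\<^bsub>N\<^esub> act N (E i) (act N (K i) v)"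
      "act N (K i) (act N (F i) v) = inverse (q\<^sup>2) \<odot>\<^bsub>N\<^esub> act N (F i) (act N (K i) v)" for i
      by (simp_all add: pull M.K_E_same M.K_F_same)
    show "act N (K i) (act N (E j) v) = inverse q \<odot>\<^bsub>N\<^esub> act N (E j) (act N (K i) v)"
      "act N (K i) (act N (F j) v) = q \<odot>\<^bsub>N\<^esub> act N (F j) (act N (K i) v)"
      "act N (E i) (act N (F j) v) = act N (F j) (act N (E i) v)" if "i \<noteq> j" for i j
      using that by (simp_all add: pull M.K_E_diff M.K_F_diff M.E_F_diff)
    show "(q - inverse q) \<odot>\<^bsub>N\<^esub> (act N (E i) (act N (F i) v) \<ominus>\<^bsub>N\<^esub> act N (F i) (act N (E i) v)) =
      act N (K i) v \<ominus>\<^bsub>N\<^esub> act N (Kinv i) v" for i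
      using M.E_F_same[of x i] by (simp add: pull minus)
    show "act N (E i) (act N (E i) (act N (E j) v)) \<ominus>\<^bsub>N\<^esub>
        (q + inverse q) \<odot>\<^bsub>N\<^esub> act N (E i) (act N (E j) (act N (E i) v)) \<oplus>\<^bsub>N\<^esub>
        act N (E j) (act N (E i) (act N (E i) v)) = \<zero>\<^bsub>N\<^esub>"
      "act N (F i) (act N (F i) (act N (F j) v)) \<ominus>\<^bsub>N\<^esub>
        (q + inverse q) \<odot>\<^bsub>N\<^esub> act N (F i) (act N (F j) (act N (F i) v)) \<oplus>\<^bsub>N\<^esub>
        act N (F j) (act N (F i) (act N (F i) v)) = \<zero>\<^bsub>N\<^esub>" if "i \<noteq> j" for i j
      using M.E_Serre[of x i j] M.F_Serre[of x i j] that by (simp_all add: pull minus)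
  qed
  ultimately have N_module: "uq_sl3_module N"
    by (simp add: uq_sl3_module_def)
  interpret N': uq_sl3_module N
    by (rule N_module)
  have "simple_uq_module N"
    unfolding simple_uq_module_def
  proof (intro conjI allI impI)
    show "uq_sl3_module N"
      by (rule N_module)
    have "carrier M \<noteq> {\<zero>\<^bsub>M\<^esub>}"
      using simple by (simp add: simple_uq_module_def)
    then obtain x where "x \<in> carrier M" "x \<noteq> \<zero>\<^bsub>M\<^esub>"
      using M.M.zero_closed by blast
    then show "carrier N \<noteq> {\<zero>\<^bsub>N\<^esub>}"
      using cl[of x] inj[of x "\<zero>\<^bsub>M\<^esub>"] zero by auto
  next
    fix H assume H: "uq_submodule H N"
    then interpret H: submodule H kk_ring N
      by (simp add: uq_submodule_def)
    have Hact: "act N g y \<in> H" if "y \<in> H" for g y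
      using H that by (simp add: uq_submodule_def)
    define H' where "H' = {x \<in> carrier M. f x \<in> H}"
    have "uq_submodule H' M"
    proof (rule M.uq_submoduleI)
      show "\<zero>\<^bsub>M\<^esub> \<in> H'"
        using H.one_closed by (simp add: H'_def zero)
      show "x \<oplus>\<^bsub>M\<^esub> y \<in> H'" if "x \<in> H'" "y \<in> H'" for x y
        using that H.m_closed[of "f x" "f y"] by (simp add: H'_def add)
      show "c \<odot>\<^bsub>M\<^esub> x \<in> H'" if "x \<in> H'" for c x
        using that H.smult_closed[of c "f x"] by (simp add: H'_def smult)
      show "act M g x \<in> H'" if "x \<in> H'" for g x
        using that Hact[of "f x" g] by (simp add: H'_def act M.act_closed)
    qed (auto simp: H'_def)
    then have "H' = {\<zero>\<^bsub>M\<^esub>} \<or> H' = carrier M"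
      using simple by (simp add: simple_uq_module_def)
    moreover have "H = f ` H'"
      using H.subset surj by (auto simp: H'_def)
    moreover have "f ` carrier M = carrier N"
      using bij by (simp add: bij_betw_def)
    ultimately show "H = {\<zero>\<^bsub>N\<^esub>} \<or> H = carrier N"
      by (auto simp: zero)
  qed
  moreover have "finite_dimensional N"
  proof -
    obtain A where A: "finite A" "A \<subseteq> carrier M" "\<And>v. v \<in> carrier M \<Longrightarrow> \<exists>c. v = (\<Oplus>\<^bsub>M\<^esub>a\<in>A. c a \<odot>\<^bsub>M\<^esub> a)"
      using fd unfolding finite_dimensional_def by blast
    have fsum: "f (\<Oplus>\<^bsub>M\<^esub>a\<in>A. h a) = (\<Oplus>\<^bsub>N\<^esub>a\<in>A. f (h a))" if "finite A" "h \<in> A \<rightarrow> carrier M" for A :: "'a set" and h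
      using that
    proof (induction A rule: finite_induct)
      case (insert a A)
      then have "h a \<in> carrier M" "h \<in> A \<rightarrow> carrier M" "f (h a) \<in> carrier N" "(\<lambda>a. f (h a)) \<in> A \<rightarrow> carrier N"
        using cl by auto
      then show ?case
        using insert by (simp add: add)
    qed (simp add: zero)
    have inj_A: "inj_on f A"
      using A(2) inj by (auto simp: inj_on_def subset_iff)
    have "\<exists>c. v = (\<Oplus>\<^bsub>N\<^esub>a\<in>f ` A. c a \<odot>\<^bsub>N\<^esub> a)" if v: "v \<in> carrier N" for v
    proof -
      obtain x c where x: "x \<in> carrier M" "v = f x" "x = (\<Oplus>\<^bsub>M\<^esub>a\<in>A. c a \<odot>\<^bsub>M\<^esub> a)"
        using surj[OF v] A(3) by blast
      have "(\<lambda>a. c a \<odot>\<^bsub>M\<^esub> a) \<in> A \<rightarrow> carrier M"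
        using A(2) by (auto intro: M.smult_closed')
      from fsum[OF A(1) this] have "v = (\<Oplus>\<^bsub>N\<^esub>a\<in>A. f (c a \<odot>\<^bsub>M\<^esub> a))"
        unfolding x(2) x(3)[symmetric] .
      also have "\<dots> = (\<Oplus>\<^bsub>N\<^esub>a\<in>A. c (the_inv_into A f (f a)) \<odot>\<^bsub>N\<^esub> f a)"
        using A(2) cl by (intro N.finsum_cong') (auto simp: smult the_inv_into_f_f[OF inj_A] N'.smult_closed')
      also have "\<dots> = (\<Oplus>\<^bsub>N\<^esub>a\<in>f ` A. c (the_inv_into A f a) \<odot>\<^bsub>N\<^esub> a)"
        using A(2) cl by (intro N.finsum_reindex[symmetric]) (auto simp: inj_A)
      finally show ?thesis
        by (intro exI[of _ "\<lambda>a. c (the_inv_into A f a)"])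
    qed
    then show ?thesis
      unfolding finite_dimensional_def using A(1,2) cl by (intro exI[of _ "f ` A"]) auto
  qed
  moreover obtain v where v: "v \<in> carrier M" "v \<noteq> \<zero>\<^bsub>M\<^esub>" "act M (E N1) v = \<zero>\<^bsub>M\<^esub>" "act M (E N2) v = \<zero>\<^bsub>M\<^esub>"
    "act M (K N1) v = q ^ m \<odot>\<^bsub>M\<^esub> v" "act M (K N2) v = q ^ n \<odot>\<^bsub>M\<^esub> v"
    using M unfolding is_V_def by blast
  then have "f v \<in> carrier N" "f v \<noteq> \<zero>\<^bsub>N\<^esub>" "act N (E N1) (f v) = \<zero>\<^bsub>N\<^esub>" "act N (E N2) (f v) = \<zero>\<^bsub>N\<^esub>"
    "act N (K N1) (f v) = q ^ m \<odot>\<^bsub>N\<^esub> f v" "act N (K N2) (f v) = q ^ n \<odot>\<^bsub>N\<^esub> f v"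
    using cl inj[of v "\<zero>\<^bsub>M\<^esub>"] by (simp_all add: pull)
  ultimately show ?thesis
    unfolding is_V_def by blast
qed


section \<open>Degree zero\<close>

text \<open>The only partition of degree \<open>0\<close>.\<close>

definition singletons :: "nat \<Rightarrow> nat \<Rightarrow> cpart" where
  "singletons m n = map (\<lambda>s. [s]) (dots m n)"

lemma length_dots [simp]: "length (dots m n) = m + n"
  by (simp add: dots_def)

lemma nth_dots: "k < m + n \<Longrightarrow> dots m n ! k = (if k < m then Pos else Neg)"
  by (auto simp: dots_def nth_append)

lemma length_singletons [simp]: "length (singletons m n) = m + n"
  by (simp add: singletons_def)

lemma nth_singletons: "k < m + n \<Longrightarrow> singletons m n ! k = [dots m n ! k]"
  by (simp add: singletons_def)

lemma map_block_factor_singletons: "map block_factor (singletons m n) = factor_seq m n"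
  by (simp add: singletons_def dots_def factor_seq_def block_factor_def)

lemma concat_singletons: "concat (singletons m n) = dots m n"
  unfolding singletons_def by (induction "dots m n") auto

lemma compatible_singletons: "compatible m n (singletons m n)" "deg (singletons m n) = 0"
  by (auto simp: compatible_def deg_def concat_singletons, auto simp: singletons_def admissible_block_def)

lemma singletons_if_length:
  "\<forall>B\<in>set P. B \<noteq> [] \<Longrightarrow> length (concat P) = length P \<Longrightarrow> P = map (\<lambda>s. [s]) (concat P)"
proof (induction P)
  case (Cons B P)
  obtain s B' where B: "B = s # B'"
    using Cons.prems by (cases B) auto
  have "length P \<le> length (concat P)"
    using Cons.prems by (intro length_le_length_concat) simp
  moreover have "length B' + length (concat P) = length P"
    using Cons.prems by (simp add: B)
  ultimately have "length B' = 0" "length (concat P) = length P"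
    by linarith+
  then show ?case
    using Cons by (simp add: B)
qed simp

lemma carrier_C_0: "x \<in> carrier (C m n 0) \<longleftrightarrow>
  (\<exists>y. valid (factor_seq m n) y \<and> x = Poly_Mapping.single (singletons m n) y)"
proof
  assume x: "x \<in> carrier (C m n 0)"
  have key: "P = singletons m n" if "P \<in> Poly_Mapping.keys x" for P
  proof -
    have P: "compatible m n P" "deg P = 0"
      using x that by (auto simp: C_def)
    have "P = map (\<lambda>s. [s]) (concat P)"
      using P block_if_compatible[OF P(1)] block_nonempty by (intro singletons_if_length) (auto simp: deg_def)
    then show ?thesis
      using P(1) by (simp add: compatible_def singletons_def)
  qed
  have eq: "x = Poly_Mapping.single (singletons m n) (Poly_Mapping.lookup x (singletons m n))"
    by (rule poly_mapping_eqI) (use key in \<open>auto simp: lookup_single when_def in_keys_iff\<close>)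
  moreover have "valid (factor_seq m n) (Poly_Mapping.lookup x (singletons m n))"
  proof (cases "singletons m n \<in> Poly_Mapping.keys x")
    case True
    then have "Poly_Mapping.lookup x (singletons m n) \<in> carrier (C_tilde (singletons m n))"
      using x by (auto simp: C_def)
    then show ?thesis
      by (simp add: C_tilde_def map_block_factor_singletons)
  next
    case False
    then show ?thesis
      by (simp add: in_keys_iff valid_0)
  qed
  ultimately show "\<exists>y. valid (factor_seq m n) y \<and> x = Poly_Mapping.single (singletons m n) y"
    by blast
next
  assume "\<exists>y. valid (factor_seq m n) y \<and> x = Poly_Mapping.single (singletons m n) y"
  then show "x \<in> carrier (C m n 0)"
    by (auto simp: C_def C_tilde_def map_block_factor_singletons compatible_singletons split: if_splits)
qed

lemma merge_inj:
  assumes "merge (singletons m n) k = merge (singletons m n) l" "Suc k < m + n" "Suc l < m + n"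
  shows "k = l"
proof -
  have *: False if "merge (singletons m n) k = merge (singletons m n) l" "Suc k < m + n" "Suc l < m + n" "k < l" for k l
  proof -
    have "merge (singletons m n) k ! k = [dots m n ! k, dots m n ! Suc k]"
      using that(2) by (simp add: merge_def nth_append nth_singletons)
    moreover have "merge (singletons m n) l ! k = [dots m n ! k]"
      using that(3,4) by (simp add: merge_def nth_append nth_singletons)
    ultimately show False
      using that(1) by simp
  qed
  show ?thesis
    using *[OF assms] *[OF assms(1)[symmetric] assms(3,2)] by (metis linorder_neqE_nat)
qed

lemma edges_from_singletons: "edges_from (singletons m n) = {k. Suc k < m + n}"
  by (auto simp: edges_from_def nth_singletons admissible_block_def)

lemma differential_singletons_eq_0_iff:
  "differential (Poly_Mapping.single (singletons m n) y) = 0 \<longleftrightarrow>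
    (\<forall>k. Suc k < m + n \<longrightarrow> edge_map (singletons m n) k y = 0)"
proof (cases "y = 0")
  case True
  then show ?thesis
    by (simp add: differential_0 edge_map_def)
next
  case False
  let ?P = "singletons m n"
  have fin: "finite {k. Suc k < m + n}"
    by (rule finite_subset[of _ "{..<m + n}"]) auto
  have d: "differential (Poly_Mapping.single ?P y) =
    (\<Sum>k | Suc k < m + n. Poly_Mapping.single (merge ?P k) (scale (edge_sign ?P k) (edge_map ?P k y)))"
    using False by (simp add: differential_def edges_from_singletons)
  have "Poly_Mapping.lookup (differential (Poly_Mapping.single ?P y)) (merge ?P l) =
    scale (edge_sign ?P l) (edge_map ?P l y)" if "Suc l < m + n" for l
  proof -
    have "Poly_Mapping.lookup (differential (Poly_Mapping.single ?P y)) (merge ?P l) =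
      (\<Sum>k | Suc k < m + n. if k = l then scale (edge_sign ?P k) (edge_map ?P k y) else 0)"
      unfolding d lookup_sum using merge_inj that by (intro sum.cong) (auto simp: lookup_single when_def)
    then show ?thesis
      using that fin by simp
  qed
  then show ?thesis
    using d by (auto simp: edge_sign_def)
qed

lemma lookup_edge_map_singletons:
  assumes y: "valid (factor_seq m n) y" and k: "Suc k < m + n" and p: "length p = k"
  defines "s \<equiv> dots m n ! k" and "t \<equiv> dots m n ! Suc k"
  shows "Poly_Mapping.lookup (edge_map (singletons m n) k y) (p @ c # r) =
    (\<Sum>a\<in>{-1, 0, 1}. \<Sum>b\<in>{-1, 0, 1}. if a + b = c
      then merge_coeff [s] [t] a b * Poly_Mapping.lookup y (p @ a # b # r) else 0)"
proof -
  let ?l = Poly_Mapping.lookup and ?P = "singletons m n" and ?A = "{-1, 0, 1 :: int}"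
  have lab: "labels (block_factor [s']) = ?A" for s'
    by (cases s') (simp_all add: block_factor_def)
  have "s = Pos \<or> t = Neg"
    using k by (auto simp: s_def t_def nth_dots)
  then have st: "block [s]" "block [t]" "block ([s] @ [t])"
    by (cases s; cases t; simp add: block_def)+
  define cond where "cond w \<longleftrightarrow> take k w = p \<and> w ! k + w ! Suc k = c \<and> drop (Suc (Suc k)) w = r" for w
  define g where "g w = ?l y w * (if cond w then merge_coeff [s] [t] (w ! k) (w ! Suc k) else 0)" for w
  have word: "length w = m + n \<and> set w \<subseteq> ?A" if "w \<in> Poly_Mapping.keys y" for w
    using valid_factor_seq_word[OF y] that by (simp add: in_keys_iff)
  have "?l (edge_map ?P k (basis_vec w)) (p @ c # r) = (if cond w then merge_coeff [s] [t] (w ! k) (w ! Suc k) else 0)"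
    if "w \<in> Poly_Mapping.keys y" for w
  proof -
    have w: "length w = m + n" "w ! k \<in> ?A" "w ! Suc k \<in> ?A"
      using word[OF that] k nth_mem[of k w] nth_mem[of "Suc k" w] by (simp, force+)
    have "merge_map [s] [t] (w ! k) (w ! Suc k) =
      scale (merge_coeff [s] [t] (w ! k) (w ! Suc k)) (basis_vec (w ! k + w ! Suc k))"
      by (rule merge_map_eq) (use st w in \<open>simp_all only: lab\<close>)
    moreover have "?P ! k = [s]" "?P ! Suc k = [t]"
      using k by (simp_all add: nth_singletons s_def t_def)
    ultimately have "edge_map ?P k (basis_vec w) = scale (merge_coeff [s] [t] (w ! k) (w ! Suc k))
      (basis_vec (take k w @ [w ! k + w ! Suc k] @ drop (Suc (Suc k)) w))"
      unfolding edge_map_def lin_ext_basis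
      by (simp add: linear_map_scale[OF linear_map_lin_ext] del: scale_single)
    moreover have "take k w @ [w ! k + w ! Suc k] @ drop (Suc (Suc k)) w = p @ c # r \<longleftrightarrow> cond w"
      using p w(1) k by (simp add: cond_def)
    ultimately show ?thesis
      by (simp add: lookup_single when_def)
  qed
  then have "?l (edge_map ?P k y) (p @ c # r) = sum g (Poly_Mapping.keys y)"
    unfolding edge_map_def lin_ext_def[of _ y] lookup_sum g_def
    by (intro sum.cong) simp_all
  also have "\<dots> = sum g {w \<in> Poly_Mapping.keys y. cond w}"
    by (rule sum.mono_neutral_right) (auto simp: g_def)
  also have "\<dots> = (\<Sum>(a, b)\<in>{(a, b) \<in> ?A \<times> ?A. a + b = c \<and> ?l y (p @ a # b # r) \<noteq> 0}.
    if a + b = c then merge_coeff [s] [t] a b * ?l y (p @ a # b # r) else 0)"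
  proof (rule sum.reindex_bij_witness[where
        i = "\<lambda>(a, b). p @ a # b # r" and j = "\<lambda>w. (w ! k, w ! Suc k)"])
    fix w assume "w \<in> {w \<in> Poly_Mapping.keys y. cond w}"
    then have w: "w \<in> Poly_Mapping.keys y" "cond w"
      by auto
    have len: "Suc k < length w" "w ! k \<in> ?A" "w ! Suc k \<in> ?A"
      using word[OF w(1)] k nth_mem[of k w] nth_mem[of "Suc k" w] by (simp, force+)
    have eq: "w = p @ w ! k # w ! Suc k # r"
      using w(2) len(1) unfolding cond_def by (metis Cons_nth_drop_Suc Suc_lessD append_take_drop_id)
    then show "(case (w ! k, w ! Suc k) of (a, b) \<Rightarrow> p @ a # b # r) = w"
      by simp
    have "(w ! k, w ! Suc k) \<in> ?A \<times> ?A"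
      by (rule SigmaI[OF len(2,3)])
    then show "(w ! k, w ! Suc k) \<in> {(a, b) \<in> ?A \<times> ?A. a + b = c \<and> ?l y (p @ a # b # r) \<noteq> 0}"
      using w eq[symmetric] by (simp add: cond_def in_keys_iff)
    show "(case (w ! k, w ! Suc k) of (a, b) \<Rightarrow> if a + b = c then merge_coeff [s] [t] a b * ?l y (p @ a # b # r) else 0) = g w"
      using w eq[symmetric] by (simp add: g_def cond_def mult.commute)
  next
    fix x assume "x \<in> {(a, b) \<in> ?A \<times> ?A. a + b = c \<and> ?l y (p @ a # b # r) \<noteq> 0}"
    then obtain a b where x: "x = (a, b)" "a + b = c" "?l y (p @ a # b # r) \<noteq> 0"
      by (cases x) auto
    show "((case x of (a, b) \<Rightarrow> p @ a # b # r) ! k, (case x of (a, b) \<Rightarrow> p @ a # b # r) ! Suc k) = x"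
      using p by (simp add: x(1) nth_append)
    show "(case x of (a, b) \<Rightarrow> p @ a # b # r) \<in> {w \<in> Poly_Mapping.keys y. cond w}"
      using x p by (simp add: cond_def in_keys_iff nth_append)
  qed
  also have "\<dots> = (\<Sum>(a, b)\<in>?A \<times> ?A. if a + b = c then merge_coeff [s] [t] a b * ?l y (p @ a # b # r) else 0)"
    by (rule sum.mono_neutral_left) (auto split: if_splits)
  also have "\<dots> = (\<Sum>a\<in>?A. \<Sum>b\<in>?A. if a + b = c then merge_coeff [s] [t] a b * ?l y (p @ a # b # r) else 0)"
    by (rule sum.cartesian_product[symmetric])
  finally show ?thesis .
qed

lemma kernel_equations:
  "inverse q_half * a + (- q_half) * b = 0 \<longleftrightarrow> a = q * b"
  "(- inverse q) * a + (b + (- q) * c) = 0 \<longleftrightarrow> b = inverse q * a + q * c"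
proof -
  have "inverse q_half * a + (- q_half) * b = inverse q_half * (a - q * b)"
    by (simp add: right_diff_distrib q_half_inverse_q flip: mult.assoc)
  then show "inverse q_half * a + (- q_half) * b = 0 \<longleftrightarrow> a = q * b"
    by simp
  show "(- inverse q) * a + (b + (- q) * c) = 0 \<longleftrightarrow> b = inverse q * a + q * c"
    by (simp add: algebra_simps eq_neg_iff_add_eq_0 add_eq_0_iff)
qed

lemma edge_map_singletons_eq_0_iff:
  assumes y: "valid (factor_seq m n) y" and k: "Suc k < m + n"
  shows "edge_map (singletons m n) k y = 0 \<longleftrightarrow>
    (\<forall>p. length p = k \<longrightarrow> pair_kernel (factor_seq m n ! k) (factor_seq m n ! Suc k) (slices p y))"
proof -
  let ?l = Poly_Mapping.lookup
  define s t where "s = dots m n ! k" and "t = dots m n ! Suc k"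
  have st: "s = t \<longleftrightarrow> factor_seq m n ! k = factor_seq m n ! Suc k" "s \<noteq> t \<Longrightarrow> s = Pos \<and> t = Neg"
    using k by (auto simp: s_def t_def nth_dots nth_factor_seq split: if_splits)
  note lookup = lookup_edge_map_singletons[OF y k, folded s_def t_def]
  have "pair_kernel (factor_seq m n ! k) (factor_seq m n ! Suc k) (slices p y) \<longleftrightarrow>
    (\<forall>c r. ?l (edge_map (singletons m n) k y) (p @ c # r) = 0)" if p: "length p = k" for p
  proof -
    have out: "?l (edge_map (singletons m n) k y) (p @ c # r) = 0" if "c \<notin> {-1, 0, 1}" for c r
      unfolding lookup[OF p] using that by (auto simp: merge_coeff_def)
    have "(\<forall>c r. ?l (edge_map (singletons m n) k y) (p @ c # r) = 0) \<longleftrightarrow>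
      (\<forall>r. ?l (edge_map (singletons m n) k y) (p @ -1 # r) = 0) \<and>
      (\<forall>r. ?l (edge_map (singletons m n) k y) (p @ 0 # r) = 0) \<and>
      (\<forall>r. ?l (edge_map (singletons m n) k y) (p @ 1 # r) = 0)"
      using out by (metis insertE singletonD)
    also have "\<dots> \<longleftrightarrow> pair_kernel (factor_seq m n ! k) (factor_seq m n ! Suc k) (slices p y)"
    proof (cases "s = t")
      case True
      then show ?thesis
        unfolding lookup[OF p] pair_kernel_def st(1)[symmetric] poly_mapping_eq_iff fun_eq_iff
        by (simp add: merge_coeff_def kernel_equations(1)[simplified])
    next
      case False
      then show ?thesis
        unfolding lookup[OF p] pair_kernel_def st(1)[symmetric] poly_mapping_eq_iff fun_eq_iff
        by (simp add: merge_coeff_def lookup_add kernel_equations(2)[simplified])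
    qed
    finally show ?thesis ..
  qed
  moreover have "edge_map (singletons m n) k y = 0 \<longleftrightarrow>
    (\<forall>p. length p = k \<longrightarrow> (\<forall>c r. ?l (edge_map (singletons m n) k y) (p @ c # r) = 0))" (is "?A \<longleftrightarrow> ?B")
  proof
    assume B: ?B
    show ?A
    proof (rule poly_mapping_eqI)
      fix u
      show "?l (edge_map (singletons m n) k y) u = ?l 0 u"
      proof (cases "k < length u")
        case True
        then have "u = take k u @ u ! k # drop (Suc k) u"
          by (rule id_take_nth_drop)
        then show ?thesis
          using B True by (metis length_take lookup_zero min.absorb4)
      next
        case False
        have "?l (edge_map (singletons m n) k (basis_vec w)) u = 0" if "w \<in> Poly_Mapping.keys y" for w
        proof -
          have "length w = m + n"
            using valid_factor_seq_word[OF y] that by (simp add: in_keys_iff)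
          then have "take k w @ [c] @ drop (Suc (Suc k)) w \<noteq> u" for c
            using False k by auto
          then show ?thesis
            unfolding edge_map_def lin_ext_basis unfolding lin_ext_def lookup_sum
            by (intro sum.neutral ballI) (simp add: lookup_single when_def)
        qed
        then show ?thesis
          unfolding edge_map_def lin_ext_def[of _ y] lookup_sum by simp
      qed
    qed
  qed simp
  ultimately show ?thesis
    by simp
qed

lemma cocycle_0_iff: "x \<in> carrier (C m n 0) \<and> differential x = 0 \<longleftrightarrow>
  (\<exists>y\<in>H0 m n. x = Poly_Mapping.single (singletons m n) y)"
proof -
  have "differential (Poly_Mapping.single (singletons m n) y) = 0 \<longleftrightarrow> harmonic (factor_seq m n) y"
    if "valid (factor_seq m n) y" for y
    unfolding differential_singletons_eq_0_iff harmonic_iff length_factor_seq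
    using edge_map_singletons_eq_0_iff[OF that] by auto
  then show ?thesis
    unfolding carrier_C_0 H0_def by auto
qed


section \<open>The cohomology\<close>

lemma cocycles_simps [simp]:
  "carrier (cocycles m n i) = {x \<in> carrier (C m n i). differential x = 0}"
  "x \<oplus>\<^bsub>cocycles m n i\<^esub> y = x + y" "\<zero>\<^bsub>cocycles m n i\<^esub> = 0"
  by (simp_all add: cocycles_def C_def)

lemma cohomology_zero: "\<zero>\<^bsub>cohomology m n i\<^esub> = coboundaries m n i"
  by (simp add: cohomology_def quotient_module_def)

lemma carrier_cohomology:
  "carrier (cohomology m n i) =
    (\<lambda>x. (\<lambda>b. b + x) ` coboundaries m n i) ` {x \<in> carrier (C m n i). differential x = 0}"
  by (auto simp: cohomology_def quotient_module_def A_RCOSETS_def' a_r_coset_def')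

lemma cohomology_vanishes:
  assumes "i \<noteq> 0"
  shows "carrier (cohomology m n i) = {\<zero>\<^bsub>cohomology m n i\<^esub>}"
proof -
  let ?Z = "{x \<in> carrier (C m n i). differential x = 0}"
  have B: "coboundaries m n i = ?Z"
    unfolding coboundaries_def using cocycle_is_coboundary[OF assms] differential_carrier differential_differential
    by auto
  have Z: "x + y \<in> ?Z" "- x \<in> ?Z" if "x \<in> ?Z" "y \<in> ?Z" for x y
    using that differential_add[of x m n i y] differential_uminus[of x m n i] by (simp_all add: C_add C_uminus)
  have "(\<lambda>b. b + x) ` ?Z = ?Z" if x: "x \<in> ?Z" for x
  proof
    show "(\<lambda>b. b + x) ` ?Z \<subseteq> ?Z"
      using Z(1)[OF _ x] by blast
    show "?Z \<subseteq> (\<lambda>b. b + x) ` ?Z"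
    proof
      fix b assume b: "b \<in> ?Z"
      then have "b + - x \<in> ?Z"
        by (rule Z(1)) (rule Z(2)[OF x x])
      then show "b \<in> (\<lambda>b. b + x) ` ?Z"
        by (intro image_eqI[of _ _ "b + - x"]) simp_all
    qed
  qed
  moreover have "0 \<in> ?Z"
    by (simp add: C_zero differential_0)
  ultimately show ?thesis
    unfolding carrier_cohomology cohomology_zero B by (intro equalityI image_subsetI) (auto intro!: image_eqI[of _ _ 0])
qed

lemma coboundaries_0: "coboundaries m n 0 = {0}"
proof -
  have "x = 0" if "x \<in> carrier (C m n (0 - 1))" for x
    using carrier_C_degree[OF that] by force
  then show ?thesis
    unfolding coboundaries_def using C_zero[of m n "0 - 1"] differential_0 by auto
qed

text \<open>As there are no coboundaries in degree \<open>0\<close>, the classes are the singletons \<open>{x}\<close> of cocycles.\<close>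

lemma is_V_cohomology_0: "is_V m n (cohomology m n 0)"
proof (rule is_V_transport[OF is_V_H0_module])
  let ?P = "singletons m n"
  define f :: "(int list \<Rightarrow>\<^sub>0 kk) \<Rightarrow> cochain set" where "f y = {Poly_Mapping.single ?P y}" for y
  have smult: "c \<odot>\<^bsub>cocycles m n 0\<^esub> Poly_Mapping.single ?P y = Poly_Mapping.single ?P (scale c y)" for c y
    by (simp add: cocycles_def C_def C_tilde_def)
  have act: "act (cocycles m n 0) g (Poly_Mapping.single ?P y) = Poly_Mapping.single ?P (tact (factor_seq m n) g y)" for g y
    by (simp add: cocycles_def C_def C_tilde_def map_block_factor_singletons)
  have carrier: "carrier (cohomology m n 0) = f ` H0 m n"
    unfolding carrier_cohomology coboundaries_0 cocycle_0_iff f_def by auto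
  show "bij_betw f (carrier (H0_module m n)) (carrier (cohomology m n 0))"
    unfolding bij_betw_def carrier by (auto simp: f_def inj_on_def dest!: injD[OF inj_single])
  show "f \<zero>\<^bsub>H0_module m n\<^esub> = \<zero>\<^bsub>cohomology m n 0\<^esub>"
    by (simp add: f_def cohomology_zero coboundaries_0)
  show "f (x \<oplus>\<^bsub>H0_module m n\<^esub> y) = f x \<oplus>\<^bsub>cohomology m n 0\<^esub> f y" for x y
    by (simp add: f_def cohomology_def quotient_module_def set_add_def set_mult_def single_add)
  show "f (c \<odot>\<^bsub>H0_module m n\<^esub> x) = c \<odot>\<^bsub>cohomology m n 0\<^esub> f x" for c x
    by (simp add: f_def cohomology_def quotient_module_def coboundaries_0 a_r_coset_def' smult)
  show "f (act (H0_module m n) g x) = act (cohomology m n 0) g (f x)" for g x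
    by (simp add: f_def cohomology_def quotient_module_def coboundaries_0 a_r_coset_def' act)
qed

theorem theorem3p9:
  fixes m n :: nat
  shows "(\<forall>i::int. i \<noteq> 0 \<longrightarrow> carrier (cohomology m n i) = {\<zero>\<^bsub>cohomology m n i\<^esub>}) \<and>
    is_V m n (cohomology m n 0) \<and>
    (\<forall>M :: 'v uq_module. is_V m n M \<longrightarrow> uq_isomorphic (cohomology m n 0) M)"
  by (intro conjI allI impI cohomology_vanishes is_V_cohomology_0 uq_isomorphic_is_V[OF is_V_cohomology_0])

end
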